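(* Let $\mathcal D>0$ with $\mathcal D\ne-\operatorname{Im}m_\infty(i)$, and consider all Schrödinger L-systems $\Theta_{\mu,h}$ ($\mu\in\mathbb R\cup\{\infty\}$) with coefficient of dissipation $\operatorname{Im}h=\mathcal D$ whose impedance function satisfies $V_{\Theta_{\mu,h}}(z)\in\mathfrak M_\kappa$ for some $0<\kappa<1$. An L-system $\Theta_{\mu,h}$ of this class has the maximum finite c-entropy $\mathcal S_{max}$ (among all L-systems of this class) if and only if it is determined by the parameters $$h=-\operatorname{Re}m_\infty(i)+i\mathcal D\quad\text{and}\quad \mu=\begin{cases}-\operatorname{Re}m_\infty(i), & \text{if }\mathcal D>-\operatorname{Im}m_\infty(i);\\ \infty, & \text{if }\mathcal D<-\operatorname{Im}m_\infty(i).\end{cases}$$ In this case $$\mathcal S_{max}=\ln|\mathcal D-\operatorname{Im}m_\infty(i)|-\ln|\mathcal D+\operatorname{Im}m_\infty(i)|.$$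
   Context: Setting. Let $\ell\in\mathbb R$, let $q$ be a (fixed) real locally summable function on $[\ell,+\infty)$, $l(y)=-y''+q(x)y$, $\mathcal H=L_2(\ell,+\infty)$. Let $D^*$ be the set of $y\in\mathcal H$ that are locally absolutely continuous together with $y'$ and satisfy $l(y)\in\mathcal H$. The minimal symmetric operator $\dot A y=l(y)$ with boundary conditions $y(\ell)=y'(\ell)=0$ is assumed to have deficiency indices $(1,1)$; $\operatorname{Dom}(\dot A^* )=D^*$, $\dot A^*y=l(y)$. For $h\in\mathbb C$ with $\operatorname{Im}h>0$, $T_h y=l(y)$ with domain $\{y\in D^*: y'(\ell)=hy(\ell)\}$. Weyl function. Let $\varphi_1,\varphi_2$ solve $l(\varphi_k)=\lambda\varphi_k$ with $\varphi_1(\ell,\lambda)=0,\varphi_1'(\ell,\lambda)=1$, $\varphi_2(\ell,\lambda)=-1,\varphi_2'(\ell,\lambda)=0$. The Weyl function $m_\infty(\lambda)$ is such that $\varphi_2(\cdot,\lambda)+m_\infty(\lambda)\varphi_1(\cdot,\lambda)\in L_2(\ell,+\infty)$. One has $\operatorname{Im}m_\infty(i)<0$. Schrödinger L-systems. $\mathcal H_+=D^*$ with $(y,z)_+=\int_\ell^\infty (y\bar z+l(y)\overline{l(z)})dx$, and $\mathcal H_+\subset\mathcal H\subset\mathcal H_-$ is the corresponding rigged triplet; $\delta(x-\ell),\delta'(x-\ell)\in\mathcal H_-$ act by $(y,\delta)=y(\ell)$, $(y,\delta')=-y'(\ell)$. For $\mu\in\mathbb R\cup\{\infty\}$ put $\mathbb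 A_{\mu,h}y=-y''+q y-\frac1{\mu-h}[y'(\ell)-hy(\ell)][\mu\delta(x-\ell)+\delta'(x-\ell)]$ and $g=\frac{(\operatorname{Im}h)^{1/2}}{|\mu-h|}[\mu\delta(x-\ell)+\delta'(x-\ell)]$ (limits as $\mu\to\infty$ if $\mu=\infty$), $Kc=cg$ for $c\in\mathbb C$; then $\operatorname{Im}\mathbb A_{\mu,h}=KK^*$. The array $\Theta_{\mu,h}=(\mathbb A_{\mu,h},K,1;\ \mathcal H_+\subset\mathcal H\subset\mathcal H_-,\mathbb C)$ is the Schrödinger L-system with main operator $T_h$ and state-space operator $\mathbb A_{\mu,h}$. Its transfer function is $W_{\Theta_{\mu,h}}(z)=I-2iK^*(\mathbb A_{\mu,h}-zI)^{-1}K=\frac{\mu-h}{\mu-\bar h}\cdot\frac{m_\infty(z)+\bar h}{m_\infty(z)+h}$ and its impedance function is $V_{\Theta_{\mu,h}}(z)=K^*(\operatorname{Re}\mathbb A_{\mu,h}-zI)^{-1}K=\frac{(m_\infty(z)+\mu)\operatorname{Im}h}{(\mu-\operatorname{Re}h)m_\infty(z)+\mu\operatorname{Re}h-|h|^2}$ (limits as $\mu\to\infty$ if $\mu=\infty$). The coefficient of dissipation of $\Theta_{\mu,h}$ (and of $T_h$) is $\mathcal D=\operatorname{Im}h$. The c-entropy of $\Theta_{\mu,h}$ is $\mathcal S=-\ln|W_{\Theta_{\mu,h}}(-i)|$; it equals $-\ln|\kappa|$ where $|\kappa|=\left|\frac{m_\infty(i)+h}{m_\infty(i)+\bar h}\right|<1$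 is the modulus of von Neumann's parameter of $T_h$. Generalized Donoghue class. For $0\le\kappa<1$, $\mathfrak M_\kappa$ is the class of all Herglotz-Nevanlinna functions $M(z)=\int_{\mathbb R}\left(\frac1{\lambda-z}-\frac{\lambda}{1+\lambda^2}\right)d\sigma(\lambda)$, $\sigma$ an infinite Borel measure with $\int_{\mathbb R}\frac{d\sigma(\lambda)}{1+\lambda^2}=\frac{1-\kappa}{1+\kappa}$ (equivalently, $M(i)=i\frac{1-\kappa}{1+\kappa}$). *)

theory Defs
  imports "HOL-Analysis.Analysis" "HOL-Library.Function_Algebras"
begin

section \<open>The differential expression on the half-line\<close>

definition absolutely_continuous_on :: "real \<Rightarrow> real \<Rightarrow> (real \<Rightarrow> complex) \<Rightarrow> bool" where
  "absolutely_continuous_on a b f \<longleftrightarrow>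
     (\<forall>\<epsilon>>0. \<exists>\<delta>>0. \<forall>(n::nat) u v.
        (\<forall>i<n. a \<le> u i \<and> u i \<le> v i \<and> v i \<le> b) \<longrightarrow>
        disjoint_family_on (\<lambda>i. {u i<..<v i}) {..<n} \<longrightarrow>
        (\<Sum>i<n. v i - u i) < \<delta> \<longrightarrow>
        (\<Sum>i<n. cmod (f (v i) - f (u i))) < \<epsilon>)"

definition locally_absolutely_continuous :: "real \<Rightarrow> (real \<Rightarrow> complex) \<Rightarrow> bool" where
  "locally_absolutely_continuous l f \<longleftrightarrow> (\<forall>b\<ge>l. absolutely_continuous_on l b f)"

definition locally_summable :: "real \<Rightarrow> (real \<Rightarrow> real) \<Rightarrow> bool" where
  "locally_summable l q \<longleftrightarrow> (\<forall>b\<ge>l. set_integrable lebesgue {l..b} q)"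

definition L2_half_line :: "real \<Rightarrow> (real \<Rightarrow> complex) set" where
  "L2_half_line l = {f. set_borel_measurable lebesgue {l..} f \<and>
                        set_integrable lebesgue {l..} (\<lambda>x. (cmod (f x))\<^sup>2)}"

definition L2_inner :: "real \<Rightarrow> (real \<Rightarrow> complex) \<Rightarrow> (real \<Rightarrow> complex) \<Rightarrow> complex" where
  "L2_inner l f g = (LINT x:{l..}|lebesgue. f x * cnj (g x))"

text \<open>Derivatives are taken within \<open>[l, \<infinity>)\<close>; at the end point they are right derivatives.\<close>

definition dif :: "real \<Rightarrow> (real \<Rightarrow> complex) \<Rightarrow> real \<Rightarrow> complex" where
  "dif l y x = vector_derivative y (at x within {l..})"

text \<open>For \<open>y\<close> with locally absolutely continuous \<open>y'\<close> the second derivative exists almost everywhere;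
  the values of \<open>diff_expr l q y\<close> on the exceptional null set are irrelevant.\<close>

definition diff_expr :: "real \<Rightarrow> (real \<Rightarrow> real) \<Rightarrow> (real \<Rightarrow> complex) \<Rightarrow> real \<Rightarrow> complex" where
  "diff_expr l q y x = - dif l (dif l y) x + of_real (q x) * y x"

text \<open>Functions on \<open>[l, \<infinity>)\<close> are total functions on the reals. Continuous ones are normalised to
  vanish to the left of \<open>l\<close>, so that each of them has exactly one representative.\<close>

definition regular :: "real \<Rightarrow> (real \<Rightarrow> complex) \<Rightarrow> bool" where
  "regular l y \<longleftrightarrow>
     (\<forall>x<l. y x = 0) \<and>
     (\<forall>x\<ge>l. y differentiable (at x within {l..})) \<and>
     locally_absolutely_continuous l y \<and>
     locally_absolutely_continuous l (dif l y)"

definition D_star :: "real \<Rightarrow> (real \<Rightarrow> real) \<Rightarrow> (real \<Rightarrow> complex) set" where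
  "D_star l q = {y. regular l y \<and> y \<in> L2_half_line l \<and> diff_expr l q y \<in> L2_half_line l}"

text \<open>The adjoint of the minimal operator is the maximal operator \<open>y \<mapsto> diff_expr l q y\<close> on
  \<open>D_star l q\<close>, so its deficiency subspaces are the kernels of the maximal operator minus
  \<open>\<i>\<close> and minus \<open>-\<i>\<close>.\<close>

definition deficiency_space :: "real \<Rightarrow> (real \<Rightarrow> real) \<Rightarrow> complex \<Rightarrow> (real \<Rightarrow> complex) set" where
  "deficiency_space l q z =
     {y \<in> D_star l q. AE x in lebesgue. x \<ge> l \<longrightarrow> diff_expr l q y x = z * y x}"

definition complex_fun_dim :: "(real \<Rightarrow> complex) set \<Rightarrow> nat" where
  "complex_fun_dim = vector_space.dim (\<lambda>(c::complex) y x. c * y x)"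

definition deficiency_indices :: "real \<Rightarrow> (real \<Rightarrow> real) \<Rightarrow> nat \<times> nat" where
  "deficiency_indices l q =
     (complex_fun_dim (deficiency_space l q \<i>), complex_fun_dim (deficiency_space l q (- \<i>)))"

section \<open>The Weyl function\<close>

definition ode_solution :: "real \<Rightarrow> (real \<Rightarrow> real) \<Rightarrow> complex \<Rightarrow> (real \<Rightarrow> complex) \<Rightarrow> bool" where
  "ode_solution l q z y \<longleftrightarrow>
     regular l y \<and> (AE x in lebesgue. x \<ge> l \<longrightarrow> diff_expr l q y x = z * y x)"

definition phi1 :: "real \<Rightarrow> (real \<Rightarrow> real) \<Rightarrow> complex \<Rightarrow> real \<Rightarrow> complex" where
  "phi1 l q z = (THE y. ode_solution l q z y \<and> y l = 0 \<and> dif l y l = 1)"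

definition phi2 :: "real \<Rightarrow> (real \<Rightarrow> real) \<Rightarrow> complex \<Rightarrow> real \<Rightarrow> complex" where
  "phi2 l q z = (THE y. ode_solution l q z y \<and> y l = -1 \<and> dif l y l = 0)"

text \<open>Meaningful for \<open>z\<close> off the real axis.\<close>

definition m_infinity :: "real \<Rightarrow> (real \<Rightarrow> real) \<Rightarrow> complex \<Rightarrow> complex" where
  "m_infinity l q z = (THE m. (\<lambda>x. phi2 l q z x + m * phi1 l q z x) \<in> L2_half_line l)"

section \<open>L-systems\<close>

text \<open>An element \<open>\<psi>\<close> of \<open>H\<^sub>-\<close> is represented by the antilinear functional
  \<open>f \<mapsto> (\<psi>, f)\<close>, the complex conjugate of \<open>(f, \<psi>)\<close>, on \<open>H\<^sub>+\<close>. Two elements agree iff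
  the functionals agree on \<open>H\<^sub>+\<close>, and \<open>y\<close> in \<open>H\<close> is embedded as \<open>f \<mapsto> (y, f)\<close>.\<close>

type_synonym functional = "(real \<Rightarrow> complex) \<Rightarrow> complex"

record l_system =
  H_plus :: "(real \<Rightarrow> complex) set"
  H_inner :: "(real \<Rightarrow> complex) \<Rightarrow> (real \<Rightarrow> complex) \<Rightarrow> complex"
  state_op :: "(real \<Rightarrow> complex) \<Rightarrow> functional"
  channel_op :: "complex \<Rightarrow> functional"

text \<open>The adjoint is determined by \<open>(A\<^sup>* y, f) = (y, A f)\<close> for \<open>y\<close>, \<open>f\<close> in \<open>H\<^sub>+\<close>.\<close>

definition op_adjoint :: "((real \<Rightarrow> complex) \<Rightarrow> functional) \<Rightarrow> (real \<Rightarrow> complex) \<Rightarrow> functional" where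
  "op_adjoint A y f = cnj (A f y)"

definition op_re :: "((real \<Rightarrow> complex) \<Rightarrow> functional) \<Rightarrow> (real \<Rightarrow> complex) \<Rightarrow> functional" where
  "op_re A y f = (A y f + op_adjoint A y f) / 2"

text \<open>\<open>K\<^sup>*\<close> maps \<open>H\<^sub>+\<close> to the complex numbers and is determined by \<open>(K c, f) = c * cnj (K\<^sup>* f)\<close>.\<close>

definition channel_adjoint :: "(complex \<Rightarrow> functional) \<Rightarrow> (real \<Rightarrow> complex) \<Rightarrow> complex" where
  "channel_adjoint K f = cnj (K 1 f)"

definition resolvent ::
  "l_system \<Rightarrow> ((real \<Rightarrow> complex) \<Rightarrow> functional) \<Rightarrow> complex \<Rightarrow> functional \<Rightarrow> real \<Rightarrow> complex" where
  "resolvent \<Theta> A z \<psi> =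
     (THE y. y \<in> H_plus \<Theta> \<and> (\<forall>f\<in>H_plus \<Theta>. A y f - z * H_inner \<Theta> y f = \<psi> f))"

definition transfer_function :: "l_system \<Rightarrow> complex \<Rightarrow> complex" where
  "transfer_function \<Theta> z =
     1 - 2 * \<i> * channel_adjoint (channel_op \<Theta>)
                   (resolvent \<Theta> (state_op \<Theta>) z (channel_op \<Theta> 1))"

definition impedance_function :: "l_system \<Rightarrow> complex \<Rightarrow> complex" where
  "impedance_function \<Theta> z =
     channel_adjoint (channel_op \<Theta>) (resolvent \<Theta> (op_re (state_op \<Theta>)) z (channel_op \<Theta> 1))"

definition c_entropy :: "l_system \<Rightarrow> ereal" where
  "c_entropy \<Theta> =
     (if transfer_function \<Theta> (- \<i>) = 0 then \<infinity>
      else ereal (- ln (cmod (transfer_function \<Theta> (- \<i>)))))"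

section \<open>Schroedinger L-systems\<close>

datatype ext_real_param = Fin real | Infty

definition delta :: "real \<Rightarrow> functional" where
  "delta l f = cnj (f l)"

definition delta' :: "real \<Rightarrow> functional" where
  "delta' l f = - cnj (dif l f l)"

text \<open>The clauses for \<open>Infty\<close> are the limits as \<open>\<mu>\<close> tends to \<open>+\<infinity>\<close>. (For \<open>\<mu>\<close> tending to \<open>-\<infinity>\<close>
  the vector \<open>g\<close> changes sign, which affects neither the transfer nor the impedance function.)\<close>

fun state_space_op ::
  "real \<Rightarrow> (real \<Rightarrow> real) \<Rightarrow> ext_real_param \<Rightarrow> complex \<Rightarrow> (real \<Rightarrow> complex) \<Rightarrow> functional" where
  "state_space_op l q (Fin \<mu>) h y f =
     L2_inner l (diff_expr l q y) f
     - (dif l y l - h * y l) / (of_real \<mu> - h) * (of_real \<mu> * delta l f + delta' l f)"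
| "state_space_op l q Infty h y f =
     L2_inner l (diff_expr l q y) f - (dif l y l - h * y l) * delta l f"

fun channel_vector :: "real \<Rightarrow> ext_real_param \<Rightarrow> complex \<Rightarrow> functional" where
  "channel_vector l (Fin \<mu>) h f =
     of_real (sqrt (Im h) / cmod (of_real \<mu> - h)) * (of_real \<mu> * delta l f + delta' l f)"
| "channel_vector l Infty h f = of_real (sqrt (Im h)) * delta l f"

definition schroedinger_system ::
  "real \<Rightarrow> (real \<Rightarrow> real) \<Rightarrow> ext_real_param \<Rightarrow> complex \<Rightarrow> l_system" where
  "schroedinger_system l q \<mu> h =
     \<lparr> H_plus = D_star l q, H_inner = L2_inner l,
       state_op = state_space_op l q \<mu> h,
       channel_op = (\<lambda>c f. c * channel_vector l \<mu> h f) \<rparr>"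

section \<open>The generalized Donoghue classes\<close>

text \<open>The integral converges because of the condition on \<open>\<sigma>\<close>, and any function given by it off the
  real axis is Herglotz-Nevanlinna; the values on the real axis are unconstrained.\<close>

definition donoghue_class :: "real \<Rightarrow> (complex \<Rightarrow> complex) set" where
  "donoghue_class \<kappa> = {M. \<exists>\<sigma> :: real measure.
     sets \<sigma> = sets borel \<and> emeasure \<sigma> UNIV = \<infinity> \<and>
     integrable \<sigma> (\<lambda>t. 1 / (1 + t\<^sup>2)) \<and>
     (LINT t|\<sigma>. 1 / (1 + t\<^sup>2)) = (1 - \<kappa>) / (1 + \<kappa>) \<and>
     (\<forall>z. Im z \<noteq> 0 \<longrightarrow>
        M z = (LINT t|\<sigma>. 1 / (of_real t - z) - of_real t / (1 + (of_real t)\<^sup>2)))}"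

section \<open>Maximal c-entropy\<close>

definition in_entropy_class ::
  "real \<Rightarrow> (real \<Rightarrow> real) \<Rightarrow> real \<Rightarrow> ext_real_param \<Rightarrow> complex \<Rightarrow> bool" where
  "in_entropy_class l q \<D> \<mu> h \<longleftrightarrow>
     Im h = \<D> \<and>
     (\<exists>\<kappa>. 0 < \<kappa> \<and> \<kappa> < 1 \<and> impedance_function (schroedinger_system l q \<mu> h) \<in> donoghue_class \<kappa>)"

definition has_max_finite_entropy ::
  "real \<Rightarrow> (real \<Rightarrow> real) \<Rightarrow> real \<Rightarrow> ext_real_param \<Rightarrow> complex \<Rightarrow> bool" where
  "has_max_finite_entropy l q \<D> \<mu> h \<longleftrightarrow>
     in_entropy_class l q \<D> \<mu> h \<and>
     \<bar>c_entropy (schroedinger_system l q \<mu> h)\<bar> \<noteq> \<infinity> \<and>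
     (\<forall>\<mu>' h'. in_entropy_class l q \<D> \<mu>' h' \<longrightarrow>
        c_entropy (schroedinger_system l q \<mu>' h') \<le> c_entropy (schroedinger_system l q \<mu> h))"

end

theory Submission
  imports Defs "HOL-Probability.Probability" "HOL-Complex_Analysis.Complex_Analysis"
begin

text \<open>
  Write \<open>m\<close> for the value \<open>m_infinity l q \<i>\<close> of the Weyl function, so that \<open>Im m < 0\<close>. The entropy and
  the impedance function of a system are explicit expressions in the Weyl function
  (\<open>c_entropy_formula\<close>, \<open>impedance_formula\<close>). The entropy is minus the logarithm of the modulus
  of \<open>(m + h) / (m + cnj h)\<close> and does not involve \<open>\<mu>\<close>. For fixed \<open>Im h = \<D>\<close> the square of this modulus is
  \<open>(X + (\<D> + Im m)\<^sup>2) / (X + (\<D> - Im m)\<^sup>2)\<close> with \<open>X = (Re m + Re h)\<^sup>2\<close>, which is smallest exactly for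
  \<open>X = 0\<close> (\<open>von_neumann_ratio_minimal\<close>). It remains to see that for \<open>Re h = - Re m\<close> exactly one
  parameter \<open>\<mu>\<close> leads to an impedance function in a generalized Donoghue class. Such a function has
  a value of the form \<open>\<i> t\<close> with \<open>0 < t < 1\<close> at \<open>\<i>\<close>, and this determines \<open>\<mu>\<close> (\<open>class_mu_unique\<close>).

  That the system so determined is indeed in the class (\<open>optimum_in_class\<close>) is the harder half: the
  impedance function must be shown to be a Herglotz integral without linear term whose measure is
  infinite. Herglotz's theorem is derived on the disc from the Schwarz formula and Helly's selection
  theorem, and moved to the half-plane. The two asymptotic conditions that single out the class
  (\<open>donoghue_classI\<close>) follow from a Hilbert space argument: an impedance function is an inner product
  of Weyl solutions, and testing these against functions of small norm with prescribed boundary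
  values (\<open>cutoff\<close>) controls them along the imaginary axis.

  The formulas for the systems rest on Lagrange's identity on the whole half-line
  (\<open>Lagrange_half_line\<close>), that is, on the absence of a boundary term at infinity. Deficiency indices
  \<open>(1, 1)\<close> provide a solution that is not square integrable; comparing Wronskians with it and with its
  conjugate, by means of the Pluecker identity, shows that all Wronskians of functions in \<open>D_star l q\<close>
  tend to zero. The Weyl solution is a limit of solutions that vanish at more and more distant points
  (\<open>Weyl_nested\<close>), and the resolvents in the definitions of the transfer and impedance functions are
  multiples of it.

  Since \<open>q\<close> is only locally summable, solutions have merely an absolutely continuous derivative. Picard
  iteration still converges (\<open>volterra\<close>), and the calculus needed for Lagrange's identity is the
  fundamental theorem for absolutely continuous functions (\<open>ac_FTC\<close>). It is proved from the
  Radon-Nikodym theorem, applied to the positive variation, together with Lebesgue's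
  differentiation theorem, which comes from Vitali coverings.
\<close>

section \<open>Lebesgue differentiation on the line\<close>

text \<open>A bounded function has a small integral over a small set, and an integrable function is bounded
up to an arbitrarily small error in the mean: truncate it at height \<open>k\<close>.\<close>

lemma integral_small_on_small_sets:
  fixes f :: "'a \<Rightarrow> real"
  assumes f: "integrable M f" "\<And>x. 0 \<le> f x" and e: "e > 0"
  obtains d where "d > 0"
    "\<And>T. T \<in> fmeasurable M \<Longrightarrow> measure M T < d \<Longrightarrow> (LINT x:T|M. f x) < e"
proof -
  have [measurable]: "f \<in> borel_measurable M" using f by auto
  define h where "h k x = min (f x) (real k)" for k x
  have hint: "integrable M (h k)" for k
    unfolding h_def by (rule Bochner_Integration.integrable_bound[OF f(1)]) (auto simp: f(2))
  have "(\<lambda>k. integral\<^sup>L M (h k)) \<longlonglongrightarrow> integral\<^sup>L M f"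
  proof (rule integral_dominated_convergence[where w=f])
    show "AE x in M. (\<lambda>k. h k x) \<longlonglongrightarrow> f x"
    proof (rule AE_I2)
      fix x
      obtain n :: nat where "f x \<le> real n" using real_arch_simple by blast
      then have "\<forall>\<^sub>F k in sequentially. h k x = f x"
        unfolding h_def eventually_sequentially by (intro exI[of _ n]) auto
      then show "(\<lambda>k. h k x) \<longlonglongrightarrow> f x" by (rule tendsto_eventually)
    qed
    show "h k \<in> borel_measurable M" for k using hint[of k] by auto
  qed (auto simp: f h_def)
  then have "\<forall>\<^sub>F k in sequentially. integral\<^sup>L M (h k) > integral\<^sup>L M f - e/2"
    using e by (intro order_tendstoD(1)) auto
  then obtain k where k: "integral\<^sup>L M f - integral\<^sup>L M (h k) < e/2"
    using eventually_happens'[OF sequentially_bot] by (smt (verit, best))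
  define d where "d = e / (2 * (real k + 1))"
  show ?thesis
  proof
    show "d > 0" using e by (simp add: d_def)
    fix T assume T: "T \<in> fmeasurable M" "measure M T < d"
    then have TM: "T \<in> sets M" and fin: "emeasure M T < \<infinity>" by (auto simp: fmeasurable_def)
    have I: "set_integrable M T f" "set_integrable M T (h k)"
      using integrable_mult_indicator[OF TM f(1)] integrable_mult_indicator[OF TM hint]
      by (auto simp: set_integrable_def)
    have "(LINT x:T|M. f x) - (LINT x:T|M. h k x) = (LINT x:T|M. f x - h k x)"
      using I by (simp add: set_integral_diff)
    also have "\<dots> \<le> (LINT x|M. f x - h k x)"
      unfolding set_lebesgue_integral_def
    proof (rule integral_mono)
      show "integrable M (\<lambda>x. indicator T x *\<^sub>R (f x - h k x))"
        using set_integral_diff(1)[OF I] by (simp add: set_integrable_def)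
      show "integrable M (\<lambda>x. f x - h k x)" using f hint by auto
      show "indicator T x *\<^sub>R (f x - h k x) \<le> f x - h k x" for x
        by (auto simp: indicator_def h_def)
    qed
    also have "\<dots> < e/2" using k f hint by simp
    finally have 1: "(LINT x:T|M. f x) - (LINT x:T|M. h k x) < e/2" .
    have cint: "set_integrable M T (\<lambda>x. real k)"
      using TM fin by (auto simp: set_integrable_def)
    have "(LINT x:T|M. h k x) \<le> (LINT x:T|M. real k)"
      by (rule set_integral_mono[OF I(2) cint]) (auto simp: h_def)
    also have "\<dots> = real k * measure M T"
      using TM fin by (simp add: set_lebesgue_integral_def measure_def mult.commute)
    also have "\<dots> \<le> real k * d" using T by (intro mult_left_mono) auto
    also have "\<dots> \<le> e/2" using e by (simp add: d_def field_simps)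
    finally show "(LINT x:T|M. f x) < e" using 1 by linarith
  qed
qed

lemma integral_diff_interval:
  fixes g :: "real \<Rightarrow> 'a::euclidean_space"
  assumes "g absolutely_integrable_on {a..b}" "a \<le> u" "u \<le> v" "v \<le> b"
  shows "integral {a..v} g - integral {a..u} g = integral {u..v} g"
proof -
  have "g integrable_on {a..v}"
    using absolutely_integrable_on_subinterval[OF assms(1), of a v] assms set_lebesgue_integral_eq_integral(1) by auto
  then have "integral {a..u} g + integral {u..v} g = integral {a..v} g"
    using assms by (intro Henstock_Kurzweil_Integration.integral_combine) auto
  then show ?thesis by (simp add: algebra_simps)
qed

text \<open>Lebesgue's differentiation theorem is obtained from the Vitali covering theorem. On the set in
question \<open>g\<close> is below \<open>p\<close>, but arbitrarily short intervals at its points carry a mean value of \<open>g\<close>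
above \<open>q\<close>. Cover it, up to a null set, by disjoint intervals of this kind that lie inside an open
set \<open>U\<close> approximating \<open>{x. g x < p}\<close> from outside. For finitely many of them, with union \<open>T\<close>,
the integral of \<open>g\<close> over \<open>T\<close> is at least \<open>q\<close> times the measure of \<open>T\<close>, and at most \<open>p\<close> times this
measure plus a contribution of the small set \<open>U - {x. g x < p}\<close>. So \<open>T\<close> is small.\<close>

lemma upper_slope_exceeds_negligible:
  fixes g :: "real \<Rightarrow> real"
  assumes g: "g absolutely_integrable_on {a..b}" and pq: "p < q"
  shows "negligible {x \<in> {a<..<b}. g x < p \<and>
     (\<forall>d>0. \<exists>y\<in>{a..b}. y \<noteq> x \<and> \<bar>y - x\<bar> < d \<and>
        (integral {a..y} g - integral {a..x} g) / (y - x) > q)}" (is "negligible ?A")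
proof -
  define B where "B = {x \<in> {a..b}. g x < p}"
  have gm: "g \<in> borel_measurable (lebesgue_on {a..b})"
    using absolutely_integrable_measurable_real[of "{a..b}" g] g by auto
  have "{x \<in> space (lebesgue_on {a..b}). g x < p} \<in> sets (lebesgue_on {a..b})"
    using gm by measurable
  then have Bs: "B \<in> sets lebesgue"
    by (simp add: B_def sets_restrict_space_iff)
  \<comment> \<open>Off the set where g is below p, the function g exceeds p by at most w.\<close>
  define w where "w x = indicator {a..b} x * (\<bar>g x\<bar> + \<bar>p\<bar>)" for x
  have wint: "integrable lebesgue w"
  proof -
    have "set_integrable lebesgue {a..b} (\<lambda>x. \<bar>g x\<bar> + \<bar>p\<bar>)"
      using g by (intro set_integral_add(1) set_integrable_abs) auto
    then show ?thesis by (simp add: set_integrable_def w_def[abs_def])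
  qed
  have wpos: "w x \<ge> 0" for x by (simp add: w_def)
  show ?thesis
    unfolding negligible_outer_le
  proof (intro allI impI)
    fix e :: real assume e: "e > 0"
    then have e': "e * (q - p) > 0" using pq by simp
    obtain d where d: "d > 0" and dT: "\<And>T. T \<in> lmeasurable \<Longrightarrow> measure lebesgue T < d \<Longrightarrow>
        (LINT x:T|lebesgue. w x) < e * (q - p)"
      using integral_small_on_small_sets[OF wint wpos e'] by metis
    obtain U where U: "open U" "B \<subseteq> U" "U - B \<in> lmeasurable" "emeasure lebesgue (U - B) < ennreal d"
      using sets_lebesgue_outer_open[OF Bs d] by metis
    have UB: "(LINT x:U-B|lebesgue. w x) < e * (q - p)"
    proof (rule dT[OF U(3)])
      show "measure lebesgue (U - B) < d"
        using U(4) d by (metis emeasure_eq_measure2 U(3) ennreal_less_iff measure_nonneg)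
    qed
    \<comment> \<open>The covering intervals, encoded by their end points; as balls they have the midpoint as centre.\<close>
    define K where "K = {(s,t). s < t \<and> {s..t} \<subseteq> U \<and> {s..t} \<subseteq> {a..b} \<and> integral {s..t} g > q * (t - s)}"
    define I where "I = (\<lambda>(s::real,t::real). {s..t})"
    have cb: "cball ((fst i + snd i)/2) ((snd i - fst i)/2) = I i" for i
      by (auto simp: I_def cball_eq_atLeastAtMost field_simps split: prod.splits)
    have Gdiff: "integral {a..t} g - integral {a..s} g = integral {s..t} g" if "a \<le> s" "s \<le> t" "t \<le> b" for s t
      using integral_diff_interval[OF g that] .
    obtain C where C: "countable C" "C \<subseteq> K"
      "pairwise (\<lambda>i j. disjnt (cball ((fst i + snd i)/2) ((snd i - fst i)/2)) (cball ((fst j + snd j)/2) ((snd j - fst j)/2))) C"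
      "negligible (?A - (\<Union>i\<in>C. cball ((fst i + snd i)/2) ((snd i - fst i)/2)))"
    proof (rule Vitali_covering_theorem_cballs[of K "\<lambda>i. (snd i - fst i)/2" ?A "\<lambda>i. (fst i + snd i)/2"])
      show "0 < (snd i - fst i)/2" if "i \<in> K" for i using that by (auto simp: K_def)
      fix x r :: real assume x: "x \<in> ?A" and r: "r > 0"
      then have "x \<in> B" by (auto simp: B_def)
      then obtain r' where r': "r' > 0" "ball x r' \<subseteq> U" using U by (meson open_contains_ball subsetD)
      obtain y where y: "y \<in> {a..b}" "y \<noteq> x" "\<bar>y - x\<bar> < min r r'"
        "(integral {a..y} g - integral {a..x} g) / (y - x) > q"
        using x r r' by (auto dest!: spec[of _ "min r r'"])
      define s t where "s = min x y" and "t = max x y"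
      have st: "s < t" "s \<in> {a..b}" "t \<in> {a..b}" "t - s = \<bar>y - x\<bar>" "x \<in> {s..t}"
        using y x by (auto simp: s_def t_def)
      have "{s..t} \<subseteq> ball x r'" using y by (auto simp: s_def t_def dist_real_def)
      moreover have "integral {s..t} g > q * (t - s)"
      proof (cases "x < y")
        case True
        then have "s = x" "t = y" by (auto simp: s_def t_def)
        then show ?thesis using y True Gdiff[of x y] x by (auto simp: field_simps)
      next
        case False
        then have "s = y" "t = x" using y by (auto simp: s_def t_def)
        then show ?thesis using y False Gdiff[of y x] x by (auto simp: field_simps)
      qed
      ultimately have "(s,t) \<in> K" using st r' by (auto simp: K_def)
      then show "\<exists>i. i \<in> K \<and> x \<in> cball ((fst i + snd i)/2) ((snd i - fst i)/2) \<and> (snd i - fst i)/2 < r"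
        unfolding cb using st y by (intro exI[of _ "(s,t)"]) (auto simp: I_def)
    qed blast
    have disj: "disjoint_family_on I C"
      using C(3) by (auto simp: cb disjoint_family_on_def pairwise_def disjnt_def)
    have djF: "disjoint_family_on I F" if "F \<subseteq> C" for F
      using disj that by (rule disjoint_family_on_mono[rotated])
    have fin: "measure lebesgue (\<Union>(I ` F)) \<le> e" if F: "F \<subseteq> C" "finite F" for F
    proof -
      define T where "T = \<Union>(I ` F)"
      have FK: "F \<subseteq> K" using F C by auto
      have Isub: "I i \<subseteq> U" "I i \<subseteq> {a..b}" "I i \<in> sets lebesgue" "I i \<in> lmeasurable" if "i \<in> F" for i
        using that FK by (auto simp: I_def K_def)
      have Tm: "T \<in> lmeasurable" unfolding T_def using F Isub by (intro fmeasurable.finite_UN) auto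
      have Tsub: "T \<subseteq> U" "T \<subseteq> {a..b}" using Isub unfolding T_def by blast+
      have gi: "set_integrable lebesgue (I i) g" if "i \<in> F" for i
        using g Isub[OF that] by (meson set_integrable_subset)
      have "q * measure lebesgue T = (\<Sum>i\<in>F. q * measure lebesgue (I i))"
        unfolding T_def
        by (subst measure_finite_Union)
           (use F Isub djF fmeasurableD2[OF Isub(4)] in \<open>auto simp: sum_distrib_left simp del: emeasure_completion\<close>)
      also have "\<dots> \<le> (\<Sum>i\<in>F. LINT x:I i|lebesgue. g x)"
      proof (rule sum_mono)
        fix i assume i: "i \<in> F"
        then have "i \<in> K" using FK by auto
        then show "q * measure lebesgue (I i) \<le> (LINT x:I i|lebesgue. g x)"
          using gi[OF i] by (auto simp: set_lebesgue_integral_eq_integral I_def K_def)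
      qed
      also have "\<dots> = (LINT x:T|lebesgue. g x)"
        unfolding T_def
        by (rule set_integral_finite_Union[symmetric])
           (use F gi Isub djF in auto)
      also have "\<dots> \<le> (LINT x:T|lebesgue. p + indicator (U - B) x * w x)"
      proof (rule set_integral_mono)
        show "set_integrable lebesgue T g" using g Tsub Tm by (meson fmeasurableD set_integrable_subset)
        have "integrable lebesgue (\<lambda>x. indicator (U - B) x *\<^sub>R w x)"
          using U(3) by (intro integrable_mult_indicator wint) auto
        then have "set_integrable lebesgue T (\<lambda>x. indicator (U - B) x * w x)"
          using Tm unfolding set_integrable_def by (intro integrable_mult_indicator) auto
        moreover have "set_integrable lebesgue T (\<lambda>x. p)"
          using Tm by (auto simp: set_integrable_def fmeasurable_def)
        ultimately show "set_integrable lebesgue T (\<lambda>x. p + indicator (U - B) x * w x)" by auto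
        fix x assume "x \<in> T"
        then show "g x \<le> p + indicator (U - B) x * w x"
          using Tsub by (auto simp: B_def w_def indicator_def)
      qed
      also have "\<dots> = p * measure lebesgue T + (LINT x:T|lebesgue. indicator (U - B) x * w x)"
      proof (subst set_integral_add)
        have "integrable lebesgue (\<lambda>x. indicator (U - B) x *\<^sub>R w x)"
          using U(3) by (intro integrable_mult_indicator wint) auto
        then show "set_integrable lebesgue T (\<lambda>x. indicator (U - B) x * w x)"
          using Tm unfolding set_integrable_def by (intro integrable_mult_indicator) auto
        show "set_integrable lebesgue T (\<lambda>x. p)"
          using Tm by (auto simp: set_integrable_def fmeasurable_def)
      qed (use Tm in \<open>simp add: set_lebesgue_integral_def measure_def mult.commute fmeasurable_def\<close>)
      also have "(LINT x:T|lebesgue. indicator (U - B) x * w x) \<le> (LINT x:U-B|lebesgue. w x)"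
        unfolding set_lebesgue_integral_def
      proof (rule integral_mono)
        have i: "integrable lebesgue (\<lambda>x. indicator (U - B) x *\<^sub>R w x)"
          using U(3) by (intro integrable_mult_indicator wint) auto
        then show "integrable lebesgue (\<lambda>x. indicator (U - B) x *\<^sub>R w x)" .
        show "integrable lebesgue (\<lambda>x. indicator T x *\<^sub>R (indicator (U - B) x * w x))"
          using i Tm by (intro integrable_mult_indicator) auto
      qed (auto simp: indicator_def wpos)
      finally have "(q - p) * measure lebesgue T \<le> (LINT x:U-B|lebesgue. w x)"
        by (simp add: algebra_simps)
      then have "(q - p) * measure lebesgue T \<le> (q - p) * e" using UB by (simp add: mult.commute)
      then show ?thesis using pq by (simp add: T_def)
    qed
    have Im: "I ` C \<subseteq> lmeasurable" "\<And>X. X \<in> I ` C \<Longrightarrow> X \<in> lmeasurable" by (auto simp: I_def)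
    have fin': "measure lebesgue (\<Union>F) \<le> e" if F: "F \<subseteq> I ` C" "finite F" for F
      using fin finite_subset_image[OF F(2,1)] by auto
    have m1: "\<Union>(I ` C) \<in> lmeasurable" and m2: "measure lebesgue (\<Union>(I ` C)) \<le> e"
      using fmeasurable_Union_bound[of "I ` C" lebesgue e] measure_Union_bound[of "I ` C" lebesgue e]
        Im fin' C(1) by auto
    define R where "R = ?A - \<Union>(I ` C)"
    have neg: "negligible R" using C(4) by (simp add: cb R_def)
    have "\<Union>(I ` C) \<union> R \<in> lmeasurable"
      using m1 negligible_imp_measurable[OF neg] by (rule fmeasurable.Un)
    moreover have "measure lebesgue (\<Union>(I ` C) \<union> R) \<le> e"
      using measure_Un_le[of "\<Union>(I ` C)" lebesgue R] m1 m2 negligible_imp_measure0[OF neg]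
        negligible_imp_sets[OF neg] by (simp add: fmeasurableD)
    moreover have "?A \<subseteq> \<Union>(I ` C) \<union> R" by (simp only: R_def Un_Diff_cancel Un_upper2)
    ultimately show "\<exists>T. ?A \<subseteq> T \<and> T \<in> lmeasurable \<and> measure lebesgue T \<le> e"
      by (intro exI[of _ "\<Union>(I ` C) \<union> R"] conjI)
  qed
qed

text \<open>Where the difference quotients of the indefinite integral do not tend to \<open>g x\<close>, rational numbers
\<open>p < q\<close> separate \<open>g x\<close> from one of their limit points, for \<open>g\<close> itself or for \<open>- g\<close>. There are countably
many such pairs, and each of them contributes a null set.\<close>

lemma indefinite_integral_has_derivative_ae_real:
  fixes g :: "real \<Rightarrow> real"
  assumes g: "g absolutely_integrable_on {a..b}"
  obtains N where "negligible N"
    "\<And>x. x \<in> {a<..<b} - N \<Longrightarrow> ((\<lambda>x. integral {a..x} g) has_real_derivative g x) (at x)"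
proof -
  define A where "A f p q = {x \<in> {a<..<b}. f x < p \<and>
     (\<forall>d>0. \<exists>y\<in>{a..b}. y \<noteq> x \<and> \<bar>y - x\<bar> < d \<and>
        (integral {a..y} f - integral {a..x} f) / (y - x) > q)}" for f :: "real \<Rightarrow> real" and p q
  define R where "R = {(p,q) \<in> \<rat> \<times> \<rat>. p < (q::real)}"
  define N where "N = (\<Union>(p,q)\<in>R. A g p q \<union> A (\<lambda>x. - g x) p q)"
  have cR: "countable R"
    unfolding R_def by (rule countable_subset[of _ "\<rat> \<times> \<rat>"]) (auto simp: countable_rat)
  have g': "(\<lambda>x. - g x) absolutely_integrable_on {a..b}" using g unfolding set_integrable_def by simp
  have "negligible (A g p q \<union> A (\<lambda>x. - g x) p q)" if "(p,q) \<in> R" for p q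
    using upper_slope_exceeds_negligible[OF g, of p q] upper_slope_exceeds_negligible[OF g', of p q] that
    by (intro negligible_Un) (auto simp: R_def A_def)
  then have "negligible N"
    unfolding N_def using cR by (intro negligible_countable_Union) auto
  moreover have "((\<lambda>x. integral {a..x} g) has_real_derivative g x) (at x)" if x: "x \<in> {a<..<b} - N" for x
  proof -
    have ev: "\<forall>\<^sub>F y in at x. (integral {a..y} f - integral {a..x} f) / (y - x) < u"
      if f: "f = g \<or> f = (\<lambda>x. - g x)" and u: "f x < u" for u f
    proof -
      obtain p where p: "p \<in> \<rat>" "f x < p" "p < u" using Rats_dense_in_real[OF u] by auto
      obtain q where q: "q \<in> \<rat>" "p < q" "q < u" using Rats_dense_in_real[OF p(3)] by auto
      have "(p,q) \<in> R" using p q by (auto simp: R_def)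
      then have "x \<notin> A f p q" using x f by (auto simp: N_def)
      then have "\<exists>d>0. \<forall>y\<in>{a..b}. y \<noteq> x \<longrightarrow> \<bar>y - x\<bar> < d \<longrightarrow>
          (integral {a..y} f - integral {a..x} f) / (y - x) \<le> q"
        using x p by (force simp: A_def not_less)
      then obtain d where d: "d > 0" "\<And>y. y \<in> {a..b} \<Longrightarrow> y \<noteq> x \<Longrightarrow> \<bar>y - x\<bar> < d \<Longrightarrow>
          (integral {a..y} f - integral {a..x} f) / (y - x) \<le> q"
        by blast
      show ?thesis
        unfolding eventually_at
      proof (intro exI[of _ "min d (min (x - a) (b - x))"] conjI ballI impI)
        show "0 < min d (min (x - a) (b - x))" using d x by auto
        fix y assume "y \<noteq> x \<and> dist y x < min d (min (x - a) (b - x))"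
        then have "(integral {a..y} f - integral {a..x} f) / (y - x) \<le> q"
          by (intro d(2)) (auto simp: dist_real_def)
        then show "(integral {a..y} f - integral {a..x} f) / (y - x) < u" using q by simp
      qed
    qed
    have "((\<lambda>y. (integral {a..y} g - integral {a..x} g) / (y - x)) \<longlongrightarrow> g x) (at x)"
    proof (rule order_tendstoI)
      fix u assume "g x < u"
      then show "\<forall>\<^sub>F y in at x. (integral {a..y} g - integral {a..x} g) / (y - x) < u"
        by (intro ev) auto
    next
      fix u assume "u < g x"
      then have "\<forall>\<^sub>F y in at x. (integral {a..y} (\<lambda>x. - g x) - integral {a..x} (\<lambda>x. - g x)) / (y - x) < - u"
        by (intro ev) auto
      then show "\<forall>\<^sub>F y in at x. u < (integral {a..y} g - integral {a..x} g) / (y - x)"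
      proof eventually_elim
        case (elim y)
        have "(- integral {a..y} g + integral {a..x} g) / (y - x) = - ((integral {a..y} g - integral {a..x} g) / (y - x))"
          by (simp add: divide_simps)
        then show ?case using elim by simp
      qed
    qed
    then show ?thesis by (simp add: has_field_derivative_iff)
  qed
  ultimately show ?thesis using that by blast
qed

lemma indefinite_integral_has_derivative_ae:
  fixes g :: "real \<Rightarrow> complex"
  assumes g: "g absolutely_integrable_on {a..b}"
  obtains N where "negligible N"
    "\<And>x. x \<in> {a<..<b} - N \<Longrightarrow> ((\<lambda>x. integral {a..x} g) has_vector_derivative g x) (at x)"
proof -
  have gr: "(\<lambda>x. Re (g x)) absolutely_integrable_on {a..b}" "(\<lambda>x. Im (g x)) absolutely_integrable_on {a..b}"
    using absolutely_integrable_linear[OF g bounded_linear_Re] absolutely_integrable_linear[OF g bounded_linear_Im]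
    by (auto simp: o_def)
  obtain N where N: "negligible N"
    "\<And>x. x \<in> {a<..<b} - N \<Longrightarrow> ((\<lambda>x. integral {a..x} (\<lambda>x. Re (g x))) has_real_derivative Re (g x)) (at x)"
    using indefinite_integral_has_derivative_ae_real[OF gr(1)] by metis
  obtain M where M: "negligible M"
    "\<And>x. x \<in> {a<..<b} - M \<Longrightarrow> ((\<lambda>x. integral {a..x} (\<lambda>x. Im (g x))) has_real_derivative Im (g x)) (at x)"
    using indefinite_integral_has_derivative_ae_real[OF gr(2)] by metis
  have eq: "integral {a..x} g = Complex (integral {a..x} (\<lambda>x. Re (g x))) (integral {a..x} (\<lambda>x. Im (g x)))"
    if "x \<in> {a<..<b}" for x
  proof -
    have "g integrable_on {a..x}"
      using absolutely_integrable_on_subinterval[OF g, of a x] that set_lebesgue_integral_eq_integral(1) by auto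
    then show ?thesis
      using integral_linear[of g "{a..x}" Re] integral_linear[of g "{a..x}" Im] bounded_linear_Re bounded_linear_Im
      by (simp add: complex_eq_iff o_def)
  qed
  show ?thesis
  proof
    show "negligible (N \<union> M)" using N M by (intro negligible_Un)
    fix x assume x: "x \<in> {a<..<b} - (N \<union> M)"
    have "((\<lambda>x. Complex (integral {a..x} (\<lambda>x. Re (g x))) (integral {a..x} (\<lambda>x. Im (g x))))
       has_vector_derivative g x) (at x)"
      using N(2)[of x] M(2)[of x] x
      by (auto simp: has_vector_derivative_complex_iff has_real_derivative_iff_has_vector_derivative)
    then show "((\<lambda>x. integral {a..x} g) has_vector_derivative g x) (at x)"
      by (rule has_vector_derivative_transform_within_open[of _ _ _ "{a<..<b}"]) (use x eq in auto)
  qed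
qed

section \<open>Absolutely continuous functions are integrals of their derivatives\<close>

text \<open>The intervals in the definition of absolute continuity are numbered from \<open>0\<close>. Families indexed by
an arbitrary finite set are more convenient, since refinements are indexed by pairs and coverings by
the intervals themselves.\<close>

definition interval_family :: "real \<Rightarrow> real \<Rightarrow> 'i set \<Rightarrow> ('i \<Rightarrow> real) \<Rightarrow> ('i \<Rightarrow> real) \<Rightarrow> bool" where
  "interval_family a b I u v \<longleftrightarrow> finite I \<and> (\<forall>i\<in>I. a \<le> u i \<and> u i \<le> v i \<and> v i \<le> b) \<and>
     disjoint_family_on (\<lambda>i. {u i<..<v i}) I"

lemma absolutely_continuous_on_family:
  assumes "absolutely_continuous_on a b f" "\<epsilon> > 0"
  obtains \<delta> where "\<delta> > 0" "\<And>(I::'i set) u v. interval_family a b I u v \<Longrightarrow> (\<Sum>i\<in>I. v i - u i) < \<delta> \<Longrightarrow>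
    (\<Sum>i\<in>I. cmod (f (v i) - f (u i))) < \<epsilon>"
proof -
  obtain \<delta> where \<delta>: "\<delta> > 0" and ac: "\<And>(n::nat) u v. (\<forall>i<n. a \<le> u i \<and> u i \<le> v i \<and> v i \<le> b) \<Longrightarrow>
        disjoint_family_on (\<lambda>i. {u i<..<v i}) {..<n} \<Longrightarrow> (\<Sum>i<n. v i - u i) < \<delta> \<Longrightarrow>
        (\<Sum>i<n. cmod (f (v i) - f (u i))) < \<epsilon>"
    using assms(1)[unfolded absolutely_continuous_on_def, rule_format, OF assms(2)] by blast
  show ?thesis
  proof
    fix I :: "'i set" and u v assume I: "interval_family a b I u v" and s: "(\<Sum>i\<in>I. v i - u i) < \<delta>"
    then have "finite I" by (simp add: interval_family_def)
    then obtain h where h: "bij_betw h {0..<card I} I" using ex_bij_betw_nat_finite by blast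
    then have h: "bij_betw h {..<card I} I" by (simp add: atLeast0LessThan)
    have hI: "h i \<in> I" if "i < card I" for i using h that by (auto simp: bij_betw_def)
    have "(\<Sum>i<card I. cmod (f ((v \<circ> h) i) - f ((u \<circ> h) i))) < \<epsilon>"
    proof (rule ac)
      show "\<forall>i<card I. a \<le> (u \<circ> h) i \<and> (u \<circ> h) i \<le> (v \<circ> h) i \<and> (v \<circ> h) i \<le> b"
        using I hI by (auto simp: interval_family_def)
      show "disjoint_family_on (\<lambda>i. {(u \<circ> h) i<..<(v \<circ> h) i}) {..<card I}"
        unfolding disjoint_family_on_def
      proof (intro ballI impI)
        fix i j assume ij: "i \<in> {..<card I}" "j \<in> {..<card I}" "i \<noteq> j"
        then have "h i \<noteq> h j" using h by (auto simp: bij_betw_def inj_on_def)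
        then show "{(u \<circ> h) i<..<(v \<circ> h) i} \<inter> {(u \<circ> h) j<..<(v \<circ> h) j} = {}"
          using I hI[of i] hI[of j] ij unfolding interval_family_def disjoint_family_on_def o_def by auto
      qed
      show "(\<Sum>i<card I. (v \<circ> h) i - (u \<circ> h) i) < \<delta>"
        using s sum.reindex_bij_betw[OF h, of "\<lambda>i. v i - u i"] by simp
    qed
    then show "(\<Sum>i\<in>I. cmod (f (v i) - f (u i))) < \<epsilon>"
      using sum.reindex_bij_betw[OF h, of "\<lambda>i. cmod (f (v i) - f (u i))"] by simp
  qed (use \<delta> in auto)
qed

lemma interval_family_sub:
  assumes "interval_family a b I u v"
    and "\<And>i. i \<in> I \<Longrightarrow> a' \<le> u' i \<and> u' i \<le> v' i \<and> v' i \<le> b'"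
    and "\<And>i. i \<in> I \<Longrightarrow> {u' i<..<v' i} \<subseteq> {u i<..<v i}"
  shows "interval_family a' b' I u' v'"
  unfolding interval_family_def
proof (intro conjI)
  show "disjoint_family_on (\<lambda>i. {u' i<..<v' i}) I"
    unfolding disjoint_family_on_def
  proof (intro ballI impI)
    fix i j assume ij: "i \<in> I" "j \<in> I" "i \<noteq> j"
    then have "{u i<..<v i} \<inter> {u j<..<v j} = {}"
      using assms(1) unfolding interval_family_def disjoint_family_on_def by blast
    then show "{u' i<..<v' i} \<inter> {u' j<..<v' j} = {}" using assms(3) ij by blast
  qed
qed (use assms in \<open>auto simp: interval_family_def\<close>)

lemma interval_family_length_le:
  assumes "interval_family a b I u v" "a \<le> b"
  shows "(\<Sum>i\<in>I. v i - u i) \<le> b - a"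
proof -
  have I: "finite I" "\<And>i. i \<in> I \<Longrightarrow> a \<le> u i \<and> u i \<le> v i \<and> v i \<le> b" "disjoint_family_on (\<lambda>i. {u i<..<v i}) I"
    using assms by (auto simp: interval_family_def)
  have "(\<Sum>i\<in>I. v i - u i) = (\<Sum>i\<in>I. measure lborel {u i<..<v i})"
    using I(2) by (intro sum.cong) auto
  also have "\<dots> = measure lborel (\<Union>i\<in>I. {u i<..<v i})"
    using I by (intro measure_finite_Union[symmetric]) auto
  also have "\<dots> \<le> measure lborel {a..b}"
  proof (rule measure_mono_fmeasurable)
    show "(\<Union>i\<in>I. {u i<..<v i}) \<in> sets lborel" using I(1) by (intro sets.finite_UN) auto
    show "{a..b} \<in> fmeasurable lborel" by (intro fmeasurableI) (auto simp: assms(2))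
  qed (use I(2) in force)
  also have "\<dots> = b - a" using assms by simp
  finally show ?thesis .
qed

text \<open>The families may have gaps, so negative increments can be left out of the sums.\<close>

definition positive_variation :: "(real \<Rightarrow> real) \<Rightarrow> real \<Rightarrow> real \<Rightarrow> real" where
  "positive_variation F a b =
     Sup {\<Sum>i\<in>I. F (v i) - F (u i) | (I :: nat set) u v. interval_family a b I u v}"

text \<open>An absolutely continuous function on an interval that is short enough for the family sums to stay
below \<open>1\<close>, so that its variation is finite.\<close>

locale short_ac =
  fixes F :: "real \<Rightarrow> real" and c d :: real
  assumes ac: "absolutely_continuous_on c d (\<lambda>x. of_real (F x))"
    and cd: "c \<le> d"
    and bdd: "\<And>(I::nat set) u v. interval_family c d I u v \<Longrightarrow> (\<Sum>i\<in>I. F (v i) - F (u i)) \<le> 1"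
begin

abbreviation "P \<equiv> positive_variation F"

lemma positive_variation_upper:
  assumes "interval_family x y (I::nat set) u v" "c \<le> x" "y \<le> d"
  shows "(\<Sum>i\<in>I. F (v i) - F (u i)) \<le> P x y"
  unfolding positive_variation_def
proof (rule cSup_upper)
  show "bdd_above {\<Sum>i\<in>I. F (v i) - F (u i) |(I::nat set) u v. interval_family x y I u v}"
  proof (rule bdd_aboveI)
    fix s assume "s \<in> {\<Sum>i\<in>I. F (v i) - F (u i) |(I::nat set) u v. interval_family x y I u v}"
    then obtain I :: "nat set" and u v where I: "interval_family x y I u v" "s = (\<Sum>i\<in>I. F (v i) - F (u i))"
      by auto
    then have "interval_family c d I u v"
      using assms unfolding interval_family_def by force
    then show "s \<le> 1" using bdd I by simp
  qed
qed (use assms in blast)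

lemma positive_variation_least:
  assumes "\<And>(I::nat set) u v. interval_family x y I u v \<Longrightarrow> (\<Sum>i\<in>I. F (v i) - F (u i)) \<le> C"
  shows "P x y \<le> C"
  unfolding positive_variation_def
proof (rule cSup_least)
  have "interval_family x y ({}::nat set) (\<lambda>_. 0) (\<lambda>_. 0)" by (simp add: interval_family_def disjoint_family_on_def)
  then show "{\<Sum>i\<in>I. F (v i) - F (u i) |(I::nat set) u v. interval_family x y I u v} \<noteq> {}" by blast
qed (use assms in auto)

text \<open>Appending the interval from \<open>x\<close> to \<open>y\<close> to a family on \<open>[c, x]\<close> shows that the positive variation grows
at least as fast as \<open>F\<close>. Hence the positive variation and its difference with \<open>F\<close> are both
increasing.\<close>

lemma positive_variation_step:
  assumes "c \<le> x" "x \<le> y" "y \<le> d"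
  shows "P c x + max 0 (F y - F x) \<le> P c y"
proof -
  have "P c x \<le> P c y - (F y - F x)"
  proof (rule positive_variation_least)
    fix I :: "nat set" and u v assume I: "interval_family c x I u v"
    then have fin: "finite I" by (simp add: interval_family_def)
    obtain k where k: "k \<notin> I" using ex_new_if_finite[OF infinite_UNIV_nat fin] by auto
    have "interval_family c y (insert k I) (u(k := x)) (v(k := y))"
      unfolding interval_family_def
    proof (intro conjI ballI)
      show "finite (insert k I)" using fin by simp
      fix i assume "i \<in> insert k I"
      then show "c \<le> (u(k := x)) i" "(u(k := x)) i \<le> (v(k := y)) i" "(v(k := y)) i \<le> y"
        using I assms k by (auto simp: interval_family_def intro: order_trans)
    next
      have "disjoint_family_on (\<lambda>i. {(u(k := x)) i<..<(v(k := y)) i}) I \<longleftrightarrow> disjoint_family_on (\<lambda>i. {u i<..<v i}) I"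
        using k unfolding disjoint_family_on_def by (intro ball_cong refl imp_cong) (auto 0 3)
      moreover have "{x<..<y} \<inter> (\<Union>i\<in>I. {u i<..<v i}) = {}"
        using I by (force simp: interval_family_def)
      moreover have "(\<Union>i\<in>I. {(u(k := x)) i<..<(v(k := y)) i}) = (\<Union>i\<in>I. {u i<..<v i})"
        using k by (intro SUP_cong) auto
      ultimately show "disjoint_family_on (\<lambda>i. {(u(k := x)) i<..<(v(k := y)) i}) (insert k I)"
        using I k by (subst disjoint_family_on_insert) (auto simp: interval_family_def)
    qed
    from positive_variation_upper[OF this] have "(\<Sum>i\<in>insert k I. F ((v(k := y)) i) - F ((u(k := x)) i)) \<le> P c y"
      using assms by simp
    moreover have "(\<Sum>i\<in>I. F ((v(k := y)) i) - F ((u(k := x)) i)) = (\<Sum>i\<in>I. F (v i) - F (u i))"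
      using k by (intro sum.cong) auto
    ultimately show "(\<Sum>i\<in>I. F (v i) - F (u i)) \<le> P c y - (F y - F x)"
      using fin k by simp
  qed
  moreover have "P c x \<le> P c y"
  proof (rule positive_variation_least)
    fix I :: "nat set" and u v assume "interval_family c x I u v"
    then have "interval_family c y I u v" using assms by (force simp: interval_family_def)
    then show "(\<Sum>i\<in>I. F (v i) - F (u i)) \<le> P c y" using positive_variation_upper assms by simp
  qed
  ultimately show ?thesis by auto
qed

text \<open>Cutting every interval of a family at \<open>x\<close> splits its sum.\<close>

lemma positive_variation_subadditive:
  assumes "c \<le> x" "x \<le> y" "y \<le> d"
  shows "P c y \<le> P c x + P x y"
proof (rule positive_variation_least)
  fix I :: "nat set" and u v assume I: "interval_family c y I u v"
  have 1: "interval_family c x I (\<lambda>i. min (u i) x) (\<lambda>i. min (v i) x)"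
    using I assms by (intro interval_family_sub[OF I]) (auto simp: interval_family_def)
  have 2: "interval_family x y I (\<lambda>i. max (u i) x) (\<lambda>i. max (v i) x)"
    using I assms by (intro interval_family_sub[OF I]) (auto simp: interval_family_def)
  have "(\<Sum>i\<in>I. F (v i) - F (u i)) =
    (\<Sum>i\<in>I. F (min (v i) x) - F (min (u i) x)) + (\<Sum>i\<in>I. F (max (v i) x) - F (max (u i) x))"
    unfolding sum.distrib[symmetric] by (intro sum.cong) (auto simp: min_def max_def)
  also have "\<dots> \<le> P c x + P x y"
    using positive_variation_upper[OF 1] positive_variation_upper[OF 2] assms by simp
  finally show "(\<Sum>i\<in>I. F (v i) - F (u i)) \<le> P c x + P x y" .
qed

text \<open>By subadditivity the increment of the positive variation over an interval is at most the positive
variation inside it, and this is nearly attained by a family of subintervals. The families inside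
the given disjoint intervals together form one family with the same bound on the total length, to
which the absolute continuity of \<open>F\<close> applies.\<close>

lemma positive_variation_ac: "absolutely_continuous_on c d (\<lambda>x. of_real (P c x))"
  unfolding absolutely_continuous_on_def
proof (intro allI impI)
  fix e :: real assume e: "e > 0"
  then have "e/2 > 0" by simp
  then obtain \<delta> where \<delta>: "\<delta> > 0" and small: "\<And>(I::(nat\<times>nat) set) u v. interval_family c d I u v \<Longrightarrow>
     (\<Sum>i\<in>I. v i - u i) < \<delta> \<Longrightarrow> (\<Sum>i\<in>I. cmod (of_real (F (v i)) - of_real (F (u i)))) < e/2"
    by (rule absolutely_continuous_on_family[OF ac, where 'i="nat \<times> nat"]) blast
  show "\<exists>\<delta>>0. \<forall>(n::nat) u v. (\<forall>i<n. c \<le> u i \<and> u i \<le> v i \<and> v i \<le> d) \<longrightarrow>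
        disjoint_family_on (\<lambda>i. {u i<..<v i}) {..<n} \<longrightarrow> (\<Sum>i<n. v i - u i) < \<delta> \<longrightarrow>
        (\<Sum>i<n. cmod (of_real (P c (v i)) - of_real (P c (u i)))) < e"
  proof (intro exI[of _ \<delta>] conjI allI impI)
    show "\<delta> > 0" by fact
    fix n :: nat and u v :: "nat \<Rightarrow> real"
    assume uv: "\<forall>i<n. c \<le> u i \<and> u i \<le> v i \<and> v i \<le> d"
      and dj: "disjoint_family_on (\<lambda>i. {u i<..<v i}) {..<n}" and s: "(\<Sum>i<n. v i - u i) < \<delta>"
    define \<eta> where "\<eta> = e / (2 * (real n + 1))"
    have \<eta>: "\<eta> > 0" using e by (simp add: \<eta>_def)
    have "\<exists>(J::nat set) s t. interval_family (u i) (v i) J s t \<and> P (u i) (v i) < (\<Sum>j\<in>J. F (t j) - F (s j)) + \<eta>" for i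
    proof (rule ccontr)
      assume "\<not> ?thesis"
      then have "\<And>(J::nat set) s t. interval_family (u i) (v i) J s t \<Longrightarrow> (\<Sum>j\<in>J. F (t j) - F (s j)) \<le> P (u i) (v i) - \<eta>"
        by (force simp: not_less)
      then have "P (u i) (v i) \<le> P (u i) (v i) - \<eta>" by (rule positive_variation_least)
      then show False using \<eta> by simp
    qed
    then obtain J :: "nat \<Rightarrow> nat set" and s t where J: "\<And>i. interval_family (u i) (v i) (J i) (s i) (t i)"
      "\<And>i. P (u i) (v i) < (\<Sum>j\<in>J i. F (t i j) - F (s i j)) + \<eta>" by metis
    define K where "K = Sigma {..<n} J"
    have fam: "interval_family c d K (\<lambda>(i,j). s i j) (\<lambda>(i,j). t i j)"
      unfolding interval_family_def
    proof (intro conjI ballI)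
      show "finite K" using J(1) by (auto simp: K_def interval_family_def)
      fix k assume "k \<in> K"
      then obtain i j where "k = (i,j)" "i < n" "j \<in> J i" by (auto simp: K_def)
      then show "c \<le> (case k of (i,j) \<Rightarrow> s i j)" "(case k of (i,j) \<Rightarrow> s i j) \<le> (case k of (i,j) \<Rightarrow> t i j)"
        "(case k of (i,j) \<Rightarrow> t i j) \<le> d"
        using J(1)[of i] uv by (auto simp: interval_family_def intro: order_trans)
    next
      show "disjoint_family_on (\<lambda>k. {case k of (i,j) \<Rightarrow> s i j<..<case k of (i,j) \<Rightarrow> t i j}) K"
        unfolding disjoint_family_on_def
      proof (intro ballI impI)
        fix k l assume kl: "k \<in> K" "l \<in> K" "k \<noteq> l"
        obtain i j where k: "k = (i,j)" "i < n" "j \<in> J i" using kl by (auto simp: K_def)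
        obtain i' j' where l: "l = (i',j')" "i' < n" "j' \<in> J i'" using kl by (auto simp: K_def)
        have sub: "{s i j<..<t i j} \<subseteq> {u i<..<v i}" "{s i' j'<..<t i' j'} \<subseteq> {u i'<..<v i'}"
          using J(1)[of i] J(1)[of i'] k l unfolding interval_family_def by force+
        have "{s i j<..<t i j} \<inter> {s i' j'<..<t i' j'} = {}"
        proof (cases "i = i'")
          case True
          then have "j \<noteq> j'" using kl k l by auto
          then show ?thesis using J(1)[of i] k l True unfolding interval_family_def disjoint_family_on_def by auto
        next
          case False
          then have "{u i<..<v i} \<inter> {u i'<..<v i'} = {}" using dj k l by (auto simp: disjoint_family_on_def)
          then show ?thesis using sub by blast
        qed
        then show "{case k of (i,j) \<Rightarrow> s i j<..<case k of (i,j) \<Rightarrow> t i j} \<inter>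
            {case l of (i,j) \<Rightarrow> s i j<..<case l of (i,j) \<Rightarrow> t i j} = {}" using k l by simp
      qed
    qed
    have finJ: "\<forall>i\<in>{..<n}. finite (J i)" using J(1) by (auto simp: interval_family_def)
    have "(\<Sum>k\<in>K. (case k of (i,j) \<Rightarrow> t i j) - (case k of (i,j) \<Rightarrow> s i j)) = (\<Sum>i<n. \<Sum>j\<in>J i. t i j - s i j)"
      unfolding K_def by (subst sum.Sigma[OF _ finJ]) (auto intro!: sum.cong)
    also have "\<dots> \<le> (\<Sum>i<n. v i - u i)"
      using J(1) uv by (intro sum_mono interval_family_length_le) auto
    finally have "(\<Sum>k\<in>K. cmod (of_real (F (case k of (i,j) \<Rightarrow> t i j)) - of_real (F (case k of (i,j) \<Rightarrow> s i j)))) < e/2"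
      using small[OF fam] s by simp
    then have e2: "(\<Sum>k\<in>K. \<bar>F (case k of (i,j) \<Rightarrow> t i j) - F (case k of (i,j) \<Rightarrow> s i j)\<bar>) < e/2"
      by (simp flip: of_real_diff)
    have "(\<Sum>i<n. cmod (of_real (P c (v i)) - of_real (P c (u i)))) = (\<Sum>i<n. P c (v i) - P c (u i))"
    proof (intro sum.cong refl)
      fix i assume "i \<in> {..<n}"
      then have "P c (u i) \<le> P c (v i)" using positive_variation_step[of "u i" "v i"] uv by auto
      then show "cmod (of_real (P c (v i)) - of_real (P c (u i))) = P c (v i) - P c (u i)"
        by (simp flip: of_real_diff)
    qed
    also have "\<dots> \<le> (\<Sum>i<n. P (u i) (v i))"
    proof (rule sum_mono)
      fix i assume "i \<in> {..<n}"
      then show "P c (v i) - P c (u i) \<le> P (u i) (v i)" using positive_variation_subadditive[of "u i" "v i"] uv by simp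
    qed
    also have "\<dots> \<le> (\<Sum>i<n. (\<Sum>j\<in>J i. F (t i j) - F (s i j)) + \<eta>)"
      using J(2) by (intro sum_mono less_imp_le)
    also have "\<dots> = (\<Sum>i<n. \<Sum>j\<in>J i. F (t i j) - F (s i j)) + real n * \<eta>"
      by (simp add: sum.distrib)
    also have "(\<Sum>i<n. \<Sum>j\<in>J i. F (t i j) - F (s i j)) \<le> (\<Sum>k\<in>K. \<bar>F (case k of (i,j) \<Rightarrow> t i j) - F (case k of (i,j) \<Rightarrow> s i j)\<bar>)"
      unfolding K_def by (subst sum.Sigma[OF _ finJ]) (auto intro!: sum_mono)
    also have "\<dots> < e/2" by fact
    also have "real n * \<eta> \<le> e/2" using e by (simp add: \<eta>_def field_simps)
    finally show "(\<Sum>i<n. cmod (of_real (P c (v i)) - of_real (P c (u i)))) < e" by simp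
  qed
qed

end

lemma ac_imp_continuous_on:
  assumes ac: "absolutely_continuous_on c d f"
  shows "continuous_on {c..d} f"
  unfolding continuous_on_iff
proof (intro ballI allI impI)
  fix x and e :: real assume x: "x \<in> {c..d}" and e: "e > 0"
  obtain \<delta> where \<delta>: "\<delta> > 0" and small: "\<And>(I::nat set) u v. interval_family c d I u v \<Longrightarrow>
     (\<Sum>i\<in>I. v i - u i) < \<delta> \<Longrightarrow> (\<Sum>i\<in>I. cmod (f (v i) - f (u i))) < e"
    by (rule absolutely_continuous_on_family[OF ac e, where 'i=nat]) blast
  have le: "cmod (f (max x y) - f (min x y)) < e" if "y \<in> {c..d}" "\<bar>y - x\<bar> < \<delta>" for y
    using small[of "{0}" "\<lambda>_. min x y" "\<lambda>_. max x y"] that x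
    by (auto simp: interval_family_def disjoint_family_on_def)
  have "cmod (f y - f x) < e" if "y \<in> {c..d}" "\<bar>y - x\<bar> < \<delta>" for y
    using that(1) le[OF that] by (cases "x \<le> y") (auto simp: norm_minus_commute max_absorb2 max_absorb1 min_absorb1 min_absorb2)
  then show "\<exists>d'>0. \<forall>y\<in>{c..d}. dist y x < d' \<longrightarrow> dist (f y) (f x) < e"
    using \<delta> by (auto simp: dist_norm intro!: exI[of _ \<delta>])
qed

text \<open>An increasing continuous function is the distribution function of a measure. Absolute continuity says
that a null set, which can be covered by intervals of small total length, has small measure; so the
measure has no singular part and the Radon-Nikodym theorem provides the density.\<close>

lemma mono_ac_eq_integral:
  fixes F :: "real \<Rightarrow> real"
  assumes ac: "absolutely_continuous_on c d (\<lambda>x. of_real (F x))" and cd: "c \<le> d"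
    and mono: "\<And>x y. c \<le> x \<Longrightarrow> x \<le> y \<Longrightarrow> y \<le> d \<Longrightarrow> F x \<le> F y"
  obtains g where "g absolutely_integrable_on {c..d}"
    "\<And>x. x \<in> {c..d} \<Longrightarrow> F x - F c = integral {c..x} g"
proof -
  \<comment> \<open>F is extended by constants, since interval measures are built from functions on the whole line.\<close>
  define H where "H x = F (max c (min d x)) - F c" for x
  have contF: "continuous_on {c..d} F"
  proof -
    have "continuous_on {c..d} (\<lambda>x. Re (of_real (F x)))"
      using ac_imp_continuous_on[OF ac] by (rule continuous_on_Re)
    then show ?thesis by (simp only: Re_complex_of_real)
  qed
  have contH: "continuous_on UNIV H"
    unfolding H_def by (intro continuous_intros continuous_on_compose2[OF contF]) (use cd in auto)
  have monoH: "H x \<le> H y" if "x \<le> y" for x y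
    unfolding H_def using mono[of "max c (min d x)" "max c (min d y)"] that cd by auto
  have Hr: "continuous (at_right a) H" for a
    using contH continuous_on_eq_continuous_within[of UNIV H] continuous_within_subset[of a UNIV H] by auto
  define \<mu> where "\<mu> = interval_measure H"
  have sets: "sets \<mu> = sets borel" "sets \<mu> = sets lborel" by (auto simp: \<mu>_def)
  have Ioc: "emeasure \<mu> {x<..y} = ennreal (H y - H x)" if "x \<le> y" for x y
    unfolding \<mu>_def by (rule emeasure_interval_measure_Ioc[OF that monoH Hr])
  have Icc: "emeasure \<mu> {x..y} = ennreal (H y - H x)" if "x \<le> y" for x y
    unfolding \<mu>_def by (rule emeasure_interval_measure_Icc[OF that monoH contH])
  have "(H \<longlongrightarrow> 0) at_bot"
    by (rule tendsto_eventually) (auto simp: H_def eventually_at_bot_linorder intro!: exI[of _ c])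
  moreover have "(H \<longlongrightarrow> F d - F c) at_top"
    by (rule tendsto_eventually) (use cd in \<open>auto simp: H_def eventually_at_top_linorder intro!: exI[of _ d]\<close>)
  moreover have "0 \<le> F d - F c" using mono[of c d] cd by simp
  ultimately have fb: "finite_borel_measure \<mu>" and tot: "emeasure \<mu> UNIV = ennreal (F d - F c)"
    unfolding \<mu>_def
    using finite_borel_measure_interval_measure[OF monoH Hr] interval_measure_UNIV[OF monoH Hr] by auto
  interpret mu: finite_borel_measure \<mu> by fact
  have out: "emeasure \<mu> (UNIV - {c..d}) = 0"
  proof -
    have "emeasure \<mu> (UNIV - {c..d}) = emeasure \<mu> UNIV - emeasure \<mu> {c..d}"
      by (rule emeasure_Diff) (auto simp: sets mu.emeasure_finite)
    then show ?thesis using cd by (simp add: tot Icc H_def)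
  qed
  have acm: "absolutely_continuous lborel \<mu>"
    unfolding absolutely_continuous_def
  proof
    fix N assume N: "N \<in> null_sets (lborel :: real measure)"
    then have Nb: "N \<in> sets borel" by auto
    let ?N = "N \<inter> {c..d}"
    have Nn: "?N \<in> null_sets lebesgue"
    proof -
      have "?N \<in> null_sets lborel" using N by (intro null_set_Int2) auto
      then show ?thesis by (rule null_sets_completionI)
    qed
    have "emeasure \<mu> ?N \<le> ennreal e" if e: "e > 0" for e
    proof -
      obtain \<delta> where \<delta>: "\<delta> > 0" and small: "\<And>(I::real set set) u v. interval_family c d I u v \<Longrightarrow>
         (\<Sum>i\<in>I. v i - u i) < \<delta> \<Longrightarrow> (\<Sum>i\<in>I. cmod (of_real (F (v i)) - of_real (F (u i)))) < e"
        by (rule absolutely_continuous_on_family[OF ac e, where 'i="real set"]) blast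
      have Nl: "?N \<in> lmeasurable" using Nn by (auto simp: fmeasurable_def null_sets_def)
      have "?N \<subseteq> cbox c d" by auto
      then obtain \<D> where \<D>: "countable \<D>" "\<And>K. K \<in> \<D> \<Longrightarrow> K \<subseteq> cbox c d \<and> K \<noteq> {} \<and> (\<exists>c d. K = cbox c d)"
        "pairwise (\<lambda>A B. interior A \<inter> interior B = {}) \<D>" "?N \<subseteq> \<Union>\<D>" "\<Union>\<D> \<in> lmeasurable"
        "measure lebesgue (\<Union>\<D>) \<le> measure lebesgue ?N + \<delta>/2"
        using \<delta> by (rule measurable_outer_intervals_bounded[OF Nl _ half_gt_zero]) blast
      have KI: "K = {Inf K..Sup K}" "c \<le> Inf K" "Inf K \<le> Sup K" "Sup K \<le> d" if K: "K \<in> \<D>" for K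
      proof -
        obtain s t where st: "K = cbox s t" "K \<noteq> {}" "K \<subseteq> {c..d}" using \<D>(2)[OF K] by auto
        then have "s \<le> t" by auto
        then show "K = {Inf K..Sup K}" "c \<le> Inf K" "Inf K \<le> Sup K" "Sup K \<le> d" using st by auto
      qed
      have fin: "emeasure \<mu> (\<Union>E) \<le> ennreal e" if E: "E \<subseteq> \<D>" "finite E" for E
      proof -
        have Km: "\<And>K. K \<in> E \<Longrightarrow> K \<in> lmeasurable" using E KI by (metis lmeasurable_cbox cbox_interval subsetD)
        have fam: "interval_family c d E Inf Sup"
          unfolding interval_family_def
        proof (intro conjI ballI)
          show "disjoint_family_on (\<lambda>i. {Inf i<..<Sup i}) E"
            unfolding disjoint_family_on_def
          proof (intro ballI impI)
            fix A B assume AB: "A \<in> E" "B \<in> E" "A \<noteq> B"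
            then have "interior A \<inter> interior B = {}" using \<D>(3) E by (auto simp: pairwise_def)
            moreover have "interior A = {Inf A<..<Sup A}" "interior B = {Inf B<..<Sup B}"
              using KI(1)[of A] KI(1)[of B] AB E interior_atLeastAtMost_real by (metis subsetD)+
            ultimately show "{Inf A<..<Sup A} \<inter> {Inf B<..<Sup B} = {}" by simp
          qed
        qed (use E KI in auto)
        have "(\<Sum>K\<in>E. Sup K - Inf K) = (\<Sum>K\<in>E. measure lebesgue K)"
        proof (intro sum.cong refl)
          fix K assume "K \<in> E"
          then have K: "K = {Inf K..Sup K}" "Inf K \<le> Sup K" using KI E by auto
          have "measure lebesgue {Inf K..Sup K} = Sup K - Inf K" using K(2) by simp
          then show "Sup K - Inf K = measure lebesgue K" using K(1) by metis
        qed
        also have "\<dots> = measure lebesgue (\<Union>E)"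
        proof (rule measure_negligible_finite_Union[symmetric])
          show "pairwise (\<lambda>S T. negligible (S \<inter> T)) E"
          proof (rule pairwiseI)
            fix A B assume AB: "A \<in> E" "B \<in> E" "A \<noteq> B"
            then have "{Inf A<..<Sup A} \<inter> {Inf B<..<Sup B} = {}"
              using fam by (auto simp: interval_family_def disjoint_family_on_def)
            moreover have "A = {Inf A..Sup A}" "B = {Inf B..Sup B}" using KI AB E by auto
            ultimately have "A \<inter> B \<subseteq> {Inf A, Sup A, Inf B, Sup B}"
              by (smt (verit, ccfv_SIG) Int_iff atLeastAtMost_iff disjoint_iff greaterThanLessThan_iff insert_iff subsetI)
            then show "negligible (A \<inter> B)" by (meson finite.emptyI finite.insertI negligible_finite negligible_subset)
          qed
        qed (use Km E in auto)
        also have "\<dots> \<le> measure lebesgue (\<Union>\<D>)"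
          using E \<D>(5) Km by (intro measure_mono_fmeasurable) (auto intro!: sets.finite_Union)
        also have "\<dots> < \<delta>" using \<D>(6) \<delta> Nn by (simp add: measure_eq_0_null_sets)
        finally have "(\<Sum>K\<in>E. cmod (of_real (F (Sup K)) - of_real (F (Inf K)))) < e"
          using small[OF fam] by simp
        also have "(\<Sum>K\<in>E. cmod (of_real (F (Sup K)) - of_real (F (Inf K)))) = (\<Sum>K\<in>E. H (Sup K) - H (Inf K))"
        proof (intro sum.cong refl)
          fix K assume "K \<in> E"
          then have K: "c \<le> Inf K" "Inf K \<le> Sup K" "Sup K \<le> d" using KI E by auto
          then have "F (Inf K) \<le> F (Sup K)" by (rule mono)
          then show "cmod (of_real (F (Sup K)) - of_real (F (Inf K))) = H (Sup K) - H (Inf K)"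
            using K by (simp add: H_def flip: of_real_diff)
        qed
        finally have lt: "(\<Sum>K\<in>E. H (Sup K) - H (Inf K)) < e" .
        have "K \<in> sets \<mu>" if "K \<in> E" for K
          using KI(1)[of K] that E sets(1) atLeastAtMost_borel by (metis subsetD)
        then have "emeasure \<mu> (\<Union>E) \<le> (\<Sum>K\<in>E. emeasure \<mu> K)"
          using emeasure_subadditive_finite[of E "\<lambda>x. x" \<mu>] E by auto
        also have "\<dots> = (\<Sum>K\<in>E. ennreal (H (Sup K) - H (Inf K)))"
          using KI E Icc by (intro sum.cong refl) (metis subsetD)
        also have "\<dots> = ennreal (\<Sum>K\<in>E. H (Sup K) - H (Inf K))"
          using KI E monoH by (intro sum_ennreal) auto
        finally show ?thesis using lt by (meson ennreal_leI less_imp_le order_trans)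
      qed
      show ?thesis
      proof (cases "\<D> = {}")
        case False
        define A where "A n = \<Union>(from_nat_into \<D> ` {..<n})" for n
        have inD: "from_nat_into \<D> i \<in> \<D>" for i using False by (rule from_nat_into)
        have Ab: "range A \<subseteq> sets \<mu>"
        proof -
          have "from_nat_into \<D> i \<in> sets \<mu>" for i using KI(1)[OF inD[of i]] sets by (metis atLeastAtMost_borel)
          then show ?thesis by (auto simp: A_def)
        qed
        have "(\<Union>n. A n) = \<Union>\<D>"
        proof -
          have "(\<Union>n. A n) = \<Union>(range (from_nat_into \<D>))" unfolding A_def by auto
          then show ?thesis using range_from_nat_into[OF False \<D>(1)] by simp
        qed
        moreover have "incseq A" unfolding incseq_def A_def by (intro allI impI Union_mono image_mono) auto
        ultimately have "emeasure \<mu> (\<Union>\<D>) = (SUP n. emeasure \<mu> (A n))"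
          using SUP_emeasure_incseq[OF Ab] by simp
        also have "\<dots> \<le> ennreal e"
          unfolding A_def using inD by (intro SUP_least fin) auto
        finally have le: "emeasure \<mu> (\<Union>\<D>) \<le> ennreal e" .
        have "\<Union>\<D> \<in> sets \<mu>"
          using KI(1) \<D>(1) sets by (intro sets.countable_Union) (auto, metis atLeastAtMost_borel)
        then have "emeasure \<mu> ?N \<le> emeasure \<mu> (\<Union>\<D>)" using \<D>(4) by (rule emeasure_mono[rotated])
        then show ?thesis using le by simp
      qed (use \<D> in simp)
    qed
    then have "emeasure \<mu> ?N = 0"
      by (metis ennreal_le_epsilon add.left_neutral le_zero_eq)
    moreover have "emeasure \<mu> N \<le> emeasure \<mu> ?N + emeasure \<mu> (UNIV - {c..d})"
    proof -
      have "emeasure \<mu> N \<le> emeasure \<mu> (?N \<union> (UNIV - {c..d}))"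
        using Nb by (intro emeasure_mono) (auto simp: sets)
      also have "\<dots> \<le> emeasure \<mu> ?N + emeasure \<mu> (UNIV - {c..d})"
        using Nb by (intro emeasure_subadditive) (auto simp: sets)
      finally show ?thesis .
    qed
    ultimately show "N \<in> null_sets \<mu>" using out Nb by (auto simp: null_sets_def sets)
  qed
  obtain f where f: "f \<in> borel_measurable lborel" "density lborel f = \<mu>"
    using sigma_finite_measure.Radon_Nikodym[OF sigma_finite_lborel acm] sets by auto
  have fint: "(\<integral>\<^sup>+x. f x \<partial>lborel) < \<infinity>"
  proof -
    have "emeasure (density lborel f) UNIV = (\<integral>\<^sup>+x. f x \<partial>lborel)"
      using emeasure_density[OF f(1), of UNIV] by simp
    then show ?thesis using mu.emeasure_finite[of UNIV] by (simp add: f(2) less_top[symmetric])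
  qed
  then have AEf: "AE x in lborel. f x \<noteq> \<infinity>" using f(1) by (intro nn_integral_noteq_infinite) auto
  define g where "g x = enn2real (f x)" for x
  have gm: "g \<in> borel_measurable lborel" using f(1) unfolding g_def by measurable
  have gf: "AE x in lborel. ennreal (g x) = f x" using AEf by eventually_elim (auto simp: g_def less_top)
  have gI: "integrable lborel g"
    by (rule integrableI_nonneg) (use gm gf fint nn_integral_cong_AE[OF gf] in \<open>auto simp: g_def\<close>)
  show ?thesis
  proof
    have gs: "set_integrable lborel {c..y} g" for y
      unfolding set_integrable_def by (rule integrable_mult_indicator[OF _ gI]) auto
    then show "g absolutely_integrable_on {c..d}"
      by (simp add: set_integrable_def integrable_completion)
    fix x assume x: "x \<in> {c..d}"
    have "ennreal (F x - F c) = emeasure \<mu> {c..x}" using x by (simp add: Icc H_def)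
    also have "\<dots> = (\<integral>\<^sup>+y. f y * indicator {c..x} y \<partial>lborel)"
      using f by (metis emeasure_density atLeastAtMost_borel sets_lborel)
    also have "\<dots> = (\<integral>\<^sup>+y. ennreal (indicator {c..x} y * g y) \<partial>lborel)"
      by (rule nn_integral_cong_AE) (use gf in \<open>eventually_elim, auto simp: indicator_def\<close>)
    also have "\<dots> = ennreal (LINT y:{c..x}|lborel. g y)"
      unfolding set_lebesgue_integral_def using gs[of x]
      by (subst nn_integral_eq_integral) (auto simp: set_integrable_def g_def)
    also have "(LINT y:{c..x}|lborel. g y) = integral {c..x} g"
      using set_borel_integral_eq_integral(2)[OF gs] by simp
    finally have e: "ennreal (F x - F c) = ennreal (integral {c..x} g)" .
    have "0 \<le> F x - F c" using mono[of c x] x by simp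
    moreover have "0 \<le> integral {c..x} g"
      using set_borel_integral_eq_integral(1)[OF gs] by (intro integral_nonneg) (auto simp: g_def)
    ultimately show "F x - F c = integral {c..x} g" using e by simp
  qed
qed

text \<open>Closure properties of absolute continuity all come from this one: the increments of the new function
are controlled by those of two absolutely continuous functions.\<close>

lemma ac_dominated:
  assumes f: "absolutely_continuous_on a b f" and g: "absolutely_continuous_on a b g"
    and AB: "0 \<le> A" "0 \<le> B"
    and le: "\<And>u v. a \<le> u \<Longrightarrow> u \<le> v \<Longrightarrow> v \<le> b \<Longrightarrow>
        cmod (h v - h u) \<le> A * cmod (f v - f u) + B * cmod (g v - g u)"
  shows "absolutely_continuous_on a b h"
  unfolding absolutely_continuous_on_def
proof (intro allI impI)
  fix e :: real assume e: "e > 0"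
  define C where "C = A + B + 1"
  have C: "C > 0" "A \<le> C" "B \<le> C" using AB by (auto simp: C_def)
  define e' where "e' = e / (2 * C)"
  have e': "e' > 0" using e C by (simp add: e'_def)
  obtain d1 where d1: "d1 > 0" "\<And>(I::nat set) u v. interval_family a b I u v \<Longrightarrow>
     (\<Sum>i\<in>I. v i - u i) < d1 \<Longrightarrow> (\<Sum>i\<in>I. cmod (f (v i) - f (u i))) < e'"
    by (rule absolutely_continuous_on_family[OF f e', where 'i=nat]) blast
  obtain d2 where d2: "d2 > 0" "\<And>(I::nat set) u v. interval_family a b I u v \<Longrightarrow>
     (\<Sum>i\<in>I. v i - u i) < d2 \<Longrightarrow> (\<Sum>i\<in>I. cmod (g (v i) - g (u i))) < e'"
    by (rule absolutely_continuous_on_family[OF g e', where 'i=nat]) blast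
  show "\<exists>d>0. \<forall>(n::nat) u v. (\<forall>i<n. a \<le> u i \<and> u i \<le> v i \<and> v i \<le> b) \<longrightarrow>
        disjoint_family_on (\<lambda>i. {u i<..<v i}) {..<n} \<longrightarrow> (\<Sum>i<n. v i - u i) < d \<longrightarrow>
        (\<Sum>i<n. cmod (h (v i) - h (u i))) < e"
  proof (intro exI[of _ "min d1 d2"] conjI allI impI)
    fix n :: nat and u v :: "nat \<Rightarrow> real"
    assume uv: "\<forall>i<n. a \<le> u i \<and> u i \<le> v i \<and> v i \<le> b" "disjoint_family_on (\<lambda>i. {u i<..<v i}) {..<n}"
      "(\<Sum>i<n. v i - u i) < min d1 d2"
    then have fam: "interval_family a b {..<n} u v" by (auto simp: interval_family_def)
    have "(\<Sum>i<n. cmod (h (v i) - h (u i))) \<le> (\<Sum>i<n. A * cmod (f (v i) - f (u i)) + B * cmod (g (v i) - g (u i)))"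
      using uv by (intro sum_mono le) auto
    also have "\<dots> = A * (\<Sum>i<n. cmod (f (v i) - f (u i))) + B * (\<Sum>i<n. cmod (g (v i) - g (u i)))"
      by (simp add: sum.distrib sum_distrib_left)
    also have "\<dots> \<le> C * (\<Sum>i<n. cmod (f (v i) - f (u i))) + C * (\<Sum>i<n. cmod (g (v i) - g (u i)))"
      using C by (intro add_mono mult_right_mono sum_nonneg) auto
    also have "\<dots> < C * e' + C * e'"
      using d1(2)[OF fam] d2(2)[OF fam] uv(3) C by (intro add_strict_mono mult_strict_left_mono) auto
    also have "\<dots> = e" using C by (simp add: e'_def)
    finally show "(\<Sum>i<n. cmod (h (v i) - h (u i))) < e" .
  qed (use d1 d2 in auto)
qed

lemma ac_add:
  assumes "absolutely_continuous_on a b f" "absolutely_continuous_on a b g"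
  shows "absolutely_continuous_on a b (\<lambda>x. f x + g x)"
proof (rule ac_dominated[OF assms, of 1 1])
  fix u v
  have "f v + g v - (f u + g u) = (f v - f u) + (g v - g u)" by simp
  then show "cmod (f v + g v - (f u + g u)) \<le> 1 * cmod (f v - f u) + 1 * cmod (g v - g u)"
    by (metis mult_1 norm_triangle_ineq)
qed auto

lemma ac_lipschitz:
  assumes "\<And>u v. a \<le> u \<Longrightarrow> u \<le> v \<Longrightarrow> v \<le> b \<Longrightarrow> cmod (f v - f u) \<le> L * (v - u)" and "L \<ge> 0"
  shows "absolutely_continuous_on a b f"
  unfolding absolutely_continuous_on_def
proof (intro allI impI)
  fix e :: real assume e: "e > 0"
  show "\<exists>d>0. \<forall>(n::nat) u v. (\<forall>i<n. a \<le> u i \<and> u i \<le> v i \<and> v i \<le> b) \<longrightarrow>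
        disjoint_family_on (\<lambda>i. {u i<..<v i}) {..<n} \<longrightarrow> (\<Sum>i<n. v i - u i) < d \<longrightarrow>
        (\<Sum>i<n. cmod (f (v i) - f (u i))) < e"
  proof (intro exI[of _ "e / (L + 1)"] conjI allI impI)
    show "0 < e / (L + 1)" using e assms by simp
    fix n :: nat and u v :: "nat \<Rightarrow> real"
    assume uv: "\<forall>i<n. a \<le> u i \<and> u i \<le> v i \<and> v i \<le> b" and s: "(\<Sum>i<n. v i - u i) < e / (L + 1)"
    have "(\<Sum>i<n. cmod (f (v i) - f (u i))) \<le> (\<Sum>i<n. (L + 1) * (v i - u i))"
    proof (rule sum_mono)
      fix i assume "i \<in> {..<n}"
      then have "cmod (f (v i) - f (u i)) \<le> L * (v i - u i)" "u i \<le> v i" using assms(1) uv by auto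
      then show "cmod (f (v i) - f (u i)) \<le> (L + 1) * (v i - u i)" by (simp add: algebra_simps)
    qed
    also have "\<dots> = (L + 1) * (\<Sum>i<n. v i - u i)" by (simp add: sum_distrib_left)
    also have "\<dots> < (L + 1) * (e / (L + 1))" using s assms by (intro mult_strict_left_mono) auto
    also have "\<dots> = e" using assms by simp
    finally show "(\<Sum>i<n. cmod (f (v i) - f (u i))) < e" .
  qed
qed

lemma ac_of_C1:
  assumes der: "\<And>x. x \<in> {a..b} \<Longrightarrow> (f has_vector_derivative f' x) (at x within {a..b})"
    and cont: "continuous_on {a..b} f'"
  shows "absolutely_continuous_on a b f"
proof -
  have "bounded (f' ` {a..b})" using cont by (auto intro!: compact_imp_bounded compact_continuous_image)
  then obtain B where B: "B > 0" "\<And>x. x \<in> {a..b} \<Longrightarrow> cmod (f' x) \<le> B" unfolding bounded_pos by blast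
  show ?thesis
  proof (rule ac_lipschitz[of _ _ _ B])
    fix u v assume uv: "a \<le> u" "u \<le> v" "v \<le> b"
    have "norm (f v - f u) \<le> B * norm (v - u)"
    proof (rule differentiable_bound[where S="{u..v}" and f'="\<lambda>x h. h *\<^sub>R f' x"])
      fix x assume x: "x \<in> {u..v}"
      have "(f has_vector_derivative f' x) (at x within {u..v})"
        by (rule has_vector_derivative_within_subset[OF der]) (use x uv in auto)
      then show "(f has_derivative (\<lambda>h. h *\<^sub>R f' x)) (at x within {u..v})"
        by (simp add: has_vector_derivative_def)
      show "onorm (\<lambda>h. h *\<^sub>R f' x) \<le> B"
        using B(2)[of x] x uv by (simp add: onorm_scaleR_left_lemma onorm_scaleR_left[OF bounded_linear_ident] onorm_id)
    qed (use uv in auto)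
    then show "cmod (f v - f u) \<le> B * (v - u)" using uv by simp
  qed (use B in simp)
qed

lemma ac_const: "absolutely_continuous_on a b (\<lambda>x. c)"
  by (rule ac_lipschitz[of _ _ _ 0]) auto

lemma ac_cong:
  assumes "absolutely_continuous_on a b f" "\<And>x. a \<le> x \<Longrightarrow> x \<le> b \<Longrightarrow> f x = g x"
  shows "absolutely_continuous_on a b g"
  by (rule ac_dominated[OF assms(1,1), of 1 0]) (use assms(2) in auto)

lemma ac_contraction:
  assumes "absolutely_continuous_on a b f"
    "\<And>u v. a \<le> u \<Longrightarrow> u \<le> v \<Longrightarrow> v \<le> b \<Longrightarrow> cmod (g v - g u) \<le> cmod (f v - f u)"
  shows "absolutely_continuous_on a b g"
  by (rule ac_dominated[OF assms(1,1), of 1 0]) (use assms(2) in auto)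

lemma ac_cnj:
  assumes "absolutely_continuous_on a b f"
  shows "absolutely_continuous_on a b (\<lambda>x. cnj (f x))"
  by (rule ac_contraction[OF assms]) (metis complex_cnj_diff complex_mod_cnj order_refl)

lemma ac_uminus:
  assumes "absolutely_continuous_on a b f"
  shows "absolutely_continuous_on a b (\<lambda>x. - f x)"
  by (rule ac_contraction[OF assms]) (simp add: norm_minus_commute)

lemma ac_diff:
  assumes "absolutely_continuous_on a b f" "absolutely_continuous_on a b g"
  shows "absolutely_continuous_on a b (\<lambda>x. f x - g x)"
  using ac_add[OF assms(1) ac_uminus[OF assms(2)]] by simp

lemma ac_mult:
  assumes f: "absolutely_continuous_on a b f" and g: "absolutely_continuous_on a b g"
  shows "absolutely_continuous_on a b (\<lambda>x. f x * g x)"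
proof -
  have bd: "bounded (f ` {a..b})" "bounded (g ` {a..b})"
    using ac_imp_continuous_on[OF f] ac_imp_continuous_on[OF g]
    by (auto intro!: compact_imp_bounded compact_continuous_image)
  obtain A where A: "A > 0" "\<And>x. x \<in> {a..b} \<Longrightarrow> cmod (f x) \<le> A"
    using bd(1) unfolding bounded_pos by blast
  obtain B where B: "B > 0" "\<And>x. x \<in> {a..b} \<Longrightarrow> cmod (g x) \<le> B"
    using bd(2) unfolding bounded_pos by blast
  show ?thesis
  proof (rule ac_dominated[OF f g, of B A])
    fix u v assume uv: "a \<le> u" "u \<le> v" "v \<le> b"
    have "f v * g v - f u * g u = (f v - f u) * g u + f v * (g v - g u)" by (simp add: algebra_simps)
    then have "cmod (f v * g v - f u * g u) \<le> cmod (f v - f u) * cmod (g u) + cmod (f v) * cmod (g v - g u)"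
      by (metis norm_mult norm_triangle_ineq)
    also have "\<dots> \<le> B * cmod (f v - f u) + A * cmod (g v - g u)"
      using A(2)[of v] B(2)[of u] uv by (intro add_mono) (auto simp: mult.commute mult_right_mono)
    finally show "cmod (f v * g v - f u * g u) \<le> B * cmod (f v - f u) + A * cmod (g v - g u)" .
  qed (use A B in auto)
qed

lemma ac_subinterval:
  assumes "absolutely_continuous_on a b f" "a \<le> c" "d \<le> b"
  shows "absolutely_continuous_on c d f"
  unfolding absolutely_continuous_on_def
proof (intro allI impI)
  fix e :: real assume "e > 0"
  then obtain \<delta> where \<delta>: "\<delta> > 0" "\<And>(n::nat) u v. (\<forall>i<n. a \<le> u i \<and> u i \<le> v i \<and> v i \<le> b) \<Longrightarrow>
        disjoint_family_on (\<lambda>i. {u i<..<v i}) {..<n} \<Longrightarrow> (\<Sum>i<n. v i - u i) < \<delta> \<Longrightarrow>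
        (\<Sum>i<n. cmod (f (v i) - f (u i))) < e"
    using assms(1)[unfolded absolutely_continuous_on_def, rule_format, of e] by blast
  show "\<exists>\<delta>>0. \<forall>(n::nat) u v. (\<forall>i<n. c \<le> u i \<and> u i \<le> v i \<and> v i \<le> d) \<longrightarrow>
        disjoint_family_on (\<lambda>i. {u i<..<v i}) {..<n} \<longrightarrow> (\<Sum>i<n. v i - u i) < \<delta> \<longrightarrow>
        (\<Sum>i<n. cmod (f (v i) - f (u i))) < e"
    using \<delta>(1) by (intro exI[of _ \<delta>] conjI allI impI \<delta>(2)) (use assms in force)+
qed

text \<open>On short intervals the function is the difference of two increasing absolutely continuous functions
(its positive variation, and the positive variation minus the function), to which
\<open>mono_ac_eq_integral\<close> applies. Bolzano's bisection principle glues the short intervals.\<close>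

lemma ac_real_eq_integral:
  fixes F :: "real \<Rightarrow> real"
  assumes ac: "absolutely_continuous_on a b (\<lambda>x. of_real (F x))" and ab: "a \<le> b"
  obtains g where "g absolutely_integrable_on {a..b}" "\<And>x. x \<in> {a..b} \<Longrightarrow> F x - F a = integral {a..x} g"
proof -
  obtain \<delta> where \<delta>: "\<delta> > 0" and small: "\<And>(I::nat set) u v. interval_family a b I u v \<Longrightarrow>
     (\<Sum>i\<in>I. v i - u i) < \<delta> \<Longrightarrow> (\<Sum>i\<in>I. cmod (of_real (F (v i)) - of_real (F (u i)))) < 1"
    by (rule absolutely_continuous_on_family[OF ac zero_less_one, where 'i=nat]) blast
  define Q where "Q c d \<longleftrightarrow> (a \<le> c \<longrightarrow> c \<le> d \<longrightarrow> d \<le> b \<longrightarrow>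
     (\<exists>g. g absolutely_integrable_on {c..d} \<and> (\<forall>x\<in>{c..d}. F x - F c = integral {c..x} g)))" for c d
  have "Q a b"
  proof (rule Bolzano[OF ab])
    fix c d e assume Q: "Q c d" "Q d e" and le: "c \<le> d" "d \<le> e"
    show "Q c e"
      unfolding Q_def
    proof (intro impI)
      assume *: "a \<le> c" "c \<le> e" "e \<le> b"
      obtain g1 where g1: "g1 absolutely_integrable_on {c..d}" "\<forall>x\<in>{c..d}. F x - F c = integral {c..x} g1"
        using Q(1) * le unfolding Q_def by auto
      obtain g2 where g2: "g2 absolutely_integrable_on {d..e}" "\<forall>x\<in>{d..e}. F x - F d = integral {d..x} g2"
        using Q(2) * le unfolding Q_def by auto
      define g where "g x = (if x \<le> d then g1 x else g2 x)" for x
      have ga1: "g absolutely_integrable_on {c..d}"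
        by (rule absolutely_integrable_spike[OF g1(1), of "{}"]) (auto simp: g_def)
      have ga2: "g absolutely_integrable_on {d..e}"
        by (rule absolutely_integrable_spike[OF g2(1), of "{d}"]) (auto simp: g_def)
      have ga: "g absolutely_integrable_on {c..e}"
        using absolutely_integrable_on_combine[OF ga1 ga2] le by auto
      have i1: "integral {c..x} g = F x - F c" if "x \<in> {c..d}" for x
      proof -
        have "integral {c..x} g = integral {c..x} g1"
          by (rule integral_cong) (use that in \<open>auto simp: g_def\<close>)
        then show ?thesis using g1 that by auto
      qed
      have i2: "integral {d..x} g = F x - F d" if "x \<in> {d..e}" for x
      proof -
        have "integral {d..x} g = integral {d..x} g2"
          by (rule integral_spike[of "{d}"]) (use that in \<open>auto simp: g_def\<close>)
        then show ?thesis using g2 that by auto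
      qed
      have "F x - F c = integral {c..x} g" if x: "x \<in> {c..e}" for x
      proof (cases "x \<le> d")
        case False
        have "g integrable_on {c..x}"
          using absolutely_integrable_on_subinterval[OF ga, of c x] x set_lebesgue_integral_eq_integral(1) by auto
        then have "integral {c..d} g + integral {d..x} g = integral {c..x} g"
          using False le by (intro Henstock_Kurzweil_Integration.integral_combine) auto
        then show ?thesis using i1[of d] i2[of x] x le False by auto
      qed (use i1 x in auto)
      then show "\<exists>g. g absolutely_integrable_on {c..e} \<and> (\<forall>x\<in>{c..e}. F x - F c = integral {c..x} g)"
        using ga by blast
    qed
  next
    fix x
    have "Q c d" if cx: "c \<le> x" "x \<le> d" "d - c < \<delta>" for c d
      unfolding Q_def
    proof (intro impI)
      assume *: "a \<le> c" "c \<le> d" "d \<le> b"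
      interpret short_ac F c d
      proof
        show acF: "absolutely_continuous_on c d (\<lambda>x. of_real (F x))" by (rule ac_subinterval[OF ac]) (use * in auto)
        fix I :: "nat set" and u v assume I: "interval_family c d I u v"
        have I': "interval_family a b I u v"
        proof (rule interval_family_sub[OF I])
          fix i assume "i \<in> I"
          then have "c \<le> u i \<and> u i \<le> v i \<and> v i \<le> d" using I unfolding interval_family_def by blast
          then show "a \<le> u i \<and> u i \<le> v i \<and> v i \<le> b" using * by linarith
        qed blast
        have "(\<Sum>i\<in>I. F (v i) - F (u i)) \<le> (\<Sum>i\<in>I. cmod (of_real (F (v i)) - of_real (F (u i))))"
          by (intro sum_mono) (simp flip: of_real_diff)
        also have "\<dots> < 1" using small[OF I'] interval_family_length_le[OF I] * cx by simp
        finally show "(\<Sum>i\<in>I. F (v i) - F (u i)) \<le> 1" by simp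
      qed (use * in auto)
      obtain g1 where g1: "g1 absolutely_integrable_on {c..d}"
        "\<And>x. x \<in> {c..d} \<Longrightarrow> P c x - P c c = integral {c..x} g1"
      proof (rule mono_ac_eq_integral[OF positive_variation_ac cd])
        show "P c x \<le> P c y" if "c \<le> x" "x \<le> y" "y \<le> d" for x y using positive_variation_step[OF that] by auto
      qed blast
      have ac2: "absolutely_continuous_on c d (\<lambda>x. of_real (P c x - F x))"
        using ac_diff[OF positive_variation_ac short_ac.ac[OF short_ac_axioms]] by simp
      obtain g2 where g2: "g2 absolutely_integrable_on {c..d}"
        "\<And>x. x \<in> {c..d} \<Longrightarrow> (P c x - F x) - (P c c - F c) = integral {c..x} g2"
      proof (rule mono_ac_eq_integral[OF ac2 cd])
        show "P c x - F x \<le> P c y - F y" if "c \<le> x" "x \<le> y" "y \<le> d" for x y using positive_variation_step[OF that] by auto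
      qed blast
      have "F x - F c = integral {c..x} (\<lambda>x. g1 x - g2 x)" if "x \<in> {c..d}" for x
      proof -
        have "g1 integrable_on {c..x}" "g2 integrable_on {c..x}"
          using absolutely_integrable_on_subinterval[OF g1(1), of c x] absolutely_integrable_on_subinterval[OF g2(1), of c x]
            that set_lebesgue_integral_eq_integral(1) by auto
        then show ?thesis using g1(2)[OF that] g2(2)[OF that] by (simp add: integral_diff)
      qed
      moreover have "(\<lambda>x. g1 x - g2 x) absolutely_integrable_on {c..d}" using g1 g2 by (intro set_integral_diff)
      ultimately show "\<exists>g. g absolutely_integrable_on {c..d} \<and> (\<forall>x\<in>{c..d}. F x - F c = integral {c..x} g)" by blast
    qed
    then show "\<exists>r>0. \<forall>c d. c \<le> x \<and> x \<le> d \<and> d - c < r \<longrightarrow> Q c d" using \<delta> by blast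
  qed
  then show ?thesis using that ab unfolding Q_def by auto
qed

lemma abs_int_Complex:
  assumes "f absolutely_integrable_on S" "g absolutely_integrable_on S"
  shows "(\<lambda>x. Complex (f x) (g x)) absolutely_integrable_on S"
    and "S \<in> sets lebesgue \<Longrightarrow> integral S (\<lambda>x. Complex (f x) (g x)) = Complex (integral S f) (integral S g)"
proof -
  have l1: "(\<lambda>x. complex_of_real (f x)) absolutely_integrable_on S" 
    using absolutely_integrable_linear[OF assms(1) bounded_linear_of_real[where 'a=complex]] by (simp add: o_def)
  have l2: "(\<lambda>x. \<i> * complex_of_real (g x)) absolutely_integrable_on S" 
    using absolutely_integrable_linear[OF assms(2) bounded_linear_of_real[where 'a=complex]] by (simp add: o_def)
  show *: "(\<lambda>x. Complex (f x) (g x)) absolutely_integrable_on S"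
    using set_integral_add(1)[OF l1 l2] by (simp add: Complex_eq)
  have int: "(\<lambda>x. Complex (f x) (g x)) integrable_on S" using * by (rule set_lebesgue_integral_eq_integral(1))
  show "integral S (\<lambda>x. Complex (f x) (g x)) = Complex (integral S f) (integral S g)"
    using integral_linear[OF int bounded_linear_Re] integral_linear[OF int bounded_linear_Im]
    by (simp add: complex_eq_iff o_def)
qed

lemma ac_eq_integral:
  assumes ac: "absolutely_continuous_on a b f" and ab: "a \<le> b"
  obtains g where "g absolutely_integrable_on {a..b}" "\<And>x. x \<in> {a..b} \<Longrightarrow> f x - f a = integral {a..x} g"
proof -
  have r: "absolutely_continuous_on a b (\<lambda>x. of_real (Re (f x)))"
    by (rule ac_contraction[OF ac]) (metis abs_Re_le_cmod minus_complex.sel(1) norm_of_real of_real_diff)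
  have i: "absolutely_continuous_on a b (\<lambda>x. of_real (Im (f x)))"
    by (rule ac_contraction[OF ac]) (metis abs_Im_le_cmod minus_complex.sel(2) norm_of_real of_real_diff)
  obtain g1 where g1: "g1 absolutely_integrable_on {a..b}" "\<And>x. x \<in> {a..b} \<Longrightarrow> Re (f x) - Re (f a) = integral {a..x} g1"
    using ac_real_eq_integral[OF r ab] by blast
  obtain g2 where g2: "g2 absolutely_integrable_on {a..b}" "\<And>x. x \<in> {a..b} \<Longrightarrow> Im (f x) - Im (f a) = integral {a..x} g2"
    using ac_real_eq_integral[OF i ab] by blast
  show ?thesis
  proof
    show "(\<lambda>x. Complex (g1 x) (g2 x)) absolutely_integrable_on {a..b}" using g1 g2 by (intro abs_int_Complex)
    fix x assume x: "x \<in> {a..b}"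
    then have "g1 absolutely_integrable_on {a..x}" "g2 absolutely_integrable_on {a..x}"
      using absolutely_integrable_on_subinterval[OF g1(1), of a x] absolutely_integrable_on_subinterval[OF g2(1), of a x] by auto
    then show "f x - f a = integral {a..x} (\<lambda>x. Complex (g1 x) (g2 x))"
      using g1(2)[OF x] g2(2)[OF x] by (subst abs_int_Complex) (auto simp: complex_eq_iff)
  qed
qed

text \<open>The converse direction: an indefinite integral is absolutely continuous because the integral of
\<open>cmod \<circ> g\<close> over a union of short intervals is small.\<close>

lemma ac_indefinite_integral:
  fixes g :: "real \<Rightarrow> complex"
  assumes g: "g absolutely_integrable_on {a..b}"
  shows "absolutely_continuous_on a b (\<lambda>x. integral {a..x} g)"
  unfolding absolutely_continuous_on_def
proof (intro allI impI)
  fix e :: real assume e: "e > 0"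
  define w where "w x = indicator {a..b} x *\<^sub>R cmod (g x)" for x
  have w: "integrable lebesgue w" "\<And>x. 0 \<le> w x"
    using absolutely_integrable_norm[OF g] by (auto simp: w_def[abs_def] set_integrable_def)
  obtain d where d: "d > 0" "\<And>T. T \<in> lmeasurable \<Longrightarrow> measure lebesgue T < d \<Longrightarrow> (LINT x:T|lebesgue. w x) < e"
    using integral_small_on_small_sets[OF w e] by metis
  show "\<exists>d>0. \<forall>(n::nat) u v. (\<forall>i<n. a \<le> u i \<and> u i \<le> v i \<and> v i \<le> b) \<longrightarrow>
        disjoint_family_on (\<lambda>i. {u i<..<v i}) {..<n} \<longrightarrow> (\<Sum>i<n. v i - u i) < d \<longrightarrow>
        (\<Sum>i<n. cmod (integral {a..v i} g - integral {a..u i} g)) < e"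
  proof (intro exI[of _ d] conjI allI impI)
    fix n :: nat and u v :: "nat \<Rightarrow> real"
    assume uv: "\<forall>i<n. a \<le> u i \<and> u i \<le> v i \<and> v i \<le> b"
      and dj: "disjoint_family_on (\<lambda>i. {u i<..<v i}) {..<n}" and s: "(\<Sum>i<n. v i - u i) < d"
    define T where "T = (\<Union>i<n. {u i<..<v i})"
    have Tm: "T \<in> lmeasurable" unfolding T_def by (intro fmeasurable.finite_UN) auto
    have "measure lebesgue T = (\<Sum>i<n. measure lebesgue {u i<..<v i})"
      unfolding T_def using dj uv by (intro measure_finite_Union) auto
    also have "\<dots> = (\<Sum>i<n. v i - u i)" using uv by (intro sum.cong) auto
    finally have mT: "measure lebesgue T < d" using s by simp
    have "(\<Sum>i<n. cmod (integral {a..v i} g - integral {a..u i} g)) \<le> (\<Sum>i<n. LINT x:{u i<..<v i}|lebesgue. w x)"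
    proof (rule sum_mono)
      fix i assume "i \<in> {..<n}"
      then have i: "a \<le> u i" "u i \<le> v i" "v i \<le> b" using uv by auto
      have gi: "g absolutely_integrable_on {u i..v i}"
        using absolutely_integrable_on_subinterval[OF g, of "u i" "v i"] i by auto
      have "cmod (integral {a..v i} g - integral {a..u i} g) = cmod (integral {u i..v i} g)"
        using integral_diff_interval[OF g i] by simp
      also have "\<dots> \<le> integral {u i..v i} (\<lambda>x. cmod (g x))"
        using gi by (intro integral_norm_bound_integral) (auto simp: absolutely_integrable_on_def)
      also have "\<dots> = integral {u i..v i} w"
        using i by (intro integral_cong) (auto simp: w_def)
      also have "\<dots> = integral {u i<..<v i} w" by (simp add: integral_open_interval_real)
      also have "\<dots> = (LINT x:{u i<..<v i}|lebesgue. w x)"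
        using integrable_mult_indicator[OF _ w(1), of "{u i<..<v i}"]
        by (intro set_lebesgue_integral_eq_integral(2)[symmetric]) (auto simp: set_integrable_def)
      finally show "cmod (integral {a..v i} g - integral {a..u i} g) \<le> (LINT x:{u i<..<v i}|lebesgue. w x)" .
    qed
    also have "\<dots> = (LINT x:T|lebesgue. w x)"
      unfolding T_def using dj integrable_mult_indicator[OF _ w(1)]
      by (intro set_integral_finite_Union[symmetric]) (auto simp: set_integrable_def)
    also have "\<dots> < e" using d(2)[OF Tm mT] .
    finally show "(\<Sum>i<n. cmod (integral {a..v i} g - integral {a..u i} g)) < e" .
  qed (use d in auto)
qed

text \<open>The two descriptions of absolute continuity meet: the density provided by the Radon-Nikodym theorem
is almost everywhere the derivative.\<close>

lemma ac_has_derivative_ae: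
  assumes ac: "absolutely_continuous_on a b f" and ab: "a \<le> b"
  obtains g N where "g absolutely_integrable_on {a..b}" "\<And>x. x \<in> {a..b} \<Longrightarrow> f x - f a = integral {a..x} g"
    "negligible N" "\<And>x. x \<in> {a<..<b} - N \<Longrightarrow> (f has_vector_derivative g x) (at x)"
proof -
  obtain g where g: "g absolutely_integrable_on {a..b}" "\<And>x. x \<in> {a..b} \<Longrightarrow> f x - f a = integral {a..x} g"
    using ac_eq_integral[OF ac ab] by blast
  obtain N where N: "negligible N" "\<And>x. x \<in> {a<..<b} - N \<Longrightarrow> ((\<lambda>x. integral {a..x} g) has_vector_derivative g x) (at x)"
    using indefinite_integral_has_derivative_ae[OF g(1)] by blast
  have fe: "f a + integral {a..y} g = f y" if "y \<in> {a<..<b}" for y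
  proof -
    have "integral {a..y} g = f y - f a" using g(2)[of y] that by simp
    then show ?thesis by simp
  qed
  have "(f has_vector_derivative g x) (at x)" if x: "x \<in> {a<..<b} - N" for x
  proof -
    have "((\<lambda>x. integral {a..x} g) has_vector_derivative g x) (at x)" using N x by auto
    then have "((\<lambda>x. f a + integral {a..x} g) has_vector_derivative g x) (at x)"
      by (auto intro!: derivative_eq_intros)
    then show ?thesis
      by (rule has_vector_derivative_transform_within_open[of _ _ _ "{a<..<b}"])
         (use x fe in auto)
  qed
  then show ?thesis using that g N(1) by blast
qed

lemma ac_FTC:
  assumes ac: "absolutely_continuous_on a b f" and ab: "a \<le> b" and N: "negligible N"
    and D: "\<And>x. x \<in> {a<..<b} - N \<Longrightarrow> (f has_vector_derivative p x) (at x)"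
  shows "p absolutely_integrable_on {a..b}" and "\<And>x. x \<in> {a..b} \<Longrightarrow> f x - f a = integral {a..x} p"
proof -
  obtain g M where g: "g absolutely_integrable_on {a..b}" "\<And>x. x \<in> {a..b} \<Longrightarrow> f x - f a = integral {a..x} g"
    and M: "negligible M" "\<And>x. x \<in> {a<..<b} - M \<Longrightarrow> (f has_vector_derivative g x) (at x)"
    using ac_has_derivative_ae[OF ac ab] by blast
  have eq: "p x = g x" if x: "x \<in> {a..b} - (N \<union> M \<union> {a,b})" for x
  proof -
    have "(f has_vector_derivative g x) (at x)" "(f has_vector_derivative p x) (at x)" using M D x by auto
    then show ?thesis using vector_derivative_unique_at by metis
  qed
  have neg: "negligible (N \<union> M \<union> {a,b})" using N M by (intro negligible_Un) auto
  show "p absolutely_integrable_on {a..b}"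
    by (rule absolutely_integrable_spike[OF g(1) neg]) (use eq in auto)
  fix x assume x: "x \<in> {a..b}"
  have "integral {a..x} p = integral {a..x} g"
    by (rule integral_spike[OF neg]) (use eq x in auto)
  then show "f x - f a = integral {a..x} p" using g x by simp
qed

lemma ac_differentiable_ae:
  assumes ac: "absolutely_continuous_on a b f" and ab: "a \<le> b"
  obtains N where "negligible N" "\<And>x. x \<in> {a<..<b} - N \<Longrightarrow> f differentiable (at x)"
  using ac_has_derivative_ae[OF ac ab] differentiableI_vector by metis

section \<open>Calculus of regular functions on a half-line\<close>

lemma at_within_half_line_not_bot:
  fixes l x :: real assumes "x \<ge> l" shows "at x within {l..} \<noteq> bot"
proof -
  have "{l..} \<noteq> {c}" for c :: real
  proof
    assume "{l..} = {c}"
    moreover have "max l c + 1 \<in> {l..}" by auto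
    ultimately show False by auto
  qed
  then have "x islimpt {l..}" using assms by (intro connected_imp_perfect) auto
  then show ?thesis by (simp add: trivial_limit_within)
qed

lemma regular_has_derivative:
  assumes "regular l y" "x \<ge> l"
  shows "(y has_vector_derivative dif l y x) (at x within {l..})"
  using assms unfolding regular_def dif_def by (simp add: vector_derivative_works)

lemma dif_eqI:
  assumes "(y has_vector_derivative p) (at x within {l..})" "x \<ge> l"
  shows "dif l y x = p"
  unfolding dif_def using vector_derivative_within[OF at_within_half_line_not_bot] assms by blast

lemma at_within_half_line: "x > l \<Longrightarrow> at x within {l..} = at (x::real)"
  by (rule at_within_interior) simp

lemma dif_eqI_interior:
  assumes "(y has_vector_derivative p) (at x)" "x > l"
  shows "dif l y x = p"
  using assms by (intro dif_eqI) (auto intro: has_vector_derivative_at_within)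

lemma continuous_on_half_lineI:
  fixes f :: "real \<Rightarrow> 'a::metric_space"
  assumes "\<And>b. b \<ge> l \<Longrightarrow> continuous_on {l..b} f"
  shows "continuous_on {l..} f"
  unfolding continuous_on_iff
proof (intro ballI allI impI)
  fix x e :: real assume x: "x \<in> {l..}" and e: "e > 0"
  have "continuous_on {l..x+1} f" using x assms by auto
  then obtain d where d: "d > 0" "\<And>x'. x' \<in> {l..x+1} \<Longrightarrow> dist x' x < d \<Longrightarrow> dist (f x') (f x) < e"
    unfolding continuous_on_iff using x e by (metis atLeastAtMost_iff atLeast_iff le_add_same_cancel1 zero_le_one)
  show "\<exists>d>0. \<forall>x'\<in>{l..}. dist x' x < d \<longrightarrow> dist (f x') (f x) < e"
    using d by (intro exI[of _ "min d 1"]) (auto simp: dist_real_def)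
qed

lemma regular_continuous:
  assumes "regular l y"
  shows "continuous_on {l..} y" "continuous_on {l..} (dif l y)"
  using assms ac_imp_continuous_on
  by (auto simp: regular_def locally_absolutely_continuous_def intro!: continuous_on_half_lineI)

text \<open>Only the derivative needs to be tested for local absolute continuity, since a continuously
differentiable function is locally Lipschitz.\<close>

lemma regularI:
  assumes zero: "\<And>x. x < l \<Longrightarrow> y x = 0"
    and der: "\<And>x. x \<ge> l \<Longrightarrow> (y has_vector_derivative y1 x) (at x within {l..})"
    and ac: "locally_absolutely_continuous l y1"
  shows "regular l y" "\<And>x. x \<ge> l \<Longrightarrow> dif l y x = y1 x"
proof -
  show d: "dif l y x = y1 x" if "x \<ge> l" for x using der[OF that] that by (rule dif_eqI)
  have "locally_absolutely_continuous l (dif l y)"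
    using ac d ac_cong unfolding locally_absolutely_continuous_def by metis
  moreover have "locally_absolutely_continuous l y"
    unfolding locally_absolutely_continuous_def
  proof (intro allI impI)
    fix b assume b: "b \<ge> l"
    show "absolutely_continuous_on l b y"
    proof (rule ac_of_C1)
      show "(y has_vector_derivative y1 x) (at x within {l..b})" if "x \<in> {l..b}" for x
        by (rule has_vector_derivative_within_subset[OF der]) (use that in auto)
      show "continuous_on {l..b} y1"
        using ac b ac_imp_continuous_on by (auto simp: locally_absolutely_continuous_def)
    qed
  qed
  moreover have "\<forall>x\<ge>l. y differentiable (at x within {l..})" using der differentiableI_vector by blast
  ultimately show "regular l y" using zero by (simp add: regular_def)
qed

text \<open>The exceptional sets of the bounded intervals \<open>[l, l + n]\<close> have a null set as their union.\<close>

lemma regular_second_derivative: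
  assumes "regular l y"
  obtains N where "negligible N"
    "\<And>x. x > l \<Longrightarrow> x \<notin> N \<Longrightarrow> (dif l y has_vector_derivative dif l (dif l y) x) (at x)"
proof -
  have "\<exists>N. negligible N \<and> (\<forall>x\<in>{l<..<l + real n} - N. dif l y differentiable (at x))" for n :: nat
  proof -
    have "absolutely_continuous_on l (l + real n) (dif l y)"
      using assms by (simp add: regular_def locally_absolutely_continuous_def)
    then show ?thesis using ac_differentiable_ae[of l "l + real n" "dif l y"] by (metis add_increasing2 of_nat_0_le_iff order_refl)
  qed
  then obtain N where N: "\<And>n. negligible (N n)" "\<And>n x. x \<in> {l<..<l + real n} - N n \<Longrightarrow> dif l y differentiable (at x)"
    by metis
  show ?thesis
  proof
    show "negligible (\<Union>(range N))" using N by (intro negligible_countable_Union) auto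
    fix x assume x: "x > l" "x \<notin> \<Union>(range N)"
    obtain n :: nat where "x - l < real n" using reals_Archimedean2 by blast
    then have "dif l y differentiable (at x)" using N(2)[of x n] x by auto
    then have "(dif l y has_vector_derivative vector_derivative (dif l y) (at x)) (at x)"
      by (simp add: vector_derivative_works)
    then show "(dif l y has_vector_derivative dif l (dif l y) x) (at x)"
      using x at_within_half_line[of l x] by (simp add: dif_def[of l "dif l y"])
  qed
qed

lemma regular_FTC:
  assumes "regular l y" "l \<le> a" "a \<le> b"
  shows "integral {a..b} (dif l y) = y b - y a"
    and "dif l (dif l y) absolutely_integrable_on {l..b}"
    and "integral {l..b} (dif l (dif l y)) = dif l y b - dif l y l"
proof -
  have "((dif l y) has_integral (y b - y a)) {a..b}"
  proof (rule fundamental_theorem_of_calculus[OF assms(3)])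
    fix x assume "x \<in> {a..b}"
    then show "(y has_vector_derivative dif l y x) (at x within {a..b})"
      using assms by (intro has_vector_derivative_within_subset[OF regular_has_derivative]) auto
  qed
  then show "integral {a..b} (dif l y) = y b - y a" by (rule integral_unique)
  obtain N where N: "negligible N"
    "\<And>x. x > l \<Longrightarrow> x \<notin> N \<Longrightarrow> (dif l y has_vector_derivative dif l (dif l y) x) (at x)"
    using regular_second_derivative[OF assms(1)] by blast
  have ac: "absolutely_continuous_on l b (dif l y)" and lb: "l \<le> b"
    using assms by (auto simp: regular_def locally_absolutely_continuous_def)
  show "dif l (dif l y) absolutely_integrable_on {l..b}"
    by (rule ac_FTC(1)[OF ac lb N(1)]) (use N in auto)
  show "integral {l..b} (dif l (dif l y)) = dif l y b - dif l y l"
    using ac_FTC(2)[OF ac lb N(1), of "dif l (dif l y)" b] N lb by auto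
qed

lemma regular_lincomb:
  fixes a b :: complex
  assumes "regular l y" "regular l w"
  shows "regular l (\<lambda>x. a * y x + b * w x)"
    "\<And>x. x \<ge> l \<Longrightarrow> dif l (\<lambda>x. a * y x + b * w x) x = a * dif l y x + b * dif l w x"
    "AE x in lebesgue. x > l \<longrightarrow> dif l (dif l (\<lambda>x. a * y x + b * w x)) x = a * dif l (dif l y) x + b * dif l (dif l w) x"
proof -
  let ?f = "\<lambda>x. a * y x + b * w x"
  have zero: "\<And>x. x < l \<Longrightarrow> ?f x = 0" using assms by (simp add: regular_def)
  have der: "(?f has_vector_derivative a * dif l y x + b * dif l w x) (at x within {l..})" if "x \<ge> l" for x
    using regular_has_derivative[OF assms(1) that] regular_has_derivative[OF assms(2) that]
    by (auto intro!: derivative_eq_intros)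
  have ac: "locally_absolutely_continuous l (\<lambda>x. a * dif l y x + b * dif l w x)"
    using assms unfolding regular_def locally_absolutely_continuous_def
    by (auto intro!: ac_add ac_mult ac_const)
  show "regular l ?f" and d: "\<And>x. x \<ge> l \<Longrightarrow> dif l ?f x = a * dif l y x + b * dif l w x"
    using regularI[OF zero der ac] by auto
  obtain N where N: "negligible N"
    "\<And>x. x > l \<Longrightarrow> x \<notin> N \<Longrightarrow> (dif l y has_vector_derivative dif l (dif l y) x) (at x)"
    using regular_second_derivative[OF assms(1)] by blast
  obtain M where M: "negligible M"
    "\<And>x. x > l \<Longrightarrow> x \<notin> M \<Longrightarrow> (dif l w has_vector_derivative dif l (dif l w) x) (at x)"
    using regular_second_derivative[OF assms(2)] by blast
  have "dif l (dif l ?f) x = a * dif l (dif l y) x + b * dif l (dif l w) x" if x: "x > l" "x \<notin> N \<union> M" for x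
  proof (rule dif_eqI_interior[OF _ x(1)])
    have "((\<lambda>x. a * dif l y x + b * dif l w x) has_vector_derivative a * dif l (dif l y) x + b * dif l (dif l w) x) (at x)"
      using N(2) M(2) x by (auto intro!: derivative_eq_intros)
    then show "(dif l ?f has_vector_derivative a * dif l (dif l y) x + b * dif l (dif l w) x) (at x)"
      by (rule has_vector_derivative_transform_within_open[of _ _ _ "{l<..}"]) (use x d in auto)
  qed
  then show "AE x in lebesgue. x > l \<longrightarrow> dif l (dif l ?f) x = a * dif l (dif l y) x + b * dif l (dif l w) x"
    using negligible_Un[OF N(1) M(1)] unfolding eventually_ae_filter_negligible by blast
qed

section \<open>Picard iteration with an integrable coefficient\<close>

lemma abs_int_mult_continuous:
  fixes Q f :: "real \<Rightarrow> complex"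
  assumes "Q absolutely_integrable_on {a..b}" "continuous_on {a..b} f"
  shows "(\<lambda>t. Q t * f t) absolutely_integrable_on {a..b}"
proof -
  have "(\<lambda>t. f t * Q t) absolutely_integrable_on {a..b}"
  proof (rule absolutely_integrable_bounded_measurable_product[where h="(*)" and f=f, OF _ _ _ _ assms(1)])
    show "bilinear ((*) :: complex \<Rightarrow> _)" by (simp add: bilinear_conv_bounded_bilinear bounded_bilinear_mult)
    show "f \<in> borel_measurable (lebesgue_on {a..b})"
      using assms(2) by (intro continuous_imp_measurable_on_sets_lebesgue) auto
    show "bounded (f ` {a..b})" using assms(2) by (auto intro!: compact_imp_bounded compact_continuous_image)
  qed auto
  then show ?thesis by (simp add: mult.commute)
qed

text \<open>The chain rule for powers of an indefinite integral. It is the source of the factorials that make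
the Picard iteration converge although \<open>Q\<close> is only integrable.\<close>

lemma integral_power_of_indefinite_integral:
  fixes m :: "real \<Rightarrow> real"
  assumes m: "m absolutely_integrable_on {a..b}" and ab: "a \<le> b"
  defines "M \<equiv> \<lambda>x. integral {a..x} m"
  shows "(\<lambda>t. m t * M t ^ n) absolutely_integrable_on {a..b}"
    and "\<And>x. x \<in> {a..b} \<Longrightarrow> integral {a..x} (\<lambda>t. m t * M t ^ n) = M x ^ Suc n / Suc n"
proof -
  define f where "f k x = complex_of_real (M x) ^ k" for k x
  have mc: "(\<lambda>t. complex_of_real (m t)) absolutely_integrable_on {a..b}"
    using absolutely_integrable_linear[OF m bounded_linear_of_real[where 'a=complex]] by (simp add: o_def)
  have ofr: "integral {a..x} (\<lambda>t. complex_of_real (h t)) = of_real (integral {a..x} h)"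
    if "h absolutely_integrable_on {a..b}" "x \<in> {a..b}" for h x
  proof -
    have "h integrable_on {a..x}"
      using absolutely_integrable_on_subinterval[OF that(1), of a x] that set_lebesgue_integral_eq_integral(1) by auto
    from integral_linear[OF this bounded_linear_of_real[where 'a=complex]] show ?thesis by (simp add: o_def)
  qed
  have acM: "absolutely_continuous_on a b (\<lambda>x. complex_of_real (M x))"
    by (rule ac_cong[OF ac_indefinite_integral[OF mc]]) (auto simp: M_def ofr[OF m])
  have acf: "absolutely_continuous_on a b (f k)" for k
  proof (induction k)
    case 0 then show ?case by (simp add: f_def ac_const)
  next
    case (Suc k) then show ?case using ac_mult[OF acM Suc.IH] by (simp add: f_def)
  qed
  obtain N where N: "negligible N" "\<And>x. x \<in> {a<..<b} - N \<Longrightarrow> (M has_real_derivative m x) (at x)"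
    using indefinite_integral_has_derivative_ae_real[OF m] unfolding M_def by blast
  define p where "p x = complex_of_real (real (Suc n) * (m x * M x ^ n))" for x
  have D: "(f (Suc n) has_vector_derivative p x) (at x)" if "x \<in> {a<..<b} - N" for x
  proof -
    have "((\<lambda>x. M x ^ Suc n) has_real_derivative real (Suc n) * (m x * M x ^ n)) (at x)"
      by (rule DERIV_cong[OF DERIV_power[OF N(2)[OF that], of "Suc n"]]) (simp add: algebra_simps)
    then have "((\<lambda>x. complex_of_real (M x ^ Suc n)) has_vector_derivative p x) (at x)"
      unfolding p_def by (rule has_vector_derivative_of_real)
    then show ?thesis by (simp add: f_def[abs_def])
  qed
  have p: "p absolutely_integrable_on {a..b}" "\<And>x. x \<in> {a..b} \<Longrightarrow> f (Suc n) x - f (Suc n) a = integral {a..x} p"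
    using ac_FTC[OF acf ab N(1) D] by auto
  have "(\<lambda>x. real (Suc n) * (m x * M x ^ n)) absolutely_integrable_on {a..b}"
    using absolutely_integrable_linear[OF p(1) bounded_linear_Re] by (simp add: o_def p_def)
  then have "(\<lambda>x. (1 / real (Suc n)) * (real (Suc n) * (m x * M x ^ n))) absolutely_integrable_on {a..b}"
    by (rule set_integrable_mult_right[rotated]) 
  then show ai: "(\<lambda>t. m t * M t ^ n) absolutely_integrable_on {a..b}" by simp
  fix x assume x: "x \<in> {a..b}"
  have "of_real (M x ^ Suc n) = integral {a..x} p"
    using p(2)[OF x] by (simp add: f_def M_def)
  also have "\<dots> = of_real (integral {a..x} (\<lambda>x. real (Suc n) * (m x * M x ^ n)))"
    unfolding p_def using ai x by (intro ofr set_integrable_mult_right) auto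
  finally have "M x ^ Suc n = real (Suc n) * integral {a..x} (\<lambda>x. m x * M x ^ n)"
    unfolding of_real_eq_iff by simp
  then show "integral {a..x} (\<lambda>t. m t * M t ^ n) = M x ^ Suc n / Suc n" by (simp add: field_simps)
qed

text \<open>The equation \<open>y'' = Q y\<close> with given initial values is equivalent to a fixed point equation for the
double integral of \<open>Q y\<close>. With \<open>Q\<close> merely integrable on bounded intervals, the iterates of this
operator are dominated by powers of the function \<open>majorant\<close>, divided by factorials.\<close>

locale volterra =
  fixes l :: real and Q :: "real \<Rightarrow> complex"
  assumes Q: "\<And>b. Q absolutely_integrable_on {l..b}"
begin

definition double_integral :: "(real \<Rightarrow> complex) \<Rightarrow> real \<Rightarrow> complex" where
  "double_integral f x = integral {l..x} (\<lambda>s. integral {l..s} (\<lambda>t. Q t * f t))"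

lemma Qf_integrable:
  assumes "continuous_on {l..} f"
  shows "(\<lambda>t. Q t * f t) absolutely_integrable_on {l..b}" "(\<lambda>t. Q t * f t) integrable_on {l..b}"
proof -
  show "(\<lambda>t. Q t * f t) absolutely_integrable_on {l..b}"
    by (rule abs_int_mult_continuous[OF Q continuous_on_subset[OF assms]]) auto
  then show "(\<lambda>t. Q t * f t) integrable_on {l..b}" by (rule set_lebesgue_integral_eq_integral(1))
qed

lemma inner_continuous:
  assumes "continuous_on {l..} f"
  shows "continuous_on {l..} (\<lambda>s. integral {l..s} (\<lambda>t. Q t * f t))"
  by (rule continuous_on_half_lineI) (rule indefinite_integral_continuous_1[OF Qf_integrable(2)[OF assms]])

lemma double_integral_continuous:
  assumes "continuous_on {l..} f"
  shows "continuous_on {l..} (double_integral f)"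
  unfolding double_integral_def
proof (rule continuous_on_half_lineI)
  fix b
  have "continuous_on {l..b} (\<lambda>s. integral {l..s} (\<lambda>t. Q t * f t))"
    by (rule continuous_on_subset[OF inner_continuous[OF assms]]) auto
  then show "continuous_on {l..b} (\<lambda>x. integral {l..x} (\<lambda>s. integral {l..s} (\<lambda>t. Q t * f t)))"
    by (rule indefinite_integral_continuous_1[OF integrable_continuous_real])
qed

lemma double_integral_diff:
  assumes "continuous_on {l..} f" "continuous_on {l..} g"
  shows "double_integral f x - double_integral g x = double_integral (\<lambda>t. f t - g t) x"
proof -
  have i: "(\<lambda>s. integral {l..s} (\<lambda>t. Q t * f t)) integrable_on {l..x}" "(\<lambda>s. integral {l..s} (\<lambda>t. Q t * g t)) integrable_on {l..x}"
    by (intro integrable_continuous_real continuous_on_subset[OF inner_continuous] assms; auto)+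
  have "double_integral f x - double_integral g x = integral {l..x} (\<lambda>s. integral {l..s} (\<lambda>t. Q t * f t) - integral {l..s} (\<lambda>t. Q t * g t))"
    unfolding double_integral_def using i by (simp add: integral_diff)
  also have "\<dots> = double_integral (\<lambda>t. f t - g t) x"
    unfolding double_integral_def using Qf_integrable[OF assms(1)] Qf_integrable[OF assms(2)]
    by (intro integral_cong) (simp add: integral_diff right_diff_distrib)
  finally show ?thesis .
qed

definition majorant :: "real \<Rightarrow> real \<Rightarrow> real" where
  "majorant b x = integral {l..x} (\<lambda>t. (b - l) * cmod (Q t))"

lemma majorant_integrand: "(\<lambda>t. (b - l) * cmod (Q t)) absolutely_integrable_on {l..c}"
  using absolutely_integrable_norm[OF Q] by (intro set_integrable_mult_right) (simp add: o_def)

lemma majorant_mono: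
  assumes "l \<le> b" "l \<le> x" "x \<le> y"
  shows "majorant b x \<le> majorant b y" "0 \<le> majorant b x"
proof -
  show "majorant b x \<le> majorant b y" unfolding majorant_def
    using assms by (intro integral_subset_le) (auto intro!: set_lebesgue_integral_eq_integral(1) majorant_integrand)
  show "0 \<le> majorant b x" unfolding majorant_def
    using assms by (intro integral_nonneg) (auto intro!: set_lebesgue_integral_eq_integral(1) majorant_integrand)
qed

text \<open>The inner integral gains a power of the majorant and the factor \<open>1 / (n + 1)\<close>. The outer one costs at
most the length of the interval, which has been included in the majorant.\<close>

lemma double_integral_step:
  assumes f: "continuous_on {l..} f" and b: "l < b" and A: "A \<ge> 0"
    and le: "\<And>t. t \<in> {l..b} \<Longrightarrow> cmod (f t) \<le> A * majorant b t ^ n" and x: "x \<in> {l..b}"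
  shows "cmod (double_integral f x) \<le> A / Suc n * majorant b x ^ Suc n"
proof -
  have inner: "cmod (integral {l..s} (\<lambda>t. Q t * f t)) \<le> A / Suc n * majorant b s ^ Suc n / (b - l)" if s: "s \<in> {l..b}" for s
  proof -
    have pw: "(\<lambda>t. ((b - l) * cmod (Q t)) * majorant b t ^ n) absolutely_integrable_on {l..b}"
      "integral {l..s} (\<lambda>t. ((b - l) * cmod (Q t)) * majorant b t ^ n) = majorant b s ^ Suc n / Suc n"
      using integral_power_of_indefinite_integral(1)[OF majorant_integrand[of b b] less_imp_le[OF b], where n=n]
        integral_power_of_indefinite_integral(2)[OF majorant_integrand[of b b] less_imp_le[OF b] s, where n=n]
      unfolding majorant_def by blast+
    have pws: "(\<lambda>t. ((b - l) * cmod (Q t)) * majorant b t ^ n) integrable_on {l..s}"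
      using absolutely_integrable_on_subinterval[OF pw(1), of l s] s set_lebesgue_integral_eq_integral(1) by auto
    have "cmod (integral {l..s} (\<lambda>t. Q t * f t)) \<le> integral {l..s} (\<lambda>t. (A / (b - l)) * (((b - l) * cmod (Q t)) * majorant b t ^ n))"
    proof (rule integral_norm_bound_integral[OF Qf_integrable(2)[OF f]])
      show "(\<lambda>t. (A / (b - l)) * (((b - l) * cmod (Q t)) * majorant b t ^ n)) integrable_on {l..s}"
        using pws by (rule integrable_on_mult_right)
      fix t assume "t \<in> {l..s}"
      then have "cmod (Q t) * cmod (f t) \<le> cmod (Q t) * (A * majorant b t ^ n)" using le[of t] s by (intro mult_left_mono) auto
      then show "cmod (Q t * f t) \<le> (A / (b - l)) * (((b - l) * cmod (Q t)) * majorant b t ^ n)"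
      proof -
        have "(A / (b - l)) * (((b - l) * cmod (Q t)) * majorant b t ^ n) = cmod (Q t) * (A * majorant b t ^ n)" using b by simp
        then show ?thesis using \<open>cmod (Q t) * cmod (f t) \<le> _\<close> by (simp add: norm_mult)
      qed
    qed
    also have "\<dots> = (A / (b - l)) * (majorant b s ^ Suc n / Suc n)" by (simp only: integral_mult_right pw(2))
    finally show ?thesis by (simp add: ac_simps)
  qed
  have "cmod (double_integral f x) \<le> integral {l..x} (\<lambda>s. A / Suc n * majorant b x ^ Suc n / (b - l))"
    unfolding double_integral_def
  proof (rule integral_norm_bound_integral)
    show "(\<lambda>s. integral {l..s} (\<lambda>t. Q t * f t)) integrable_on {l..x}"
      by (intro integrable_continuous_real continuous_on_subset[OF inner_continuous[OF f]]) auto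
    fix s assume s: "s \<in> {l..x}"
    have "A / Suc n * majorant b s ^ Suc n / (b - l) \<le> A / Suc n * majorant b x ^ Suc n / (b - l)"
      using majorant_mono[of b s x] s b A x by (intro divide_right_mono mult_left_mono power_mono) auto
    then show "cmod (integral {l..s} (\<lambda>t. Q t * f t)) \<le> A / Suc n * majorant b x ^ Suc n / (b - l)"
      using inner[of s] s x by auto
  qed auto
  also have "\<dots> = ((x - l) / (b - l)) * (A / Suc n * majorant b x ^ Suc n)" using x by (simp add: ac_simps)
  also have "\<dots> \<le> 1 * (A / Suc n * majorant b x ^ Suc n)"
    using x b A majorant_mono[of b x b] by (intro mult_right_mono) (auto simp: field_simps)
  finally show ?thesis by simp
qed

lemma fixed_point_zero:
  assumes f: "continuous_on {l..} f" and eq: "\<And>x. x \<ge> l \<Longrightarrow> f x = double_integral f x" and x: "x \<ge> l"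
  shows "f x = 0"
proof -
  define b where "b = x + 1"
  have b: "l < b" "x \<in> {l..b}" using x by (auto simp: b_def)
  have "continuous_on {l..b} f" using f by (rule continuous_on_subset) auto
  then have "bounded (f ` {l..b})" by (auto intro!: compact_imp_bounded compact_continuous_image)
  then obtain C where C: "C > 0" "\<And>x. x \<in> {l..b} \<Longrightarrow> cmod (f x) \<le> C" unfolding bounded_pos by blast
  have bd: "\<forall>t\<in>{l..b}. cmod (f t) \<le> C / fact n * majorant b t ^ n" for n
  proof (induction n)
    case 0 then show ?case using C by simp
  next
    case (Suc n)
    show ?case
    proof
      fix t assume t: "t \<in> {l..b}"
      have "cmod (double_integral f t) \<le> C / fact n / Suc n * majorant b t ^ Suc n"
        using Suc C b t by (intro double_integral_step f) auto
      then show "cmod (f t) \<le> C / fact (Suc n) * majorant b t ^ Suc n" using eq[of t] t by (simp add: field_simps)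
    qed
  qed
  have "(\<lambda>n. C * (inverse (fact n) * majorant b x ^ n)) \<longlonglongrightarrow> C * 0"
    using summable_exp[of "majorant b x"] by (intro tendsto_mult tendsto_const summable_LIMSEQ_zero) auto
  moreover have "\<forall>n. cmod (f x) \<le> C * (inverse (fact n) * majorant b x ^ n)"
    using bd b by (simp add: field_simps)
  ultimately have "cmod (f x) \<le> C * 0" by (intro LIMSEQ_le_const) auto
  then show ?thesis by simp
qed

text \<open>Picard iteration. The successive differences are bounded by the terms of an exponential series, so
the iterates converge and are dominated by a constant on every bounded interval; dominated
convergence carries the fixed point equation to the limit.\<close>

lemma solution_exists:
  assumes c: "continuous_on {l..} c"
  obtains u where "continuous_on {l..} u" "\<And>x. x \<ge> l \<Longrightarrow> u x = c x + double_integral u x"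
proof -
  define S where "S = rec_nat c (\<lambda>_ f x. c x + double_integral f x)"
  have S0: "S 0 = c" and SS: "S (Suc n) = (\<lambda>x. c x + double_integral (S n) x)" for n by (simp_all add: S_def)
  have Sc: "continuous_on {l..} (S n)" for n
    by (induction n) (auto simp: S0 SS intro!: continuous_intros c double_integral_continuous)
  have main: "\<exists>B. \<forall>t\<in>{l..b}. (\<forall>n. cmod (S n t) \<le> B) \<and> convergent (\<lambda>n. S n t)" if b: "l < b" for b
  proof -
    have "continuous_on {l..b} (double_integral c)" "continuous_on {l..b} c"
      using c double_integral_continuous[OF c] by (auto elim: continuous_on_subset)
    then have "bounded (double_integral c ` {l..b})" "bounded (c ` {l..b})" by (auto intro!: compact_imp_bounded compact_continuous_image)
    then obtain C C' where C: "C > 0" "\<forall>x\<in>double_integral c ` {l..b}. cmod x \<le> C" and C': "C' > 0" "\<forall>x\<in>c ` {l..b}. cmod x \<le> C'"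
      unfolding bounded_pos by blast
    have bd: "\<forall>t\<in>{l..b}. cmod (S (Suc n) t - S n t) \<le> C / fact n * majorant b t ^ n" for n
    proof (induction n)
      case 0 then show ?case using C by (simp add: S0 SS)
    next
      case (Suc n)
      show ?case
      proof
        fix t assume t: "t \<in> {l..b}"
        have "S (Suc (Suc n)) t - S (Suc n) t = double_integral (\<lambda>t. S (Suc n) t - S n t) t"
          using double_integral_diff[OF Sc Sc, of "Suc n" t n] by (simp only: SS[of "Suc n"] SS[of n]) simp
        moreover have "cmod (double_integral (\<lambda>t. S (Suc n) t - S n t) t) \<le> C / fact n / Suc n * majorant b t ^ Suc n"
          using Suc C b t by (intro double_integral_step continuous_intros Sc) auto
        ultimately show "cmod (S (Suc (Suc n)) t - S (Suc n) t) \<le> C / fact (Suc n) * majorant b t ^ Suc n"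
          by (simp add: field_simps)
      qed
    qed
    define e where "e n = C * (inverse (fact n) * majorant b b ^ n)" for n
    have es: "summable e" unfolding e_def using summable_exp[of "majorant b b"] by (intro summable_mult)
    have e0: "0 \<le> e n" for n unfolding e_def using C majorant_mono[of b b b] b by simp
    have le: "cmod (S (Suc n) t - S n t) \<le> e n" if t: "t \<in> {l..b}" for n t
    proof -
      have "C / fact n * majorant b t ^ n \<le> C / fact n * majorant b b ^ n"
        using majorant_mono[of b t b] C b t by (intro mult_left_mono power_mono) auto
      moreover have "cmod (S (Suc n) t - S n t) \<le> C / fact n * majorant b t ^ n" using bd[of n] t by blast
      moreover have "C / fact n * majorant b b ^ n = e n" by (simp add: e_def field_simps)
      ultimately show ?thesis by linarith
    qed
    have "cmod (S n t) \<le> C' + suminf e \<and> convergent (\<lambda>n. S n t)" if t: "t \<in> {l..b}" for n t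
    proof -
      have sm: "summable (\<lambda>n. S (Suc n) t - S n t)"
        by (rule summable_comparison_test'[OF es]) (use le t in auto)
      have tel: "S n t = c t + (\<Sum>k<n. S (Suc k) t - S k t)" for n
        using sum_lessThan_telescope[of "\<lambda>k. S k t" n] by (simp add: S0)
      have "cmod (S n t) \<le> cmod (c t) + (\<Sum>k<n. cmod (S (Suc k) t - S k t))"
        unfolding tel[of n] by (rule norm_triangle_le) (simp add: norm_sum)
      also have "\<dots> \<le> C' + (\<Sum>k<n. e k)" using C' t le by (intro add_mono sum_mono) auto
      also have "\<dots> \<le> C' + suminf e" using es e0 by (simp add: sum_le_suminf)
      finally have 1: "cmod (S n t) \<le> C' + suminf e" .
      have "(\<lambda>n. c t + (\<Sum>k<n. S (Suc k) t - S k t)) \<longlonglongrightarrow> c t + (\<Sum>k. S (Suc k) t - S k t)"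
        using sm by (intro tendsto_intros summable_LIMSEQ)
      then have "convergent (\<lambda>n. S n t)" unfolding tel[symmetric] convergent_def by blast
      then show ?thesis using 1 by simp
    qed
    then show ?thesis by blast
  qed
  define u where "u x = lim (\<lambda>n. S n x)" for x
  have lim: "(\<lambda>n. S n x) \<longlonglongrightarrow> u x" if "x \<ge> l" for x
    unfolding u_def using main[of "x+1"] that by (auto simp: convergent_LIMSEQ_iff)
  have eq: "u x = c x + double_integral u x" and uint: "(\<lambda>t. Q t * u t) absolutely_integrable_on {l..x}" if x: "x \<ge> l" for x
  proof -
    define b where "b = x + 1"
    have b: "l < b" "x \<in> {l..b}" using x by (auto simp: b_def)
    obtain B where B: "\<And>t n. t \<in> {l..b} \<Longrightarrow> cmod (S n t) \<le> B" using main[OF b(1)] by blast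
    have B0: "B \<ge> 0" using B[of x 0] b norm_ge_zero order_trans by blast
    have Qn: "(\<lambda>t. B * cmod (Q t)) integrable_on {l..s}" for s
      using absolutely_integrable_norm[OF Q[of s]]
      by (intro integrable_on_mult_right set_lebesgue_integral_eq_integral(1)) (simp add: o_def)
    have dom: "cmod (Q t * S n t) \<le> B * cmod (Q t)" if "t \<in> {l..b}" for t n
      using mult_left_mono[OF B[OF that, of n], of "cmod (Q t)"] by (simp add: norm_mult mult.commute)
    have conv: "(\<lambda>n. Q t * S n t) \<longlonglongrightarrow> Q t * u t" if "t \<in> {l..b}" for t
      using that by (intro tendsto_intros lim) auto
    have dc: "(\<lambda>t. Q t * u t) integrable_on {l..s}"
      "(\<lambda>n. integral {l..s} (\<lambda>t. Q t * S n t)) \<longlonglongrightarrow> integral {l..s} (\<lambda>t. Q t * u t)" if "s \<in> {l..b}" for s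
      using dominated_convergence[where g="\<lambda>t. Q t * u t" and S="{l..s}" and f="\<lambda>n t. Q t * S n t", OF Qf_integrable(2)[OF Sc] Qn] dom conv that by auto
    have udom: "cmod (Q t * u t) \<le> B * cmod (Q t)" if "t \<in> {l..b}" for t
      using tendsto_norm[OF conv[OF that]] dom[OF that] by (intro LIMSEQ_le_const2) auto
    show "(\<lambda>t. Q t * u t) absolutely_integrable_on {l..x}"
      by (rule absolutely_integrable_integrable_bound[OF _ dc(1) Qn]) (use udom b in auto)
    have "(\<lambda>n. double_integral (S n) x) \<longlonglongrightarrow> double_integral u x"
      unfolding double_integral_def
    proof (rule dominated_convergence(2))
      show "(\<lambda>s. integral {l..s} (\<lambda>t. Q t * S n t)) integrable_on {l..x}" for n
        by (intro integrable_continuous_real continuous_on_subset[OF inner_continuous[OF Sc]]) auto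
      show "(\<lambda>s. integral {l..b} (\<lambda>t. B * cmod (Q t))) integrable_on {l..x}" by (rule integrable_const_ivl)
      fix s n assume s: "s \<in> {l..x}"
      have "cmod (integral {l..s} (\<lambda>t. Q t * S n t)) \<le> integral {l..s} (\<lambda>t. B * cmod (Q t))"
        using s b dom by (intro integral_norm_bound_integral Qf_integrable Sc Qn) auto
      also have "\<dots> \<le> integral {l..b} (\<lambda>t. B * cmod (Q t))"
        using s b B0 by (intro integral_subset_le Qn) auto
      finally show "norm (integral {l..s} (\<lambda>t. Q t * S n t)) \<le> integral {l..b} (\<lambda>t. B * cmod (Q t))" .
    qed (use dc(2) b in auto)
    then have "(\<lambda>n. c x + double_integral (S n) x) \<longlonglongrightarrow> c x + double_integral u x" by (intro tendsto_intros)
    moreover have "(\<lambda>n. S (Suc n) x) \<longlonglongrightarrow> u x" using lim[OF x] by (rule LIMSEQ_Suc)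
    ultimately show "u x = c x + double_integral u x" unfolding SS by (intro LIMSEQ_unique)
  qed
  have inner: "continuous_on {l..} (\<lambda>s. integral {l..s} (\<lambda>t. Q t * u t))"
    by (rule continuous_on_half_lineI) (intro indefinite_integral_continuous_1 set_lebesgue_integral_eq_integral(1) uint)
  have "continuous_on {l..} (double_integral u)"
    unfolding double_integral_def
  proof (rule continuous_on_half_lineI)
    fix b
    have "continuous_on {l..b} (\<lambda>s. integral {l..s} (\<lambda>t. Q t * u t))"
      by (rule continuous_on_subset[OF inner]) auto
    then show "continuous_on {l..b} (\<lambda>x. integral {l..x} (\<lambda>s. integral {l..s} (\<lambda>t. Q t * u t)))"
      by (rule indefinite_integral_continuous_1[OF integrable_continuous_real])
  qed
  then have "continuous_on {l..} (\<lambda>x. c x + double_integral u x)" using c by (intro continuous_intros)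
  then have "continuous_on {l..} u" using eq by (subst continuous_on_cong[OF refl, of _ _ "\<lambda>x. c x + double_integral u x"]) auto
  then show ?thesis using that eq by blast
qed

end

section \<open>The initial value problem\<close>

text \<open>At the end point the second derivative is one-sided; a single point does not matter, and away from
it the ordinary derivative can be used.\<close>

lemma AE_half_line_open_iff:
  "(AE x in lebesgue. x \<ge> l \<longrightarrow> P x) \<longleftrightarrow> (AE x in lebesgue. x > (l::real) \<longrightarrow> P x)"
proof
  assume "AE x in lebesgue. x > l \<longrightarrow> P x"
  moreover have "AE x in lebesgue. x \<noteq> l" 
    unfolding eventually_ae_filter_negligible by (intro exI[of _ "{l}"]) auto
  ultimately show "AE x in lebesgue. x \<ge> l \<longrightarrow> P x" by eventually_elim auto
qed (auto elim: eventually_mono)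

lemma integral_cong_AE_half_line:
  fixes f g :: "real \<Rightarrow> 'a::banach"
  assumes "AE x in lebesgue. x > l \<longrightarrow> f x = g x"
  shows "integral {l..b} f = integral {l..b} g"
proof -
  obtain N where N: "negligible N" "{x. \<not> (x > l \<longrightarrow> f x = g x)} \<subseteq> N"
    using assms unfolding eventually_ae_filter_negligible by blast
  have "f x = g x" if "x > l" "x \<notin> N" for x using N(2) that by blast
  then show ?thesis
    by (intro integral_spike[of "N \<union> {l}"]) (use N(1) in \<open>auto simp: less_le intro: negligible_Un\<close>)
qed

lemma ode_solution_iff:
  "ode_solution l q z y \<longleftrightarrow> regular l y \<and>
     (AE x in lebesgue. x > l \<longrightarrow> dif l (dif l y) x = (of_real (q x) - z) * y x)"
proof -
  have "- p + w = v \<longleftrightarrow> p = w - v" for p w v :: complex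
    by (auto simp: algebra_simps)
  then show ?thesis
    unfolding ode_solution_def AE_half_line_open_iff diff_expr_def by (simp add: left_diff_distrib)
qed

lemma ode_solution_lincomb:
  assumes "ode_solution l q z y" "ode_solution l q z w"
  shows "ode_solution l q z (\<lambda>x. a * y x + b * w x)"
proof -
  have r: "regular l y" "regular l w" using assms by (auto simp: ode_solution_def)
  have "AE x in lebesgue. x > l \<longrightarrow> dif l (dif l y) x = (of_real (q x) - z) * y x"
    "AE x in lebesgue. x > l \<longrightarrow> dif l (dif l w) x = (of_real (q x) - z) * w x"
    using assms by (auto simp: ode_solution_iff)
  with regular_lincomb(3)[OF r, of a b]
  have "AE x in lebesgue. x > l \<longrightarrow> dif l (dif l (\<lambda>x. a * y x + b * w x)) x = (of_real (q x) - z) * (a * y x + b * w x)"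
    by eventually_elim (auto simp: algebra_simps)
  then show ?thesis using regular_lincomb(1)[OF r] by (simp add: ode_solution_iff)
qed

locale half_line =
  fixes l :: real and q :: "real \<Rightarrow> real"
  assumes q: "locally_summable l q"
begin

lemma coefficient_integrable: "(\<lambda>t. complex_of_real (q t) - z) absolutely_integrable_on {l..b}"
proof (cases "l \<le> b")
  case True
  then have "q absolutely_integrable_on {l..b}" using q by (simp add: locally_summable_def)
  then have "(\<lambda>t. complex_of_real (q t)) absolutely_integrable_on {l..b}"
    using absolutely_integrable_linear[OF _ bounded_linear_of_real[where 'a=complex]] by (auto simp: o_def)
  then show ?thesis by (intro set_integral_diff) auto
qed (simp add: set_integrable_def)

lemma ode_solution_integral:
  assumes y: "ode_solution l q z y" and x: "x \<ge> l"
  shows "dif l y x = dif l y l + integral {l..x} (\<lambda>t. (of_real (q t) - z) * y t)"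
    and "y x = y l + dif l y l * of_real (x - l) + volterra.double_integral l (\<lambda>t. of_real (q t) - z) y x"
proof -
  have r: "regular l y" and ae: "AE x in lebesgue. x > l \<longrightarrow> dif l (dif l y) x = (of_real (q x) - z) * y x"
    using y by (auto simp: ode_solution_iff)
  have d: "dif l y x = dif l y l + integral {l..x} (\<lambda>t. (of_real (q t) - z) * y t)" if "x \<ge> l" for x
    using regular_FTC(3)[OF r order_refl that] integral_cong_AE_half_line[OF ae, of x] by simp
  interpret volterra l "\<lambda>t. of_real (q t) - z" by unfold_locales (rule coefficient_integrable)
  have i: "(\<lambda>s. integral {l..s} (\<lambda>t. (of_real (q t) - z) * y t)) integrable_on {l..x}"
    by (intro integrable_continuous_real continuous_on_subset[OF inner_continuous[OF regular_continuous(1)[OF r]]]) auto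
  have "y x - y l = integral {l..x} (dif l y)" using regular_FTC(1)[OF r order_refl x] by simp
  also have "\<dots> = integral {l..x} (\<lambda>s. dif l y l + integral {l..s} (\<lambda>t. (of_real (q t) - z) * y t))"
    by (intro integral_cong d) auto
  also have "\<dots> = integral {l..x} (\<lambda>s. dif l y l) + double_integral y x"
    unfolding double_integral_def by (rule integral_add[OF integrable_const_ivl i])
  also have "integral {l..x} (\<lambda>s. dif l y l) = dif l y l * of_real (x - l)"
    using x by (simp add: scaleR_conv_of_real mult.commute)
  finally show "y x = y l + dif l y l * of_real (x - l) + double_integral y x" by (simp add: algebra_simps)
  show "dif l y x = dif l y l + integral {l..x} (\<lambda>t. (of_real (q t) - z) * y t)" by (rule d[OF x])
qed

lemma ode_solution_unique:
  assumes y: "ode_solution l q z y" and w: "ode_solution l q z w"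
    and eq: "y l = w l" "dif l y l = dif l w l"
  shows "y = w"
proof
  fix x
  interpret volterra l "\<lambda>t. of_real (q t) - z" by unfold_locales (rule coefficient_integrable)
  have r: "regular l y" "regular l w" using y w by (auto simp: ode_solution_def)
  have c: "continuous_on {l..} y" "continuous_on {l..} w" using regular_continuous r by auto
  show "y x = w x"
  proof (cases "x < l")
    case False
    have "y x - w x = 0"
    proof (rule fixed_point_zero)
      show "continuous_on {l..} (\<lambda>x. y x - w x)" using c by (intro continuous_intros)
      show "y x - w x = double_integral (\<lambda>x. y x - w x) x" if "x \<ge> l" for x
        using ode_solution_integral(2)[OF y that] ode_solution_integral(2)[OF w that] eq double_integral_diff[OF c, of x] by simp
    qed (use False in auto)
    then show ?thesis by simp
  qed (use r in \<open>auto simp: regular_def\<close>)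
qed

text \<open>The fixed point of the Volterra equation is a solution: its first derivative is an indefinite
integral, which by Lebesgue's theorem has the integrand as its derivative almost everywhere.\<close>

lemma ode_solution_exists:
  obtains y where "ode_solution l q z y" "y l = a" "dif l y l = b"
proof -
  define Q where "Q t = complex_of_real (q t) - z" for t
  interpret volterra l Q by unfold_locales (simp add: Q_def[abs_def] coefficient_integrable)
  have "continuous_on {l..} (\<lambda>x. a + b * of_real (x - l))" by (intro continuous_intros)
  then obtain u where u: "continuous_on {l..} u" "\<And>x. x \<ge> l \<Longrightarrow> u x = a + b * of_real (x - l) + double_integral u x"
    using solution_exists by blast
  define u1 where "u1 x = b + integral {l..x} (\<lambda>t. Q t * u t)" for x
  have u1c: "continuous_on {l..} u1" unfolding u1_def using inner_continuous[OF u(1)] by (intro continuous_intros)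
  have ueq: "u x = a + integral {l..x} u1" if x: "x \<ge> l" for x
  proof -
    have "(\<lambda>s. integral {l..s} (\<lambda>t. Q t * u t)) integrable_on {l..x}"
      by (intro integrable_continuous_real continuous_on_subset[OF inner_continuous[OF u(1)]]) auto
    then have "integral {l..x} u1 = integral {l..x} (\<lambda>s. b) + double_integral u x"
      unfolding double_integral_def u1_def by (rule integral_add[OF integrable_const_ivl])
    also have "integral {l..x} (\<lambda>s. b) = b * of_real (x - l)"
      using x by (simp add: scaleR_conv_of_real mult.commute)
    finally have "integral {l..x} u1 = b * of_real (x - l) + double_integral u x" .
    then show ?thesis using u(2)[OF x] by simp
  qed
  define y where "y x = (if x < l then 0 else u x)" for x
  have der: "(y has_vector_derivative u1 x) (at x within {l..})" if x: "x \<ge> l" for x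
  proof -
    have "((\<lambda>x. integral {l..x} u1) has_vector_derivative u1 x) (at x within {l..x+1})"
      by (rule integral_has_vector_derivative[OF continuous_on_subset[OF u1c]]) (use x in auto)
    then have "((\<lambda>x. a + integral {l..x} u1) has_vector_derivative u1 x) (at x within {l..x+1})"
      by (auto intro!: derivative_eq_intros)
    moreover have "at x within {l..x+1} = at x within {l..}"
      by (rule at_within_nhd[of _ "{x-1<..<x+1}"]) auto
    ultimately have "((\<lambda>x. a + integral {l..x} u1) has_vector_derivative u1 x) (at x within {l..})" by simp
    then show ?thesis
      by (rule has_vector_derivative_transform[rotated 2]) (use x ueq in \<open>auto simp: y_def\<close>)
  qed
  have ac: "locally_absolutely_continuous l u1"
    unfolding locally_absolutely_continuous_def u1_def
    by (intro allI impI ac_add ac_const ac_indefinite_integral Qf_integrable(1) u(1))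
  have r: "regular l y" and d: "\<And>x. x \<ge> l \<Longrightarrow> dif l y x = u1 x"
    by (rule regularI[OF _ der ac]; simp add: y_def)+
  have ae: "AE x in lebesgue. x > l \<longrightarrow> dif l (dif l y) x = (of_real (q x) - z) * y x"
  proof -
    have "\<exists>N. negligible N \<and> (\<forall>x\<in>{l<..<l+real n} - N. ((\<lambda>x. integral {l..x} (\<lambda>t. Q t * u t)) has_vector_derivative Q x * u x) (at x))" for n :: nat
      using indefinite_integral_has_derivative_ae[OF Qf_integrable(1)[OF u(1), of "l + real n"]] by metis
    then obtain N where N: "\<And>n. negligible (N n)"
      "\<And>n x. x \<in> {l<..<l+real n} - N n \<Longrightarrow> ((\<lambda>x. integral {l..x} (\<lambda>t. Q t * u t)) has_vector_derivative Q x * u x) (at x)"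
      by metis
    have "dif l (dif l y) x = (of_real (q x) - z) * y x" if x: "x > l" "x \<notin> \<Union>(range N)" for x
    proof (rule dif_eqI_interior[OF _ x(1)])
      obtain n :: nat where "x - l < real n" using reals_Archimedean2 by blast
      then have "((\<lambda>x. integral {l..x} (\<lambda>t. Q t * u t)) has_vector_derivative Q x * u x) (at x)"
        using N(2)[of x n] x by auto
      then have "(u1 has_vector_derivative Q x * u x) (at x)"
        unfolding u1_def by (auto intro!: derivative_eq_intros)
      then have "(dif l y has_vector_derivative Q x * u x) (at x)"
        by (rule has_vector_derivative_transform_within_open[of _ _ _ "{l<..}"]) (use x d in auto)
      then show "(dif l y has_vector_derivative (of_real (q x) - z) * y x) (at x)"
        using x by (simp add: y_def Q_def)
    qed
    moreover have "negligible (\<Union>(range N))" using N by (intro negligible_countable_Union) auto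
    ultimately show ?thesis unfolding eventually_ae_filter_negligible by blast
  qed
  show ?thesis
  proof
    show "ode_solution l q z y" using r ae by (simp add: ode_solution_iff)
    show "y l = a" using ueq[of l] by (simp add: y_def)
    show "dif l y l = b" using d[of l] by (simp add: u1_def)
  qed
qed

end

section \<open>Square integrable functions\<close>

definition sq_integrable :: "real set \<Rightarrow> (real \<Rightarrow> complex) \<Rightarrow> bool" where
  "sq_integrable S f \<longleftrightarrow> set_borel_measurable lebesgue S f \<and> set_integrable lebesgue S (\<lambda>x. (cmod (f x))\<^sup>2)"

definition sq_norm :: "real set \<Rightarrow> (real \<Rightarrow> complex) \<Rightarrow> real" where
  "sq_norm S f = (LINT x:S|lebesgue. (cmod (f x))\<^sup>2)"

lemma L2_iff: "f \<in> L2_half_line l \<longleftrightarrow> sq_integrable {l..} f"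
  by (simp add: L2_half_line_def sq_integrable_def)

lemma sq_norm_nonneg: "sq_norm S f \<ge> 0"
  unfolding sq_norm_def set_lebesgue_integral_def by (rule integral_nonneg_AE) auto

lemma sq_integrable_restrict:
  "sq_integrable S f \<longleftrightarrow> (\<lambda>x. indicator S x *\<^sub>R f x) \<in> borel_measurable lebesgue \<and>
     integrable lebesgue (\<lambda>x. (cmod (indicator S x *\<^sub>R f x))\<^sup>2)"
proof -
  have "(\<lambda>x. (cmod (indicator S x *\<^sub>R f x))\<^sup>2) = (\<lambda>x. indicator S x *\<^sub>R (cmod (f x))\<^sup>2)"
    by (auto simp: indicator_def)
  then show ?thesis by (simp add: sq_integrable_def set_borel_measurable_def set_integrable_def)
qed

text \<open>The Cauchy-Schwarz inequality, from the fact that a quadratic polynomial without sign changes has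
non-positive discriminant.\<close>

lemma integrable_mult_of_square_integrable:
  fixes F G :: "'a \<Rightarrow> complex"
  assumes [measurable]: "F \<in> borel_measurable M" "G \<in> borel_measurable M"
    and F: "integrable M (\<lambda>x. (cmod (F x))\<^sup>2)" and G: "integrable M (\<lambda>x. (cmod (G x))\<^sup>2)"
  shows "integrable M (\<lambda>x. F x * G x)"
    and "cmod (LINT x|M. F x * G x) \<le> sqrt (LINT x|M. (cmod (F x))\<^sup>2) * sqrt (LINT x|M. (cmod (G x))\<^sup>2)"
proof -
  have le: "cmod (F x * G x) \<le> ((cmod (F x))\<^sup>2 + (cmod (G x))\<^sup>2)" for x
  proof -
    have "2 * (cmod (F x) * cmod (G x)) \<le> (cmod (F x))\<^sup>2 + (cmod (G x))\<^sup>2"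
      using sum_squares_bound[of "cmod (F x)" "cmod (G x)"] by (simp add: mult.assoc)
    moreover have "0 \<le> cmod (F x) * cmod (G x)" by simp
    ultimately show ?thesis unfolding norm_mult by linarith
  qed
  show int: "integrable M (\<lambda>x. F x * G x)"
    by (rule Bochner_Integration.integrable_bound[OF Bochner_Integration.integrable_add[OF F G]]) (use le in auto)
  then have int': "integrable M (\<lambda>x. cmod (F x) * cmod (G x))"
    using integrable_norm[OF int] by (simp add: norm_mult)
  define A B C where "A = (LINT x|M. (cmod (F x))\<^sup>2)" and "B = (LINT x|M. cmod (F x) * cmod (G x))"
    and "C = (LINT x|M. (cmod (G x))\<^sup>2)"
  have AC: "A \<ge> 0" "C \<ge> 0" "B \<ge> 0" by (auto simp: A_def B_def C_def)
  have quad: "0 \<le> t\<^sup>2 * A + 2 * t * B + C" for t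
  proof -
    have "0 \<le> (LINT x|M. (t * cmod (F x) + cmod (G x))\<^sup>2)" by simp
    also have "\<dots> = (LINT x|M. t\<^sup>2 * (cmod (F x))\<^sup>2 + (2 * t) * (cmod (F x) * cmod (G x)) + (cmod (G x))\<^sup>2)"
      by (simp add: power2_eq_square algebra_simps)
    also have "\<dots> = t\<^sup>2 * A + 2 * t * B + C"
      unfolding A_def B_def C_def using F G int' by simp
    finally show ?thesis .
  qed
  have "B\<^sup>2 \<le> A * C"
  proof (cases "A = 0")
    case True
    have "B = 0"
    proof (rule ccontr)
      assume "B \<noteq> 0"
      then show False using quad[of "- (C + 1) / (2 * B)"] True by (simp add: field_simps)
    qed
    then show ?thesis using True by simp
  next
    case False
    then have "A > 0" using AC by simp
    then show ?thesis using quad[of "- B / A"] by (simp add: field_simps power2_eq_square)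
  qed
  then have "B \<le> sqrt A * sqrt C" by (metis AC(3) real_sqrt_le_mono real_sqrt_mult real_sqrt_unique)
  moreover have "cmod (LINT x|M. F x * G x) \<le> B"
    unfolding B_def using integral_norm_bound[of M "\<lambda>x. F x * G x"] by (simp add: norm_mult)
  ultimately show "cmod (LINT x|M. F x * G x) \<le> sqrt (LINT x|M. (cmod (F x))\<^sup>2) * sqrt (LINT x|M. (cmod (G x))\<^sup>2)"
    by (simp add: A_def C_def)
qed

lemma sq_integrable_mult:
  assumes "sq_integrable S f" "sq_integrable S g"
  shows "set_integrable lebesgue S (\<lambda>x. f x * g x)"
    and "cmod (LINT x:S|lebesgue. f x * g x) \<le> sqrt (sq_norm S f) * sqrt (sq_norm S g)"
proof -
  have e: "(\<lambda>x. indicator S x *\<^sub>R f x * (indicator S x *\<^sub>R g x)) = (\<lambda>x. indicator S x *\<^sub>R (f x * g x))"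
    "\<And>h. (\<lambda>x. (cmod (indicator S x *\<^sub>R (h x :: complex)))\<^sup>2) = (\<lambda>x. indicator S x *\<^sub>R (cmod (h x))\<^sup>2)"
    by (auto simp: indicator_def)
  show "set_integrable lebesgue S (\<lambda>x. f x * g x)"
    "cmod (LINT x:S|lebesgue. f x * g x) \<le> sqrt (sq_norm S f) * sqrt (sq_norm S g)"
    using integrable_mult_of_square_integrable[of "\<lambda>x. indicator S x *\<^sub>R f x" lebesgue "\<lambda>x. indicator S x *\<^sub>R g x"] assms
    unfolding sq_integrable_restrict e set_integrable_def set_lebesgue_integral_def sq_norm_def by auto
qed

lemma sq_integrable_lincomb:
  assumes "sq_integrable S f" "sq_integrable S g"
  shows "sq_integrable S (\<lambda>x. a * f x + b * g x)"
proof -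
  define F where "F x = indicator S x *\<^sub>R f x" for x
  define G where "G x = indicator S x *\<^sub>R g x" for x
  have F: "F \<in> borel_measurable lebesgue" "integrable lebesgue (\<lambda>x. (cmod (F x))\<^sup>2)"
    and G: "G \<in> borel_measurable lebesgue" "integrable lebesgue (\<lambda>x. (cmod (G x))\<^sup>2)"
    using assms by (auto simp: sq_integrable_restrict F_def[abs_def] G_def[abs_def])
  have e: "indicator S x *\<^sub>R (a * f x + b * g x) = a * F x + b * G x" for x
    by (simp add: F_def G_def scaleR_right_distrib)
  have "integrable lebesgue (\<lambda>x. (cmod (a * F x + b * G x))\<^sup>2)"
  proof (rule Bochner_Integration.integrable_bound)
    show "integrable lebesgue (\<lambda>x. 2 * (cmod a)\<^sup>2 * (cmod (F x))\<^sup>2 + 2 * (cmod b)\<^sup>2 * (cmod (G x))\<^sup>2)"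
      using F G by auto
    show "AE x in lebesgue. norm ((cmod (a * F x + b * G x))\<^sup>2) \<le> norm (2 * (cmod a)\<^sup>2 * (cmod (F x))\<^sup>2 + 2 * (cmod b)\<^sup>2 * (cmod (G x))\<^sup>2)"
    proof (rule AE_I2)
      fix x
      have "(cmod (a * F x + b * G x))\<^sup>2 \<le> (cmod (a * F x) + cmod (b * G x))\<^sup>2"
        by (intro power_mono norm_triangle_ineq) auto
      also have "\<dots> \<le> 2 * (cmod (a * F x))\<^sup>2 + 2 * (cmod (b * G x))\<^sup>2"
        using sum_squares_bound[of "cmod (a * F x)" "cmod (b * G x)"] by (simp add: power2_sum)
      finally show "norm ((cmod (a * F x + b * G x))\<^sup>2) \<le> norm (2 * (cmod a)\<^sup>2 * (cmod (F x))\<^sup>2 + 2 * (cmod b)\<^sup>2 * (cmod (G x))\<^sup>2)"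
        by (simp add: norm_mult power_mult_distrib)
    qed
  qed (use F G in measurable)
  then show ?thesis unfolding sq_integrable_restrict e using F G by auto
qed

lemma sq_integrable_cnj: "sq_integrable S (\<lambda>x. cnj (f x)) \<longleftrightarrow> sq_integrable S f"
proof -
  have *: "sq_integrable S (\<lambda>x. cnj (f x))" if "sq_integrable S f" for f
  proof -
    have "(\<lambda>x. cnj (indicator S x *\<^sub>R f x)) \<in> borel_measurable lebesgue"
      using that unfolding sq_integrable_restrict
      by (intro measurable_compose[OF _ borel_measurable_continuous_onI[of cnj]] continuous_intros) auto
    then show ?thesis using that by (simp add: sq_integrable_def set_borel_measurable_def)
  qed
  show ?thesis using *[of f] *[of "\<lambda>x. cnj (f x)"] by auto
qed

lemma sq_integrable_subset:
  assumes "sq_integrable S f" "T \<subseteq> S" "T \<in> sets lebesgue"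
  shows "sq_integrable T f"
  using assms set_integrable_subset set_borel_measurable_subset[of lebesgue S f T] unfolding sq_integrable_def by blast

lemma sq_norm_mono:
  assumes "sq_integrable S f" "T \<subseteq> S" "T \<in> sets lebesgue"
  shows "sq_norm T f \<le> sq_norm S f"
  unfolding sq_norm_def set_lebesgue_integral_def
proof (rule integral_mono)
  have "set_integrable lebesgue T (\<lambda>x. (cmod (f x))\<^sup>2)"
    using assms by (auto simp: sq_integrable_def intro: set_integrable_subset)
  then show "integrable lebesgue (\<lambda>x. indicat_real T x *\<^sub>R (cmod (f x))\<^sup>2)" by (simp add: set_integrable_def)
  show "integrable lebesgue (\<lambda>x. indicat_real S x *\<^sub>R (cmod (f x))\<^sup>2)"
    using assms by (simp add: sq_integrable_def set_integrable_def)
qed (use assms(2) in \<open>auto simp: indicator_def\<close>)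

lemma sq_integrable_continuous:
  assumes "continuous_on {a..b} f"
  shows "sq_integrable {a..b} f"
proof -
  have "set_borel_measurable lebesgue {a..b} f"
    using assms continuous_imp_measurable_on_sets_lebesgue[OF assms]
    by (simp add: set_borel_measurable_def borel_measurable_restrict_space_iff)
  moreover have "set_integrable lebesgue {a..b} (\<lambda>x. (cmod (f x))\<^sup>2)"
    using assms by (intro absolutely_integrable_continuous_real continuous_intros)
  ultimately show ?thesis by (simp add: sq_integrable_def)
qed

text \<open>Changing a function on a null set keeps it square integrable because Lebesgue measure is complete.
Such changes are needed for second derivatives, which exist only almost everywhere.\<close>

lemma L2_cong_AE:
  assumes "AE x in lebesgue. x > l \<longrightarrow> f x = (g x :: complex)" "f \<in> L2_half_line l"
  shows "g \<in> L2_half_line l"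
proof -
  have ae: "AE x in lebesgue. indicator {l..} x *\<^sub>R f x = indicator {l..} x *\<^sub>R g x"
  proof -
    have "AE x in lebesgue. x \<ge> l \<longrightarrow> f x = g x" using assms(1) by (simp add: AE_half_line_open_iff)
    then show ?thesis by eventually_elim (auto simp: indicator_def)
  qed
  have f: "(\<lambda>x. indicator {l..} x *\<^sub>R f x) \<in> borel_measurable lebesgue"
    "integrable lebesgue (\<lambda>x. (cmod (indicator {l..} x *\<^sub>R f x))\<^sup>2)"
    using assms(2) by (auto simp: L2_iff sq_integrable_restrict)
  have g: "(\<lambda>x. indicator {l..} x *\<^sub>R g x) \<in> borel_measurable lebesgue"
    using borel_measurable_AE[OF f(1) ae] .
  have "integrable lebesgue (\<lambda>x. (cmod (indicator {l..} x *\<^sub>R g x))\<^sup>2)"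
  proof (rule integrable_cong_AE_imp[OF f(2)])
    show "(\<lambda>x. (cmod (indicator {l..} x *\<^sub>R g x))\<^sup>2) \<in> borel_measurable lebesgue" using g by measurable
    show "AE x in lebesgue. (cmod (indicator {l..} x *\<^sub>R f x))\<^sup>2 = (cmod (indicator {l..} x *\<^sub>R g x))\<^sup>2"
      using ae by eventually_elim (simp only:)
  qed
  then show ?thesis using g by (simp add: L2_iff sq_integrable_restrict)
qed

lemma L2_inner_cong_AE:
  assumes "AE x in lebesgue. x > l \<longrightarrow> f x = f' x" "f \<in> L2_half_line l" "g \<in> L2_half_line l"
  shows "L2_inner l f g = L2_inner l f' g"
proof -
  have f': "f' \<in> L2_half_line l" using L2_cong_AE assms by blast
  have gc: "sq_integrable {l..} (\<lambda>x. cnj (g x))" using assms by (simp add: sq_integrable_cnj L2_iff)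
  have m: "(\<lambda>x. indicator {l..} x *\<^sub>R (f x * cnj (g x))) \<in> borel_measurable lebesgue"
    "(\<lambda>x. indicator {l..} x *\<^sub>R (f' x * cnj (g x))) \<in> borel_measurable lebesgue"
    using sq_integrable_mult(1)[OF _ gc] assms f' by (auto simp: set_integrable_def L2_iff)
  have "AE x in lebesgue. x \<ge> l \<longrightarrow> f x = f' x" using assms(1) by (simp add: AE_half_line_open_iff)
  then show ?thesis
    unfolding L2_inner_def set_lebesgue_integral_def
    by (intro integral_cong_AE m) (auto simp: indicator_def elim!: eventually_mono)
qed

lemma L2_inner_integrable:
  assumes "f \<in> L2_half_line l" "g \<in> L2_half_line l"
  shows "set_integrable lebesgue {l..} (\<lambda>x. f x * cnj (g x))"
  using assms by (intro sq_integrable_mult) (auto simp: L2_iff sq_integrable_cnj)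

lemma L2_inner_lincomb:
  assumes "f \<in> L2_half_line l" "g \<in> L2_half_line l" "h \<in> L2_half_line l"
  shows "L2_inner l (\<lambda>x. a * f x + b * g x) h = a * L2_inner l f h + b * L2_inner l g h"
proof -
  have i: "set_integrable lebesgue {l..} (\<lambda>x. a * (f x * cnj (h x)))" "set_integrable lebesgue {l..} (\<lambda>x. b * (g x * cnj (h x)))"
    using L2_inner_integrable assms by (intro set_integrable_mult_right; blast)+
  have "L2_inner l (\<lambda>x. a * f x + b * g x) h = (LINT x:{l..}|lebesgue. a * (f x * cnj (h x)) + b * (g x * cnj (h x)))"
    unfolding L2_inner_def by (simp add: algebra_simps)
  then show ?thesis using i by (simp add: set_integral_add L2_inner_def)
qed

lemma L2_inner_scale:
  assumes "f \<in> L2_half_line l" "h \<in> L2_half_line l"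
  shows "L2_inner l (\<lambda>x. a * f x) h = a * L2_inner l f h"
  using L2_inner_lincomb[OF assms(1) assms(1) assms(2), of a 0] by simp

lemma L2_inner_commute: "L2_inner l g f = cnj (L2_inner l f g)"
proof -
  have e: "(\<lambda>x. indicator {l..} x *\<^sub>R cnj (f x * cnj (g x))) = (\<lambda>x. cnj (indicator {l..} x *\<^sub>R (f x * cnj (g x))))"
    by (simp only: complex_cnj_scaleR)
  have "cnj (L2_inner l f g) = (LINT x:{l..}|lebesgue. cnj (f x * cnj (g x)))"
    unfolding L2_inner_def set_lebesgue_integral_def e Bochner_Integration.integral_cnj ..
  then show ?thesis by (simp add: L2_inner_def mult.commute)
qed

lemma L2_inner_self: "L2_inner l f f = of_real (sq_norm {l..} f)"
proof -
  have "L2_inner l f f = (LINT x:{l..}|lebesgue. of_real ((cmod (f x))\<^sup>2))"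
    unfolding L2_inner_def by (simp only: complex_norm_square)
  also have "\<dots> = of_real (sq_norm {l..} f)"
    unfolding sq_norm_def set_lebesgue_integral_def
    by (subst integral_complex_of_real[symmetric]) (simp add: scaleR_conv_of_real)
  finally show ?thesis .
qed

lemma L2_Cauchy_Schwarz:
  assumes "f \<in> L2_half_line l" "g \<in> L2_half_line l"
  shows "cmod (L2_inner l f g) \<le> sqrt (sq_norm {l..} f) * sqrt (sq_norm {l..} g)"
  using sq_integrable_mult(2)[of "{l..}" f "\<lambda>x. cnj (g x)"] assms
  by (simp add: L2_inner_def L2_iff sq_integrable_cnj sq_norm_def)

lemma sq_norm_zero_imp_zero:
  assumes f: "f \<in> L2_half_line l" "continuous_on {l..} f" "sq_norm {l..} f = 0" and x: "x \<ge> l"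
  shows "f x = 0"
proof -
  have c: "continuous_on {l..x+1} (\<lambda>x. (cmod (f x))\<^sup>2)"
    by (intro continuous_intros continuous_on_subset[OF f(2)]) auto
  have "sq_norm {l..x+1} f \<le> 0" using sq_norm_mono[of "{l..}" f "{l..x+1}"] f by (simp add: L2_iff)
  then have "sq_norm {l..x+1} f = 0" using sq_norm_nonneg[of "{l..x+1}" f] by linarith
  moreover have "sq_norm {l..x+1} f = integral {l..x+1} (\<lambda>x. (cmod (f x))\<^sup>2)"
    unfolding sq_norm_def using c by (intro set_lebesgue_integral_eq_integral(2) absolutely_integrable_continuous_real)
  ultimately have "\<forall>y\<in>{l..x+1}. (cmod (f y))\<^sup>2 = 0"
    using integral_eq_0_iff[OF c] x by auto
  then show ?thesis using x by auto
qed

section \<open>Lagrange's identity on bounded intervals\<close>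

definition wronskian :: "real \<Rightarrow> (real \<Rightarrow> complex) \<Rightarrow> (real \<Rightarrow> complex) \<Rightarrow> real \<Rightarrow> complex" where
  "wronskian l f g x = f x * dif l g x - dif l f x * g x"

lemma regular_cnj:
  assumes "regular l y"
  shows "regular l (\<lambda>x. cnj (y x))"
    "\<And>x. x \<ge> l \<Longrightarrow> dif l (\<lambda>x. cnj (y x)) x = cnj (dif l y x)"
    "AE x in lebesgue. x > l \<longrightarrow> dif l (dif l (\<lambda>x. cnj (y x))) x = cnj (dif l (dif l y) x)"
proof -
  have zero: "\<And>x. x < l \<Longrightarrow> cnj (y x) = 0" using assms by (simp add: regular_def)
  have der: "((\<lambda>x. cnj (y x)) has_vector_derivative cnj (dif l y x)) (at x within {l..})" if "x \<ge> l" for x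
    using regular_has_derivative[OF assms that] by (rule has_vector_derivative_cnj)
  have ac: "locally_absolutely_continuous l (\<lambda>x. cnj (dif l y x))"
    using assms unfolding regular_def locally_absolutely_continuous_def by (auto intro!: ac_cnj)
  show "regular l (\<lambda>x. cnj (y x))" and d: "\<And>x. x \<ge> l \<Longrightarrow> dif l (\<lambda>x. cnj (y x)) x = cnj (dif l y x)"
    using regularI[OF zero der ac] by auto
  obtain N where N: "negligible N"
    "\<And>x. x > l \<Longrightarrow> x \<notin> N \<Longrightarrow> (dif l y has_vector_derivative dif l (dif l y) x) (at x)"
    using regular_second_derivative[OF assms(1)] by blast
  have "dif l (dif l (\<lambda>x. cnj (y x))) x = cnj (dif l (dif l y) x)" if x: "x > l" "x \<notin> N" for x
  proof (rule dif_eqI_interior[OF _ x(1)])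
    have "((\<lambda>x. cnj (dif l y x)) has_vector_derivative cnj (dif l (dif l y) x)) (at x)"
      using N(2) x by (intro has_vector_derivative_cnj) auto
    then show "(dif l (\<lambda>x. cnj (y x)) has_vector_derivative cnj (dif l (dif l y) x)) (at x)"
      by (rule has_vector_derivative_transform_within_open[of _ _ _ "{l<..}"]) (use x d in auto)
  qed
  then show "AE x in lebesgue. x > l \<longrightarrow> dif l (dif l (\<lambda>x. cnj (y x))) x = cnj (dif l (dif l y) x)"
    using N(1) unfolding eventually_ae_filter_negligible by blast
qed

lemma diff_expr_cnj_AE:
  assumes "regular l y"
  shows "AE x in lebesgue. x > l \<longrightarrow> cnj (diff_expr l q y x) = diff_expr l q (\<lambda>x. cnj (y x)) x"
  using regular_cnj(3)[OF assms] by eventually_elim (auto simp: diff_expr_def)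

lemma diff_expr_lincomb_AE:
  assumes "regular l y" "regular l w"
  shows "AE x in lebesgue. x > l \<longrightarrow> a * diff_expr l q y x + b * diff_expr l q w x = diff_expr l q (\<lambda>x. a * y x + b * w x) x"
  using regular_lincomb(3)[OF assms, of a b] by eventually_elim (auto simp: diff_expr_def algebra_simps)

text \<open>The Wronskian is locally absolutely continuous, and in its derivative the terms with two first
derivatives cancel.\<close>

lemma Lagrange_identity:
  assumes f: "regular l f" and g: "regular l g" and b: "l \<le> b"
  shows "(\<lambda>x. diff_expr l q f x * g x - f x * diff_expr l q g x) absolutely_integrable_on {l..b}"
    and "integral {l..b} (\<lambda>x. diff_expr l q f x * g x - f x * diff_expr l q g x) = wronskian l f g b - wronskian l f g l"
proof -
  obtain N where N: "negligible N"
    "\<And>x. x > l \<Longrightarrow> x \<notin> N \<Longrightarrow> (dif l f has_vector_derivative dif l (dif l f) x) (at x)"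
    using regular_second_derivative[OF f] by blast
  obtain M where M: "negligible M"
    "\<And>x. x > l \<Longrightarrow> x \<notin> M \<Longrightarrow> (dif l g has_vector_derivative dif l (dif l g) x) (at x)"
    using regular_second_derivative[OF g] by blast
  have ac: "absolutely_continuous_on l b (wronskian l f g)"
    using f g b unfolding wronskian_def regular_def locally_absolutely_continuous_def by (auto intro!: ac_diff ac_mult)
  have D: "(wronskian l f g has_vector_derivative (diff_expr l q f x * g x - f x * diff_expr l q g x)) (at x)"
    if "x \<in> {l<..<b} - (N \<union> M)" for x
  proof -
    have x: "x > l" "x \<notin> N" "x \<notin> M" using that by auto
    have d: "(f has_vector_derivative dif l f x) (at x)" "(g has_vector_derivative dif l g x) (at x)"
      using regular_has_derivative[OF f, of x] regular_has_derivative[OF g, of x] x at_within_half_line[OF x(1)] by auto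
    have "((\<lambda>x. f x * dif l g x - dif l f x * g x) has_vector_derivative
        (f x * dif l (dif l g) x + dif l f x * dif l g x) - (dif l f x * dif l g x + dif l (dif l f) x * g x)) (at x)"
      by (intro has_vector_derivative_diff has_vector_derivative_mult d N(2) M(2) x)
    then show ?thesis by (simp add: wronskian_def[abs_def] diff_expr_def algebra_simps)
  qed
  have neg: "negligible (N \<union> M)" using N M by (intro negligible_Un)
  show "(\<lambda>x. diff_expr l q f x * g x - f x * diff_expr l q g x) absolutely_integrable_on {l..b}"
    by (rule ac_FTC(1)[OF ac b neg D])
  show "integral {l..b} (\<lambda>x. diff_expr l q f x * g x - f x * diff_expr l q g x) = wronskian l f g b - wronskian l f g l"
    using ac_FTC(2)[OF ac b neg D, of b] b by auto
qed

lemma D_star_lincomb: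
  assumes "f \<in> D_star l q" "g \<in> D_star l q"
  shows "(\<lambda>x. a * f x + b * g x) \<in> D_star l q"
proof -
  have r: "regular l f" "regular l g" and L: "f \<in> L2_half_line l" "g \<in> L2_half_line l"
    "diff_expr l q f \<in> L2_half_line l" "diff_expr l q g \<in> L2_half_line l"
    using assms by (auto simp: D_star_def)
  have "diff_expr l q (\<lambda>x. a * f x + b * g x) \<in> L2_half_line l"
    by (rule L2_cong_AE[OF diff_expr_lincomb_AE[OF r]]) (use L in \<open>auto simp: L2_iff sq_integrable_lincomb\<close>)
  then show ?thesis using regular_lincomb(1)[OF r] L by (auto simp: D_star_def L2_iff sq_integrable_lincomb)
qed

lemma D_star_cnj:
  assumes "f \<in> D_star l q"
  shows "(\<lambda>x. cnj (f x)) \<in> D_star l q"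
proof -
  have r: "regular l f" and L: "f \<in> L2_half_line l" "diff_expr l q f \<in> L2_half_line l"
    using assms by (auto simp: D_star_def)
  have "diff_expr l q (\<lambda>x. cnj (f x)) \<in> L2_half_line l"
    by (rule L2_cong_AE[OF diff_expr_cnj_AE[OF r]]) (use L in \<open>auto simp: L2_iff sq_integrable_cnj\<close>)
  then show ?thesis using regular_cnj(1)[OF r] L by (auto simp: D_star_def L2_iff sq_integrable_cnj)
qed

lemma ode_solution_diff_expr:
  "ode_solution l q z y \<Longrightarrow> AE x in lebesgue. x > l \<longrightarrow> z * y x = diff_expr l q y x"
  unfolding ode_solution_def AE_half_line_open_iff by (auto elim: eventually_mono)

lemma ode_solution_D_star:
  assumes "ode_solution l q z y" "y \<in> L2_half_line l"
  shows "y \<in> D_star l q"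
proof -
  have "diff_expr l q y \<in> L2_half_line l"
    by (rule L2_cong_AE[OF ode_solution_diff_expr[OF assms(1)]])
       (use assms(2) sq_integrable_lincomb[of "{l..}" y y z 0] in \<open>auto simp: L2_iff\<close>)
  then show ?thesis using assms by (simp add: D_star_def ode_solution_def)
qed

lemma ode_solution_cnj:
  assumes "ode_solution l q z y"
  shows "ode_solution l q (cnj z) (\<lambda>x. cnj (y x))"
proof -
  have r: "regular l y" using assms by (simp add: ode_solution_def)
  have "AE x in lebesgue. x > l \<longrightarrow> diff_expr l q (\<lambda>x. cnj (y x)) x = cnj z * cnj (y x)"
    using diff_expr_cnj_AE[OF r, of q] ode_solution_diff_expr[OF assms]
    by eventually_elim (auto simp flip: complex_cnj_mult)
  then show ?thesis using regular_cnj(1)[OF r] by (simp add: ode_solution_def AE_half_line_open_iff)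
qed

section \<open>The limit point case\<close>

text \<open>Monotone convergence along the intervals \<open>[l, l + n]\<close>.\<close>

lemma L2_of_bounded:
  assumes c: "continuous_on {l..} f" and bd: "\<And>b. b \<ge> l \<Longrightarrow> sq_norm {l..b} f \<le> C"
  shows "f \<in> L2_half_line l"
proof -
  have m: "set_borel_measurable lebesgue {l..} f"
    using continuous_imp_measurable_on_sets_lebesgue[OF c]
    by (simp add: set_borel_measurable_def borel_measurable_restrict_space_iff)
  define u where "u n x = indicator {l..l + real n} x *\<^sub>R (cmod (f x))\<^sup>2" for n x
  have si: "sq_integrable {l..b} f" for b by (intro sq_integrable_continuous continuous_on_subset[OF c]) auto
  have ui: "integrable lebesgue (u n)" for n
    using si[of "l + real n"] by (simp add: sq_integrable_def set_integrable_def u_def[abs_def])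
  have uI: "integral\<^sup>L lebesgue (u n) = sq_norm {l..l + real n} f" for n
    by (simp add: sq_norm_def set_lebesgue_integral_def u_def[abs_def])
  have "incseq (\<lambda>n. integral\<^sup>L lebesgue (u n))"
    unfolding uI incseq_def by (intro allI impI sq_norm_mono si) auto
  moreover have "\<forall>n. integral\<^sup>L lebesgue (u n) \<le> C" unfolding uI by (intro allI bd) auto
  ultimately obtain L where L: "(\<lambda>n. integral\<^sup>L lebesgue (u n)) \<longlonglongrightarrow> L" using incseq_convergent by blast
  have "integrable lebesgue (\<lambda>x. indicator {l..} x *\<^sub>R (cmod (f x))\<^sup>2)"
  proof (rule integrable_monotone_convergence[OF ui _ _ L])
    show "AE x in lebesgue. mono (\<lambda>n. u n x)"
      by (rule AE_I2) (auto simp: mono_def u_def indicator_def)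
    show "AE x in lebesgue. (\<lambda>n. u n x) \<longlonglongrightarrow> indicator {l..} x *\<^sub>R (cmod (f x))\<^sup>2"
    proof (rule AE_I2)
      fix x
      obtain n0 :: nat where "x - l \<le> real n0" using real_arch_simple by blast
      then have "\<forall>\<^sub>F n in sequentially. u n x = indicator {l..} x *\<^sub>R (cmod (f x))\<^sup>2"
        unfolding eventually_sequentially by (intro exI[of _ n0]) (auto simp: u_def indicator_def)
      then show "(\<lambda>n. u n x) \<longlonglongrightarrow> indicator {l..} x *\<^sub>R (cmod (f x))\<^sup>2" by (rule tendsto_eventually)
    qed
    have "(\<lambda>x. (cmod (indicator {l..} x *\<^sub>R f x))\<^sup>2) \<in> borel_measurable lebesgue"
      using m unfolding set_borel_measurable_def by measurable
    moreover have "(\<lambda>x. (cmod (indicator {l..} x *\<^sub>R f x))\<^sup>2) = (\<lambda>x. indicator {l..} x *\<^sub>R (cmod (f x))\<^sup>2)"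
      by (auto simp: indicator_def)
    ultimately show "(\<lambda>x. indicator {l..} x *\<^sub>R (cmod (f x))\<^sup>2) \<in> borel_measurable lebesgue" by simp
  qed
  then show ?thesis using m by (simp add: L2_half_line_def set_integrable_def)
qed

lemma sq_norm_at_top:
  assumes c: "continuous_on {l..} f" and nL2: "f \<notin> L2_half_line l"
  shows "filterlim (\<lambda>b. sq_norm {l..b} f) at_top at_top"
  unfolding filterlim_at_top
proof
  fix Z
  have "\<exists>b\<ge>l. sq_norm {l..b} f > Z"
    by (rule ccontr) (use L2_of_bounded[OF c, of Z] nL2 in force)
  then obtain b where b: "b \<ge> l" "sq_norm {l..b} f > Z" by blast
  have "Z \<le> sq_norm {l..x} f" if "x \<ge> b" for x
  proof -
    have "sq_norm {l..b} f \<le> sq_norm {l..x} f"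
      using that by (intro sq_norm_mono sq_integrable_continuous continuous_on_subset[OF c]) auto
    then show ?thesis using b by simp
  qed
  then show "\<forall>\<^sub>F x in at_top. Z \<le> sq_norm {l..x} f" by (auto simp: eventually_at_top_linorder)
qed

text \<open>Split the integral at a point beyond which \<open>w\<close> has small norm. The first part is constant, so it
is negligible against the growing norm of \<open>p\<close>; the second one is estimated by the Cauchy-Schwarz
inequality.\<close>

lemma integral_against_growing_is_o:
  assumes w: "w \<in> L2_half_line l" and c: "continuous_on {l..} p"
    and N: "filterlim (\<lambda>b. sq_norm {l..b} p) at_top at_top"
  shows "((\<lambda>b. (LINT x:{l..b}|lebesgue. w x * p x) / complex_of_real (sqrt (sq_norm {l..b} p))) \<longlongrightarrow> 0) at_top"
  unfolding tendsto_iff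
proof (intro allI impI)
  fix e :: real assume e: "e > 0"
  have ws: "sq_integrable {l..} w" using w by (simp add: L2_iff)
  have ps: "sq_integrable {l..b} p" for b by (intro sq_integrable_continuous continuous_on_subset[OF c]) auto
  have wi: "set_integrable lebesgue {l..} (\<lambda>x. (cmod (w x))\<^sup>2)" using ws by (simp add: sq_integrable_def)
  have "((\<lambda>b. sq_norm {l..b} w) \<longlongrightarrow> sq_norm {l..} w) at_top"
    unfolding sq_norm_def by (rule tendsto_set_lebesgue_integral_at_top[OF _ wi]) auto
  then have "\<forall>\<^sub>F c in at_top. sq_norm {l..c} w > sq_norm {l..} w - (e/2)\<^sup>2"
    using e by (intro order_tendstoD(1)) auto
  then obtain c0 where c0: "c0 \<ge> l" "sq_norm {l..c0} w > sq_norm {l..} w - (e/2)\<^sup>2"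
    by (metis (mono_tags, lifting) eventually_at_top_linorder max.cobounded1 max.cobounded2)
  define K where "K = cmod (LINT x:{l..c0}|lebesgue. w x * p x)"
  have "\<forall>\<^sub>F b in at_top. sq_norm {l..b} p > (2 * K / e)\<^sup>2"
    using N by (simp add: filterlim_at_top_dense)
  moreover have "\<forall>\<^sub>F b in at_top. sq_norm {l..b} p > 0"
    using N by (simp add: filterlim_at_top_dense)
  moreover have "\<forall>\<^sub>F b in at_top. b \<ge> c0" by (rule eventually_ge_at_top)
  ultimately show "\<forall>\<^sub>F b in at_top. dist ((LINT x:{l..b}|lebesgue. w x * p x) / complex_of_real (sqrt (sq_norm {l..b} p))) 0 < e"
  proof eventually_elim
    case (elim b)
    have un: "{l..b} = {l..c0} \<union> {c0<..b}" using elim c0 by auto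
    have wb: "sq_integrable {l..b} w" by (rule sq_integrable_subset[OF ws]) auto
    have pint: "set_integrable lebesgue {l..b} (\<lambda>x. w x * p x)" by (rule sq_integrable_mult(1)[OF wb ps])
    have sub: "{l..c0} \<subseteq> {l..b}" "{c0<..b} \<subseteq> {l..b}" using un by auto
    have "(LINT x:{l..b}|lebesgue. w x * p x) = (LINT x:{l..c0}|lebesgue. w x * p x) + (LINT x:{c0<..b}|lebesgue. w x * p x)"
      unfolding un by (rule set_integral_Un) (use sub in \<open>auto intro: set_integrable_subset[OF pint]\<close>)
    then have "cmod (LINT x:{l..b}|lebesgue. w x * p x) \<le> K + cmod (LINT x:{c0<..b}|lebesgue. w x * p x)"
      unfolding K_def by (simp add: norm_triangle_ineq)
    also have "cmod (LINT x:{c0<..b}|lebesgue. w x * p x) \<le> sqrt (sq_norm {c0<..b} w) * sqrt (sq_norm {c0<..b} p)"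
      using sub by (intro sq_integrable_mult(2) sq_integrable_subset[OF wb] sq_integrable_subset[OF ps[of b]]) auto
    also have "\<dots> \<le> (e/2) * sqrt (sq_norm {l..b} p)"
    proof (rule mult_mono)
      have "sq_norm {l..b} w = sq_norm {l..c0} w + sq_norm {c0<..b} w"
        unfolding sq_norm_def un
        by (rule set_integral_Un) (use wb sub in \<open>auto intro: set_integrable_subset simp: sq_integrable_def\<close>)
      moreover have "sq_norm {l..b} w \<le> sq_norm {l..} w" by (rule sq_norm_mono[OF ws]) auto
      ultimately have "sq_norm {c0<..b} w \<le> (e/2)\<^sup>2" using c0 by linarith
      then show "sqrt (sq_norm {c0<..b} w) \<le> e/2" using e by (intro real_le_lsqrt) (auto simp: sq_norm_nonneg)
      show "sqrt (sq_norm {c0<..b} p) \<le> sqrt (sq_norm {l..b} p)"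
        using sub sq_norm_mono[OF ps[of b], of "{c0<..b}"] by auto
    qed (use e sq_norm_nonneg in auto)
    finally have le: "cmod (LINT x:{l..b}|lebesgue. w x * p x) \<le> K + (e/2) * sqrt (sq_norm {l..b} p)" by simp
    have "2 * K / e < sqrt (sq_norm {l..b} p)" by (rule real_less_rsqrt[OF elim(1)])
    then have "K < (e/2) * sqrt (sq_norm {l..b} p)" using e by (simp add: field_simps)
    then have "cmod (LINT x:{l..b}|lebesgue. w x * p x) < e * sqrt (sq_norm {l..b} p)" using le by linarith
    then show ?case using elim(2) by (simp add: norm_divide field_simps)
  qed
qed

lemma integral_eq_LINT:
  fixes k :: "real \<Rightarrow> complex"
  assumes "k absolutely_integrable_on {l..b}"
  shows "integral {l..b} k = (LINT x:{l..b}|lebesgue. k x)"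
  using set_lebesgue_integral_eq_integral(2)[OF assms] by simp

lemma const_over_at_top_tendsto_0:
  assumes "filterlim g at_top F"
  shows "((\<lambda>b. c / complex_of_real (g b)) \<longlongrightarrow> 0) F"
proof (rule tendsto_norm_zero_cancel)
  have "((\<lambda>b. cmod c / g b) \<longlongrightarrow> 0) F"
    using assms by (intro tendsto_divide_0[OF tendsto_const] filterlim_at_top_imp_at_infinity)
  then have "((\<lambda>b. \<bar>cmod c / g b\<bar>) \<longlongrightarrow> 0) F" by (rule tendsto_rabs_zero)
  then show "((\<lambda>b. cmod (c / complex_of_real (g b))) \<longlongrightarrow> 0) F" by (simp add: norm_divide abs_divide)
qed

text \<open>By Lagrange's identity the Wronskian of \<open>f\<close> with a solution \<open>p\<close> is a constant plus the integral of
\<open>p\<close> against the square integrable function \<open>diff_expr l q f - z f\<close>.\<close>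

lemma wronskian_solution_is_o:
  assumes f: "f \<in> D_star l q" and p: "ode_solution l q z p"
    and N: "filterlim (\<lambda>b. sq_norm {l..b} p) at_top at_top"
  shows "((\<lambda>b. wronskian l f p b / complex_of_real (sqrt (sq_norm {l..b} p))) \<longlongrightarrow> 0) at_top"
proof -
  have rf: "regular l f" and rp: "regular l p" using f p by (auto simp: D_star_def ode_solution_def)
  define w where "w x = 1 * diff_expr l q f x + (- z) * f x" for x
  have w: "w \<in> L2_half_line l"
    using f unfolding w_def[abs_def] D_star_def L2_iff by (intro sq_integrable_lincomb) auto
  have pc: "continuous_on {l..} p" using regular_continuous(1)[OF rp] .
  have eq: "wronskian l f p b = wronskian l f p l + (LINT x:{l..b}|lebesgue. w x * p x)" if b: "b \<ge> l" for b
  proof -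
    have "wronskian l f p b = wronskian l f p l + integral {l..b} (\<lambda>x. diff_expr l q f x * p x - f x * diff_expr l q p x)"
      using Lagrange_identity(2)[OF rf rp b, of q] by simp
    also have "integral {l..b} (\<lambda>x. diff_expr l q f x * p x - f x * diff_expr l q p x) = integral {l..b} (\<lambda>x. w x * p x)"
    proof (rule integral_cong_AE_half_line)
      show "AE x in lebesgue. x > l \<longrightarrow> diff_expr l q f x * p x - f x * diff_expr l q p x = w x * p x"
        using ode_solution_diff_expr[OF p] by eventually_elim (auto simp: w_def algebra_simps)
    qed
    also have "\<dots> = (LINT x:{l..b}|lebesgue. w x * p x)"
    proof (rule integral_eq_LINT, rule sq_integrable_mult(1))
      show "sq_integrable {l..b} w" using w by (auto simp: L2_iff intro: sq_integrable_subset)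
      show "sq_integrable {l..b} p" by (intro sq_integrable_continuous continuous_on_subset[OF pc]) auto
    qed
    finally show ?thesis .
  qed
  have "filterlim (\<lambda>b. sqrt (sq_norm {l..b} p)) at_top at_top"
    by (rule filterlim_compose[OF sqrt_at_top N])
  then have "((\<lambda>b. wronskian l f p l / complex_of_real (sqrt (sq_norm {l..b} p))) \<longlongrightarrow> 0) at_top"
    by (rule const_over_at_top_tendsto_0)
  from tendsto_add[OF this integral_against_growing_is_o[OF w pc N]]
  have "((\<lambda>b. wronskian l f p l / complex_of_real (sqrt (sq_norm {l..b} p)) +
     (LINT x:{l..b}|lebesgue. w x * p x) / complex_of_real (sqrt (sq_norm {l..b} p))) \<longlongrightarrow> 0) at_top" by simp
  then show ?thesis
  proof (rule Lim_transform_eventually)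
    show "\<forall>\<^sub>F b in at_top. wronskian l f p l / complex_of_real (sqrt (sq_norm {l..b} p)) +
        (LINT x:{l..b}|lebesgue. w x * p x) / complex_of_real (sqrt (sq_norm {l..b} p)) =
        wronskian l f p b / complex_of_real (sqrt (sq_norm {l..b} p))"
      using eventually_ge_at_top[of l] by eventually_elim (metis eq add_divide_distrib)
  qed
qed

text \<open>For a solution and its conjugate the integrand in Lagrange's identity is a multiple of
\<open>cmod (p x)\<^sup>2\<close>, so this Wronskian grows like the full square of the norm of \<open>p\<close>.\<close>

lemma wronskian_cnj_solution:
  assumes p: "ode_solution l q z p" and b: "b \<ge> l"
  shows "wronskian l p (\<lambda>x. cnj (p x)) b = wronskian l p (\<lambda>x. cnj (p x)) l + 2 * \<i> * of_real (Im z * sq_norm {l..b} p)"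
proof -
  define r where "r x = cnj (p x)" for x
  have r: "ode_solution l q (cnj z) r" using ode_solution_cnj[OF p] by (simp add: r_def[abs_def])
  have rp: "regular l p" "regular l r" using p r by (auto simp: ode_solution_def)
  have pc: "continuous_on {l..} p" using regular_continuous(1)[OF rp(1)] .
  have "wronskian l p r b = wronskian l p r l + integral {l..b} (\<lambda>x. diff_expr l q p x * r x - p x * diff_expr l q r x)"
    using Lagrange_identity(2)[OF rp b, of q] by simp
  also have "integral {l..b} (\<lambda>x. diff_expr l q p x * r x - p x * diff_expr l q r x) =
    integral {l..b} (\<lambda>x. 2 * \<i> * of_real (Im z) * of_real ((cmod (p x))\<^sup>2))"
  proof (rule integral_cong_AE_half_line)
    show "AE x in lebesgue. x > l \<longrightarrow> diff_expr l q p x * r x - p x * diff_expr l q r x =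
        2 * \<i> * of_real (Im z) * of_real ((cmod (p x))\<^sup>2)"
      using ode_solution_diff_expr[OF p] ode_solution_diff_expr[OF r]
    proof eventually_elim
      case (elim x)
      have n: "of_real ((cmod (p x))\<^sup>2) = p x * r x" by (simp only: r_def complex_norm_square)
      have z: "2 * \<i> * complex_of_real (Im z) = z - cnj z" by (simp add: complex_eq_iff)
      have "z * p x * r x - p x * (cnj z * r x) = (z - cnj z) * (p x * r x)" by (simp add: algebra_simps)
      then show ?case using elim unfolding n z by metis
    qed
  qed
  also have "\<dots> = 2 * \<i> * of_real (Im z) * integral {l..b} (\<lambda>x. of_real ((cmod (p x))\<^sup>2))" by (rule integral_mult_right)
  also have "integral {l..b} (\<lambda>x. complex_of_real ((cmod (p x))\<^sup>2)) = of_real (integral {l..b} (\<lambda>x. (cmod (p x))\<^sup>2))"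
  proof -
    have "(\<lambda>x. (cmod (p x))\<^sup>2) integrable_on {l..b}"
      by (intro integrable_continuous_real continuous_intros continuous_on_subset[OF pc]) auto
    from integral_linear[OF this bounded_linear_of_real[where 'a=complex]] show ?thesis by (simp add: o_def)
  qed
  also have "integral {l..b} (\<lambda>x. (cmod (p x))\<^sup>2) = sq_norm {l..b} p"
    unfolding sq_norm_def
    by (intro set_lebesgue_integral_eq_integral(2)[symmetric] absolutely_integrable_continuous_real continuous_intros continuous_on_subset[OF pc]) auto
  finally show ?thesis by (simp add: r_def[abs_def] mult.assoc)
qed

text \<open>The Wronskian is a \<open>2 \<times> 2\<close> determinant of the boundary data \<open>(f b, f' b)\<close>; this is the Pluecker
relation for four vectors in the plane.\<close>

lemma Plucker_identity: "wronskian l f g b * wronskian l p r b = wronskian l f p b * wronskian l g r b - wronskian l f r b * wronskian l g p b"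
  by (simp add: wronskian_def algebra_simps)

locale limit_point = half_line +
  assumes deficiency: "deficiency_indices l q = (1, 1)"
begin

text \<open>The solutions for \<open>\<i>\<close> form a two-dimensional space. If all of them were square integrable they would
belong to the deficiency space, which has dimension one.\<close>

lemma non_L2_solution:
  obtains p where "ode_solution l q \<i> p" "p \<notin> L2_half_line l"
proof (rule ccontr)
  assume no: "\<not> thesis"
  note witness = that
  have def_space: "p \<in> deficiency_space l q \<i>" if "ode_solution l q \<i> p" for p
    using no witness[OF that] that ode_solution_D_star[OF that] by (auto simp: deficiency_space_def ode_solution_def)
  interpret V: vector_space "\<lambda>(c::complex) (y::real \<Rightarrow> complex) x. c * y x"
    by unfold_locales (auto simp: algebra_simps fun_eq_iff)
  have dim: "V.dim (deficiency_space l q \<i>) = 1"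
    using deficiency by (simp add: deficiency_indices_def complex_fun_dim_def)
  obtain B where B: "deficiency_space l q \<i> \<subseteq> V.span B" "card B = 1"
    using V.basis_exists[of "deficiency_space l q \<i>"] dim by metis
  then obtain e where e: "B = {e}" by (auto simp: card_1_singleton_iff)
  obtain p1 where p1: "ode_solution l q \<i> p1" "p1 l = 0" "dif l p1 l = 1" using ode_solution_exists by blast
  obtain p2 where p2: "ode_solution l q \<i> p2" "p2 l = 1" "dif l p2 l = 0" using ode_solution_exists by blast
  obtain a where a: "p1 = (\<lambda>x. a * e x)" using def_space[OF p1(1)] B e by (auto simp: V.span_singleton)
  obtain b where b: "p2 = (\<lambda>x. b * e x)" using def_space[OF p2(1)] B e by (auto simp: V.span_singleton)
  \<comment> \<open>Both solutions are multiples of e. Since p2 does not vanish at l, neither does e, and then p1,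
    which vanishes at l, must be zero.\<close>
  have "e l \<noteq> 0" using b p2 by auto
  then have "a = 0" using a p1 by auto
  then have p10: "p1 = (\<lambda>x. 0)" using a by simp
  have "regular l p1" using p1 by (simp add: ode_solution_def)
  then have "dif l p1 l = 0" unfolding p10 by (intro dif_eqI) auto
  then show False using p1 by simp
qed

text \<open>The heart of the limit point case. Let \<open>p\<close> be a solution for \<open>\<i>\<close> that is not square integrable, \<open>r\<close> its
conjugate, and \<open>N b\<close> the square of the norm of \<open>p\<close> on \<open>[l, b]\<close>. Then \<open>N\<close> tends to infinity, the
Wronskians of \<open>f\<close> and of \<open>g\<close> with \<open>p\<close> and \<open>r\<close> are of smaller order than \<open>sqrt N\<close>, and the Wronskian
of \<open>p\<close> and \<open>r\<close> is asymptotic to \<open>2 \<i> N\<close>. By the Pluecker identity the Wronskian of \<open>f\<close> and \<open>g\<close>,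
multiplied by something of order \<open>N\<close>, is of smaller order than \<open>N\<close>, so it tends to zero.\<close>

lemma Lagrange_no_boundary_term_at_infinity:
  assumes f: "f \<in> D_star l q" and g: "g \<in> D_star l q"
  shows "(LINT x:{l..}|lebesgue. diff_expr l q f x * g x - f x * diff_expr l q g x) = - wronskian l f g l"
proof -
  let ?k = "\<lambda>x. diff_expr l q f x * g x - f x * diff_expr l q g x"
  have rf: "regular l f" and rg: "regular l g" using f g by (auto simp: D_star_def)
  have ki: "set_integrable lebesgue {l..} ?k"
    using f g by (intro set_integral_diff(1) sq_integrable_mult(1)) (auto simp: D_star_def L2_iff)
  have "((\<lambda>b. LINT x:{l..b}|lebesgue. ?k x) \<longlongrightarrow> (LINT x:{l..}|lebesgue. ?k x)) at_top"
    by (rule tendsto_set_lebesgue_integral_at_top[OF _ ki]) auto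
  then have "((\<lambda>b. wronskian l f g l + (LINT x:{l..b}|lebesgue. ?k x)) \<longlongrightarrow> wronskian l f g l + (LINT x:{l..}|lebesgue. ?k x)) at_top"
    by (intro tendsto_intros)
  then have lim: "(wronskian l f g \<longlongrightarrow> wronskian l f g l + (LINT x:{l..}|lebesgue. ?k x)) at_top"
  proof (rule Lim_transform_eventually)
    show "\<forall>\<^sub>F b in at_top. wronskian l f g l + (LINT x:{l..b}|lebesgue. ?k x) = wronskian l f g b"
      using eventually_ge_at_top[of l]
    proof eventually_elim
      case (elim b)
      then show ?case
        using Lagrange_identity(2)[OF rf rg elim, of q] integral_eq_LINT[OF Lagrange_identity(1)[OF rf rg elim, of q]] by simp
    qed
  qed
  obtain p where p: "ode_solution l q \<i> p" "p \<notin> L2_half_line l" by (rule non_L2_solution)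
  define r where "r x = cnj (p x)" for x
  have r: "ode_solution l q (- \<i>) r" using ode_solution_cnj[OF p(1)] by (simp add: r_def[abs_def])
  have rp: "regular l p" "regular l r" using p r by (auto simp: ode_solution_def)
  have pc: "continuous_on {l..} p" using regular_continuous(1)[OF rp(1)] .
  define N where "N b = sq_norm {l..b} p" for b
  have N: "filterlim N at_top at_top" unfolding N_def[abs_def] by (rule sq_norm_at_top[OF pc p(2)])
  have Nr: "N b = sq_norm {l..b} r" for b by (simp add: N_def sq_norm_def r_def)
  have o: "((\<lambda>b. wronskian l h p b / complex_of_real (sqrt (N b))) \<longlongrightarrow> 0) at_top"
    "((\<lambda>b. wronskian l h r b / complex_of_real (sqrt (N b))) \<longlongrightarrow> 0) at_top" if "h \<in> D_star l q" for h
    using wronskian_solution_is_o[OF that p(1)] wronskian_solution_is_o[OF that r] N unfolding N_def[symmetric] Nr[symmetric] by auto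
  have Wpr: "wronskian l p r b = wronskian l p r l + 2 * \<i> * of_real (N b)" if b: "b \<ge> l" for b
    using wronskian_cnj_solution[OF p(1) b] by (simp add: r_def[abs_def] N_def)
  have Npos: "\<forall>\<^sub>F b in at_top. N b > 0" using N by (simp add: filterlim_at_top_dense)
  have "((\<lambda>b. wronskian l p r l / complex_of_real (N b)) \<longlongrightarrow> 0) at_top"
    by (rule const_over_at_top_tendsto_0[OF N])
  then have "((\<lambda>b. wronskian l p r l / complex_of_real (N b) + 2 * \<i>) \<longlongrightarrow> 0 + 2 * \<i>) at_top" by (intro tendsto_intros)
  from tendsto_mult[OF lim this]
  have 1: "((\<lambda>b. wronskian l f g b * (wronskian l p r l / complex_of_real (N b) + 2 * \<i>)) \<longlongrightarrow>
      (wronskian l f g l + (LINT x:{l..}|lebesgue. ?k x)) * (2 * \<i>)) at_top" by simp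
  have "((\<lambda>b. (wronskian l f p b / complex_of_real (sqrt (N b))) * (wronskian l g r b / complex_of_real (sqrt (N b)))
     - (wronskian l f r b / complex_of_real (sqrt (N b))) * (wronskian l g p b / complex_of_real (sqrt (N b)))) \<longlongrightarrow> 0 * 0 - 0 * 0) at_top"
    by (intro tendsto_diff tendsto_mult o f g)
  then have 2: "((\<lambda>b. wronskian l f g b * (wronskian l p r l / complex_of_real (N b) + 2 * \<i>)) \<longlongrightarrow> 0 * 0 - 0 * 0) at_top"
  proof (rule Lim_transform_eventually)
    show "\<forall>\<^sub>F b in at_top. (wronskian l f p b / complex_of_real (sqrt (N b))) * (wronskian l g r b / complex_of_real (sqrt (N b)))
     - (wronskian l f r b / complex_of_real (sqrt (N b))) * (wronskian l g p b / complex_of_real (sqrt (N b)))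
      = wronskian l f g b * (wronskian l p r l / complex_of_real (N b) + 2 * \<i>)"
      using Npos eventually_ge_at_top[of l]
    proof eventually_elim
      case (elim b)
      have s: "complex_of_real (sqrt (N b)) * complex_of_real (sqrt (N b)) = of_real (N b)"
        using elim by (simp flip: of_real_mult)
      have "(wronskian l f p b / complex_of_real (sqrt (N b))) * (wronskian l g r b / complex_of_real (sqrt (N b)))
     - (wronskian l f r b / complex_of_real (sqrt (N b))) * (wronskian l g p b / complex_of_real (sqrt (N b)))
         = wronskian l f g b * wronskian l p r b / of_real (N b)"
        unfolding times_divide_times_eq s diff_divide_distrib[symmetric] Plucker_identity[symmetric] ..
      also have "\<dots> = wronskian l f g b * (wronskian l p r l / complex_of_real (N b) + 2 * \<i>)"
        using Wpr[OF elim(2)] elim(1) by (simp add: field_simps)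
      finally show ?case .
    qed
  qed
  \<comment> \<open>The Wronskian converges, because its increment is the integral of an integrable function; both
    computations of the limit are compared.\<close>
  have "(wronskian l f g l + (LINT x:{l..}|lebesgue. ?k x)) * (2 * \<i>) = 0 * 0 - 0 * 0"
    by (rule tendsto_unique[OF _ 1 2]) simp
  then show "(LINT x:{l..}|lebesgue. ?k x) = - wronskian l f g l" by (simp add: add_eq_0_iff)
qed

theorem Lagrange_half_line:
  assumes f: "f \<in> D_star l q" and g: "g \<in> D_star l q"
  shows "L2_inner l (diff_expr l q f) g - L2_inner l f (diff_expr l q g) =
    dif l f l * cnj (g l) - f l * cnj (dif l g l)"
proof -
  have rg: "regular l g" using g by (simp add: D_star_def)
  have L: "f \<in> L2_half_line l" "g \<in> L2_half_line l" "diff_expr l q f \<in> L2_half_line l" "diff_expr l q g \<in> L2_half_line l"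
    using f g by (auto simp: D_star_def)
  define gc where "gc x = cnj (g x)" for x
  have gc: "gc \<in> D_star l q" unfolding gc_def[abs_def] by (rule D_star_cnj[OF g])
  have "AE x in lebesgue. x > l \<longrightarrow> cnj (diff_expr l q g x) = diff_expr l q gc x"
    using diff_expr_cnj_AE[OF rg, of q] by (simp only: gc_def[abs_def])
  then have ae: "AE x in lebesgue. x > l \<longrightarrow> diff_expr l q g x = cnj (diff_expr l q gc x)"
    by eventually_elim (metis complex_cnj_cnj)
  have Lgc: "(\<lambda>x. cnj (diff_expr l q gc x)) \<in> L2_half_line l"
    using gc by (auto simp: D_star_def L2_iff sq_integrable_cnj)
  have "L2_inner l f (diff_expr l q g) = L2_inner l f (\<lambda>x. cnj (diff_expr l q gc x))"
    using L2_inner_cong_AE[OF ae L(4) L(1)] L2_inner_commute by metis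
  also have "\<dots> = (LINT x:{l..}|lebesgue. f x * diff_expr l q gc x)" by (simp add: L2_inner_def)
  finally have "L2_inner l (diff_expr l q f) g - L2_inner l f (diff_expr l q g) =
      (LINT x:{l..}|lebesgue. diff_expr l q f x * gc x) - (LINT x:{l..}|lebesgue. f x * diff_expr l q gc x)"
    by (simp add: L2_inner_def gc_def)
  also have "\<dots> = (LINT x:{l..}|lebesgue. diff_expr l q f x * gc x - f x * diff_expr l q gc x)"
    using L gc by (intro set_integral_diff(2)[symmetric] sq_integrable_mult(1)) (auto simp: D_star_def L2_iff)
  also have "\<dots> = - wronskian l f gc l" by (rule Lagrange_no_boundary_term_at_infinity[OF f gc])
  also have "\<dots> = dif l f l * cnj (g l) - f l * cnj (dif l g l)"
    using regular_cnj(2)[OF rg, of l] by (simp add: wronskian_def gc_def[abs_def])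
  finally show ?thesis .
qed

end

section \<open>The Weyl solution and the Weyl function\<close>

context half_line
begin

lemma phi1_solution:
  "ode_solution l q z (phi1 l q z)" "phi1 l q z l = 0" "dif l (phi1 l q z) l = 1"
proof -
  have "\<exists>!y. ode_solution l q z y \<and> y l = 0 \<and> dif l y l = 1"
    using ode_solution_exists[of z 0 1] ode_solution_unique[of z] by metis
  from theI'[OF this] show "ode_solution l q z (phi1 l q z)" "phi1 l q z l = 0" "dif l (phi1 l q z) l = 1"
    by (auto simp: phi1_def)
qed

lemma phi2_solution:
  "ode_solution l q z (phi2 l q z)" "phi2 l q z l = -1" "dif l (phi2 l q z) l = 0"
proof -
  have "\<exists>!y. ode_solution l q z y \<and> y l = -1 \<and> dif l y l = 0"
    using ode_solution_exists[of z "-1" 0] ode_solution_unique[of z] by metis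
  from theI'[OF this] show "ode_solution l q z (phi2 l q z)" "phi2 l q z l = -1" "dif l (phi2 l q z) l = 0"
    by (auto simp: phi2_def)
qed

lemma ode_solution_zero_iff:
  assumes "ode_solution l q z y"
  shows "y = (\<lambda>x. 0) \<longleftrightarrow> y l = 0 \<and> dif l y l = 0"
proof
  assume y: "y = (\<lambda>x. 0)"
  have "((\<lambda>x. 0 :: complex) has_vector_derivative 0) (at l within {l..})" by simp
  then have "dif l (\<lambda>x. 0) l = 0" by (rule dif_eqI) simp
  then show "y l = 0 \<and> dif l y l = 0" using y by simp
next
  assume 0: "y l = 0 \<and> dif l y l = 0"
  have s: "ode_solution l q z (\<lambda>x. 0 * y x + 0 * y x)" by (rule ode_solution_lincomb[OF assms assms])
  have "regular l y" using assms by (simp add: ode_solution_def)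
  then have "dif l (\<lambda>x. 0 * y x + 0 * y x) l = 0" using regular_lincomb(2)[of l y y l 0 0] by simp
  then have "y = (\<lambda>x. 0 * y x + 0 * y x)" using ode_solution_unique[OF assms s] 0 by simp
  then show "y = (\<lambda>x. 0)" by (simp add: fun_eq_iff)
qed

text \<open>Weyl's nested circles, expressed by compactness. The quantity \<open>E c b\<close> below is \<open>Im z\<close> times the imaginary
part of \<open>u (cnj u')\<close> at \<open>b\<close>, for the solution \<open>u\<close> with coefficients \<open>c\<close>. It increases with \<open>b\<close>, at a rate
proportional to \<open>cmod (u b)\<^sup>2\<close>. For each \<open>b\<close> some unit vector \<open>c\<close> yields a solution that vanishes
at \<open>b\<close>, hence \<open>E c b = 0\<close> and \<open>E c x \<le> 0\<close> for \<open>x \<le> b\<close>. A limit of these vectors as \<open>b\<close> tends to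
infinity yields a solution with \<open>E c b \<le> 0\<close> for all \<open>b\<close>; its norm is thereby bounded by the
initial value of \<open>E\<close>.\<close>

lemma Weyl_nested:
  assumes z: "Im z \<noteq> 0"
  obtains u where "ode_solution l q z u" "u \<in> L2_half_line l" "u \<noteq> (\<lambda>x. 0)"
proof -
  define U where "U c x = fst c * phi1 l q z x + snd c * phi2 l q z x" for c :: "complex \<times> complex" and x
  define U' where "U' c x = fst c * dif l (phi1 l q z) x + snd c * dif l (phi2 l q z) x" for c :: "complex \<times> complex" and x
  define E where "E c b = Im z * Im (U c b * cnj (U' c b))" for c b
  have r: "regular l (phi1 l q z)" "regular l (phi2 l q z)"
    using phi1_solution phi2_solution by (auto simp: ode_solution_def)
  have Us: "ode_solution l q z (U c)" for c
    unfolding U_def[abs_def] by (intro ode_solution_lincomb phi1_solution phi2_solution)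
  have Ur: "regular l (U c)" for c using Us by (simp add: ode_solution_def)
  have Ud: "dif l (U c) x = U' c x" if "x \<ge> l" for c x
    using regular_lincomb(2)[OF r that] by (simp add: U_def[abs_def] U'_def)
  have W: "wronskian l (U c) (\<lambda>x. cnj (U c x)) b = 2 * \<i> * of_real (Im (U c b * cnj (U' c b)))" if "b \<ge> l" for c b
    using regular_cnj(2)[OF Ur that] Ud[OF that] by (simp add: wronskian_def complex_eq_iff)
  have E: "E c b = E c l + (Im z)\<^sup>2 * sq_norm {l..b} (U c)" if b: "b \<ge> l" for c b
  proof -
    have "2 * \<i> * complex_of_real (Im (U c b * cnj (U' c b))) =
        2 * \<i> * of_real (Im (U c l * cnj (U' c l)) + Im z * sq_norm {l..b} (U c))"
      using wronskian_cnj_solution[OF Us b, of c] unfolding W[OF b] W[OF order_refl] by (simp add: distrib_left)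
    then have "Im (U c b * cnj (U' c b)) = Im (U c l * cnj (U' c l)) + Im z * sq_norm {l..b} (U c)"
      by (simp only: mult_cancel_left of_real_eq_iff) simp
    then show ?thesis by (simp add: E_def distrib_left power2_eq_square)
  qed
  have sq: "sq_integrable {l..b} (U c)" for b c
    by (intro sq_integrable_continuous continuous_on_subset[OF regular_continuous(1)[OF Ur]]) auto
  have Emono: "E c b \<le> E c b'" if "l \<le> b" "b \<le> b'" for c b b'
    using E[of b c] E[of b' c] that sq_norm_mono[OF sq, of "{l..b}" b' c] by (auto intro!: mult_left_mono)
  have "\<exists>c. c \<in> sphere 0 1 \<and> E c (l + real n) = 0" for n
  proof -
    obtain d :: "complex \<times> complex" where d: "d \<noteq> 0" "U d (l + real n) = 0"
    proof (cases "phi1 l q z (l + real n) = 0 \<and> phi2 l q z (l + real n) = 0")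
      case True
      then show ?thesis using that[of "(1,0)"] by (auto simp: U_def zero_prod_def)
    next
      case False
      then show ?thesis using that[of "(phi2 l q z (l + real n), - phi1 l q z (l + real n))"]
        by (auto simp: U_def zero_prod_def mult.commute)
    qed
    define c where "c = (1 / norm d) *\<^sub>R d"
    have "c \<in> sphere 0 1" using d by (simp add: c_def)
    moreover have "U c x = (1 / norm d) *\<^sub>R U d x" for x by (simp add: c_def U_def scaleR_right_distrib)
    then have "E c (l + real n) = 0" using d by (simp add: E_def)
    ultimately show ?thesis by blast
  qed
  then obtain c where c: "\<And>n. c n \<in> sphere 0 1" "\<And>n. E (c n) (l + real n) = 0" by metis
  obtain c0 s where c0: "c0 \<in> sphere 0 (1::real)" "strict_mono s" "(c \<circ> s) \<longlonglongrightarrow> c0"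
    using compact_sphere[of "0 :: complex \<times> complex" 1] c(1) unfolding compact_def by blast
  have le: "E c0 b \<le> 0" if b: "b \<ge> l" for b
  proof (rule LIMSEQ_le_const2)
    have "(\<lambda>n. E ((c \<circ> s) n) b) \<longlonglongrightarrow> E c0 b"
      unfolding E_def U_def U'_def by (intro tendsto_intros c0)
    then show "(\<lambda>n. E ((c \<circ> s) n) b) \<longlonglongrightarrow> E c0 b" .
    obtain n0 :: nat where n0: "b - l \<le> real n0" using real_arch_simple by blast
    have "E ((c \<circ> s) n) b \<le> 0" if n: "n \<ge> n0" for n
    proof -
      have "real n0 \<le> real (s n)" using n seq_suble[OF c0(2), of n] by simp
      then have "E (c (s n)) b \<le> E (c (s n)) (l + real (s n))" using b n0 by (intro Emono) auto
      then show ?thesis using c(2) by simp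
    qed
    then show "\<exists>N. \<forall>n\<ge>N. E ((c \<circ> s) n) b \<le> 0" by blast
  qed
  have "sq_norm {l..b} (U c0) \<le> - E c0 l / (Im z)\<^sup>2" if b: "b \<ge> l" for b
    using E[OF b, of c0] le[OF b] z by (simp add: field_simps)
  then have "U c0 \<in> L2_half_line l"
    by (rule L2_of_bounded[OF regular_continuous(1)[OF Ur]])
  moreover have "U c0 \<noteq> (\<lambda>x. 0)"
  proof
    assume "U c0 = (\<lambda>x. 0)"
    then have "U c0 l = 0" "dif l (U c0) l = 0" using ode_solution_zero_iff[OF Us] by auto
    then have "c0 = 0" using Ud[of l c0] by (simp add: U_def U'_def phi1_solution phi2_solution prod_eq_iff)
    then show False using c0 by simp
  qed
  ultimately show ?thesis using that Us by blast
qed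

end

context limit_point
begin

lemma L2_inner_solution:
  assumes "ode_solution l q z f" "f \<in> L2_half_line l" "g \<in> L2_half_line l"
  shows "L2_inner l (diff_expr l q f) g = z * L2_inner l f g"
proof -
  have zf: "(\<lambda>x. z * f x) \<in> L2_half_line l"
    using sq_integrable_lincomb[of "{l..}" f f z 0] assms by (simp add: L2_iff)
  have "L2_inner l (diff_expr l q f) g = L2_inner l (\<lambda>x. z * f x) g"
    using L2_inner_cong_AE[OF ode_solution_diff_expr[OF assms(1)] zf assms(3)] by simp
  then show ?thesis using L2_inner_scale[OF assms(2,3)] by simp
qed

text \<open>Lagrange's identity for two eigenfunctions. With \<open>w = z\<close> and \<open>g = f\<close> it makes the norm of a square
integrable solution a function of its initial values, which gives uniqueness of the Weyl solution.\<close>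

lemma solution_inner:
  assumes f: "ode_solution l q z f" "f \<in> L2_half_line l" and g: "ode_solution l q w g" "g \<in> L2_half_line l"
  shows "(z - cnj w) * L2_inner l f g = dif l f l * cnj (g l) - f l * cnj (dif l g l)"
proof -
  have "L2_inner l f (diff_expr l q g) = cnj (w * L2_inner l g f)"
    using L2_inner_commute[of l f "diff_expr l q g"] L2_inner_solution[OF g f(2)] by simp
  also have "\<dots> = cnj w * L2_inner l f g" using L2_inner_commute[of l f g] by simp
  finally show ?thesis
    using Lagrange_half_line[OF ode_solution_D_star[OF f] ode_solution_D_star[OF g]] L2_inner_solution[OF f g(2)]
    by (simp add: left_diff_distrib)
qed

lemma D_star_zeroI:
  assumes f: "f \<in> D_star l q" and n: "sq_norm {l..} f = 0"
  shows "f = (\<lambda>x. 0)"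
proof
  fix x
  have r: "regular l f" and L: "f \<in> L2_half_line l" using f by (auto simp: D_star_def)
  show "f x = 0"
    using sq_norm_zero_imp_zero[OF L regular_continuous(1)[OF r] n, of x] r by (cases "x < l") (auto simp: regular_def)
qed

lemma L2_solution_zeroI:
  assumes z: "Im z \<noteq> 0" and f: "ode_solution l q z f" "f \<in> L2_half_line l" and 0: "f l = 0"
  shows "f = (\<lambda>x. 0)"
proof (rule D_star_zeroI[OF ode_solution_D_star[OF f]])
  have "z - cnj z \<noteq> 0" using z by (simp add: complex_eq_iff)
  then show "sq_norm {l..} f = 0" using solution_inner[OF f f] 0 by (simp add: L2_inner_self)
qed

definition weyl_solution :: "complex \<Rightarrow> real \<Rightarrow> complex" where
  "weyl_solution z x = phi2 l q z x + m_infinity l q z * phi1 l q z x"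

lemma weyl_solution_aux:
  fixes m :: complex
  shows "ode_solution l q z (\<lambda>x. phi2 l q z x + m * phi1 l q z x)"
    and "dif l (\<lambda>x. phi2 l q z x + m * phi1 l q z x) l = m"
proof -
  show "ode_solution l q z (\<lambda>x. phi2 l q z x + m * phi1 l q z x)"
    using ode_solution_lincomb[OF phi2_solution(1) phi1_solution(1), of z 1 m] by simp
  show "dif l (\<lambda>x. phi2 l q z x + m * phi1 l q z x) l = m"
    using regular_lincomb(2)[of l "phi2 l q z" "phi1 l q z" l 1 m] phi1_solution[of z] phi2_solution[of z]
    by (simp add: ode_solution_def)
qed

text \<open>The solution found by nested circles does not vanish at \<open>l\<close>, so it can be normalised to the value
\<open>-1\<close>; its derivative there is then the only coefficient for which the combination is square
integrable.\<close>

lemma weyl_solution: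
  assumes z: "Im z \<noteq> 0"
  shows "ode_solution l q z (weyl_solution z)" "weyl_solution z \<in> L2_half_line l" "weyl_solution z l = -1" "dif l (weyl_solution z) l = m_infinity l q z"
    and "weyl_solution z \<in> D_star l q" "regular l (weyl_solution z)"
proof -
  obtain u where u: "ode_solution l q z u" "u \<in> L2_half_line l" "u \<noteq> (\<lambda>x. 0)" using Weyl_nested[OF z] by blast
  have ul: "u l \<noteq> 0" using L2_solution_zeroI[OF z u(1,2)] u(3) by blast
  define v where "v x = (- 1 / u l) * u x + 0 * u x" for x
  have v: "ode_solution l q z v" unfolding v_def[abs_def] by (rule ode_solution_lincomb[OF u(1) u(1)])
  have vL: "v \<in> L2_half_line l" using u(2) unfolding v_def[abs_def] L2_iff by (intro sq_integrable_lincomb)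
  have "v = (\<lambda>x. phi2 l q z x + dif l v l * phi1 l q z x)"
    by (rule ode_solution_unique[OF v weyl_solution_aux(1)])
       (use ul in \<open>simp_all only: weyl_solution_aux(2), simp_all add: v_def phi1_solution phi2_solution\<close>)
  then have ex: "(\<lambda>x. phi2 l q z x + dif l v l * phi1 l q z x) \<in> L2_half_line l" using vL by simp
  have un: "m1 = m2" if m: "(\<lambda>x. phi2 l q z x + m1 * phi1 l q z x) \<in> L2_half_line l"
      "(\<lambda>x. phi2 l q z x + m2 * phi1 l q z x) \<in> L2_half_line l" for m1 m2
  proof -
    define d where "d x = (phi2 l q z x + m1 * phi1 l q z x) + (-1) * (phi2 l q z x + m2 * phi1 l q z x)" for x
    have ds: "ode_solution l q z d"
      unfolding d_def[abs_def] using ode_solution_lincomb[OF weyl_solution_aux(1) weyl_solution_aux(1), of z 1 m1 "-1" m2] by simp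
    have "d \<in> L2_half_line l"
      using m sq_integrable_lincomb[of "{l..}" _ _ 1 "-1"] unfolding d_def[abs_def] L2_iff by fastforce
    then have d0: "d = (\<lambda>x. 0)" by (rule L2_solution_zeroI[OF z ds]) (simp add: d_def phi1_solution)
    have "(m1 - m2) * phi1 l q z x = 0" for x
    proof -
      have "(m1 - m2) * phi1 l q z x = d x" by (simp add: d_def algebra_simps)
      then show ?thesis using d0 by simp
    qed
    moreover obtain x where "phi1 l q z x \<noteq> 0"
      using ode_solution_zero_iff[OF phi1_solution(1)] phi1_solution(3)[of z] by (metis zero_neq_one)
    ultimately show ?thesis by (metis mult_eq_0_iff right_minus_eq)
  qed
  have "(\<lambda>x. phi2 l q z x + m_infinity l q z * phi1 l q z x) \<in> L2_half_line l"
    unfolding m_infinity_def by (rule theI[of _ "dif l v l"]) (use ex un in auto)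
  then show L: "weyl_solution z \<in> L2_half_line l" by (simp add: weyl_solution_def[abs_def])
  show s: "ode_solution l q z (weyl_solution z)" "dif l (weyl_solution z) l = m_infinity l q z"
    using weyl_solution_aux by (auto simp: weyl_solution_def[abs_def])
  show "weyl_solution z l = -1" by (simp add: weyl_solution_def phi1_solution phi2_solution)
  show "weyl_solution z \<in> D_star l q" by (rule ode_solution_D_star[OF s(1) L])
  show "regular l (weyl_solution z)" using s by (simp add: ode_solution_def)
qed

abbreviation "minf \<equiv> m_infinity l q"

lemma weyl_solution_inner:
  assumes "Im z \<noteq> 0" "Im w \<noteq> 0"
  shows "(z - cnj w) * L2_inner l (weyl_solution z) (weyl_solution w) = cnj (minf w) - minf z"
  using solution_inner[OF weyl_solution(1,2)[OF assms(1)] weyl_solution(1,2)[OF assms(2)]] weyl_solution(3,4)[OF assms(1)] weyl_solution(3,4)[OF assms(2)] by simp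

text \<open>The conjugate of the Weyl solution is a square integrable solution for \<open>cnj z\<close> with the same value
at \<open>l\<close>.\<close>

lemma minf_cnj:
  assumes z: "Im z \<noteq> 0"
  shows "minf (cnj z) = cnj (minf z)"
proof -
  have z': "Im (cnj z) \<noteq> 0" using z by simp
  define d where "d x = 1 * cnj (weyl_solution z x) + (-1) * weyl_solution (cnj z) x" for x
  have c: "ode_solution l q (cnj z) (\<lambda>x. cnj (weyl_solution z x))" by (rule ode_solution_cnj[OF weyl_solution(1)[OF z]])
  have ds: "ode_solution l q (cnj z) d"
    unfolding d_def[abs_def] by (rule ode_solution_lincomb[OF c weyl_solution(1)[OF z']])
  have "d \<in> L2_half_line l"
    using weyl_solution(2)[OF z] weyl_solution(2)[OF z'] unfolding d_def[abs_def] L2_iff by (intro sq_integrable_lincomb) (auto simp: sq_integrable_cnj)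
  then have "d = (\<lambda>x. 0)" by (rule L2_solution_zeroI[OF z' ds]) (simp add: d_def weyl_solution(3)[OF z] weyl_solution(3)[OF z'])
  then have "dif l d l = 0" using ode_solution_zero_iff[OF ds] by blast
  moreover have "dif l d l = cnj (minf z) - minf (cnj z)"
    using regular_lincomb(2)[OF regular_cnj(1)[OF weyl_solution(6)[OF z]] weyl_solution(6)[OF z'], of l 1 "-1"]
      regular_cnj(2)[OF weyl_solution(6)[OF z], of l] weyl_solution(4)[OF z] weyl_solution(4)[OF z'] by (simp add: d_def[abs_def])
  ultimately show ?thesis by simp
qed

lemma Im_minf:
  assumes z: "Im z \<noteq> 0"
  shows "Im z * sq_norm {l..} (weyl_solution z) = - Im (minf z)" "sq_norm {l..} (weyl_solution z) > 0"
proof -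
  have "(z - cnj z) * of_real (sq_norm {l..} (weyl_solution z)) = cnj (minf z) - minf z"
    using weyl_solution_inner[OF z z] by (simp add: L2_inner_self)
  then show "Im z * sq_norm {l..} (weyl_solution z) = - Im (minf z)" by (simp add: complex_eq_iff)
  have "sq_norm {l..} (weyl_solution z) \<noteq> 0" using D_star_zeroI[OF weyl_solution(5)[OF z]] weyl_solution(3)[OF z] by auto
  then show "sq_norm {l..} (weyl_solution z) > 0" using sq_norm_nonneg[of "{l..}" "weyl_solution z"] by linarith
qed

lemma Im_minf_nonzero: "Im z \<noteq> 0 \<Longrightarrow> Im (minf z) \<noteq> 0"
  using Im_minf[of z] by auto

lemma Im_minf_i: "Im (minf \<i>) < 0"
  using Im_minf[of \<i>] by simp

end

section \<open>Transfer and impedance functions in terms of the Weyl function\<close>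

text \<open>Systems with a finite and with an infinite parameter have the same shape, built on the functional
\<open>\<mu> \<delta> + \<delta>'\<close>, respectively \<open>\<delta>\<close>. With the weights \<open>(\<mu>, 1)\<close>, respectively \<open>(1, 0)\<close>, for the value and the slope
at \<open>l\<close> both cases are treated at once.\<close>

fun value_weight :: "ext_real_param \<Rightarrow> real" where "value_weight (Fin \<mu>) = \<mu>" | "value_weight Infty = 1"
fun slope_weight :: "ext_real_param \<Rightarrow> real" where "slope_weight (Fin \<mu>) = 1" | "slope_weight Infty = 0"

definition boundary_value :: "real \<Rightarrow> ext_real_param \<Rightarrow> (real \<Rightarrow> complex) \<Rightarrow> complex" where
  "boundary_value l \<mu> f = of_real (value_weight \<mu>) * f l - of_real (slope_weight \<mu>) * dif l f l"

text \<open>The boundary functional of a function with \<open>f l = 1\<close> and \<open>f' l = h\<close>; it is \<open>\<mu> - h\<close>, respectively \<open>1\<close>.\<close>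

definition slope_value :: "ext_real_param \<Rightarrow> complex \<Rightarrow> complex" where
  "slope_value \<mu> h = of_real (value_weight \<mu>) - of_real (slope_weight \<mu>) * h"

definition channel_scale :: "ext_real_param \<Rightarrow> complex \<Rightarrow> real" where
  "channel_scale \<mu> h = sqrt (Im h) / cmod (slope_value \<mu> h)"

lemma weights_normalised: "slope_weight \<mu> = 0 \<Longrightarrow> value_weight \<mu> = 1" "slope_weight \<mu> = 0 \<or> slope_weight \<mu> = 1"
  by (cases \<mu>; simp)+

lemma slope_value_nonzero: "Im h \<noteq> 0 \<Longrightarrow> slope_value \<mu> h \<noteq> 0"
  by (cases \<mu>) (auto simp: slope_value_def complex_eq_iff)

lemma cnj_slope_value: "cnj (slope_value \<mu> h) = slope_value \<mu> (cnj h)"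
  by (simp add: slope_value_def)

lemma channel_scale_square: "Im h > 0 \<Longrightarrow> complex_of_real (channel_scale \<mu> h) * of_real (channel_scale \<mu> h) = of_real (Im h) / (slope_value \<mu> h * slope_value \<mu> (cnj h))"
proof -
  assume h: "Im h > 0"
  have 1: "of_real ((cmod (slope_value \<mu> h))\<^sup>2) = slope_value \<mu> h * slope_value \<mu> (cnj h)" by (simp only: cnj_slope_value[symmetric] complex_norm_square)
  have 2: "channel_scale \<mu> h * channel_scale \<mu> h = Im h / (cmod (slope_value \<mu> h))\<^sup>2"
    using h by (simp add: channel_scale_def power2_eq_square)
  have "complex_of_real (channel_scale \<mu> h) * of_real (channel_scale \<mu> h) = of_real (Im h / (cmod (slope_value \<mu> h))\<^sup>2)"
    unfolding 2[symmetric] by (rule of_real_mult[symmetric])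
  also have "\<dots> = of_real (Im h) / of_real ((cmod (slope_value \<mu> h))\<^sup>2)" by (rule of_real_divide)
  finally show ?thesis unfolding 1 .
qed

lemma state_space_op_eq:
  "state_space_op l q \<mu> h y f =
     L2_inner l (diff_expr l q y) f - (dif l y l - h * y l) / slope_value \<mu> h * cnj (boundary_value l \<mu> f)"
  by (cases \<mu>) (simp_all add: delta_def delta'_def slope_value_def boundary_value_def)

lemma channel_vector_eq: "channel_vector l \<mu> h f = of_real (channel_scale \<mu> h) * cnj (boundary_value l \<mu> f)"
  by (cases \<mu>) (simp_all add: delta_def delta'_def slope_value_def boundary_value_def channel_scale_def)

lemma resolvent_eqI:
  assumes "y \<in> D_star l q" "\<And>f. f \<in> D_star l q \<Longrightarrow> A y f - z * L2_inner l y f = \<psi> f"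
    and "\<And>w. w \<in> D_star l q \<Longrightarrow> (\<And>f. f \<in> D_star l q \<Longrightarrow> A w f - z * L2_inner l w f = \<psi> f) \<Longrightarrow> w = y"
  shows "resolvent (schroedinger_system l q \<mu> h) A z \<psi> = y"
  unfolding resolvent_def schroedinger_system_def l_system.select_convs
proof (rule the_equality)
  show "y \<in> D_star l q \<and> (\<forall>f\<in>D_star l q. A y f - z * L2_inner l y f = \<psi> f)"
    using assms(1,2) by blast
  fix w assume "w \<in> D_star l q \<and> (\<forall>f\<in>D_star l q. A w f - z * L2_inner l w f = \<psi> f)"
  then show "w = y" by (intro assms(3)) blast+
qed

context limit_point
begin

lemma D_star_diff:
  fixes d y w :: "real \<Rightarrow> complex"
  assumes "w \<in> D_star l q" "y \<in> D_star l q" and d_def: "d = (\<lambda>x. 1 * w x + (-1) * y x)"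
  shows "d \<in> D_star l q" "d l = w l - y l" "dif l d l = dif l w l - dif l y l"
    "\<And>f. f \<in> D_star l q \<Longrightarrow> L2_inner l d f = L2_inner l w f - L2_inner l y f"
    "\<And>f. f \<in> D_star l q \<Longrightarrow> L2_inner l (diff_expr l q d) f = L2_inner l (diff_expr l q w) f - L2_inner l (diff_expr l q y) f"
proof -
  have r: "regular l w" "regular l y" and L: "w \<in> L2_half_line l" "y \<in> L2_half_line l"
    "diff_expr l q w \<in> L2_half_line l" "diff_expr l q y \<in> L2_half_line l"
    using assms by (auto simp: D_star_def)
  show "d \<in> D_star l q" unfolding d_def by (rule D_star_lincomb[OF assms(1,2)])
  show "d l = w l - y l" by (simp add: d_def)
  show "dif l d l = dif l w l - dif l y l" using regular_lincomb(2)[OF r, of l 1 "-1"] by (simp add: d_def)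
  fix f assume "f \<in> D_star l q"
  then have f: "f \<in> L2_half_line l" by (simp add: D_star_def)
  show "L2_inner l d f = L2_inner l w f - L2_inner l y f"
    using L2_inner_lincomb[OF L(1,2) f, of 1 "-1"] by (simp add: d_def)
  have "(\<lambda>x. 1 * diff_expr l q w x + (-1) * diff_expr l q y x) \<in> L2_half_line l"
    using L unfolding L2_iff by (intro sq_integrable_lincomb)
  then have "L2_inner l (diff_expr l q d) f = L2_inner l (\<lambda>x. 1 * diff_expr l q w x + (-1) * diff_expr l q y x) f"
    using L2_inner_cong_AE[OF diff_expr_lincomb_AE[OF r, of 1 q "-1"] _ f] by (simp add: d_def)
  then show "L2_inner l (diff_expr l q d) f = L2_inner l (diff_expr l q w) f - L2_inner l (diff_expr l q y) f"
    using L2_inner_lincomb[OF L(3,4) f, of 1 "-1"] by simp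
qed

text \<open>Lagrange's identity turns the adjoint into the same differential expression with \<open>h\<close> replaced by
\<open>cnj h\<close>: the boundary terms recombine to a multiple of the same boundary functional.\<close>

lemma op_re_eq:
  assumes h: "Im h \<noteq> 0" and y: "y \<in> D_star l q" and f: "f \<in> D_star l q"
  shows "op_re (state_space_op l q \<mu> h) y f = L2_inner l (diff_expr l q y) f
     - ((dif l y l - h * y l) / slope_value \<mu> h + (dif l y l - cnj h * y l) / slope_value \<mu> (cnj h)) / 2 * cnj (boundary_value l \<mu> f)"
proof -
  have nz: "slope_value \<mu> h \<noteq> 0" "slope_value \<mu> (cnj h) \<noteq> 0" using h slope_value_nonzero[of h \<mu>] slope_value_nonzero[of "cnj h" \<mu>] by auto
  define T where "T = (dif l y l - h * y l) / slope_value \<mu> h"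
  define T' where "T' = (dif l y l - cnj h * y l) / slope_value \<mu> (cnj h)"
  have "cnj (L2_inner l (diff_expr l q f) y) = L2_inner l (diff_expr l q y) f - (dif l y l * cnj (f l) - y l * cnj (dif l f l))"
    using Lagrange_half_line[OF y f] unfolding L2_inner_commute[of l y "diff_expr l q f"]
    by (metis diff_diff_eq2 add_diff_cancel_left')
  then have "cnj (state_space_op l q \<mu> h f y) =
     L2_inner l (diff_expr l q y) f - (dif l y l * cnj (f l) - y l * cnj (dif l f l)
       + (cnj (dif l f l) - cnj h * cnj (f l)) / slope_value \<mu> (cnj h) * boundary_value l \<mu> y)"
    by (simp add: state_space_op_eq cnj_slope_value)
  also have "dif l y l * cnj (f l) - y l * cnj (dif l f l)
       + (cnj (dif l f l) - cnj h * cnj (f l)) / slope_value \<mu> (cnj h) * boundary_value l \<mu> y = T' * cnj (boundary_value l \<mu> f)"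
  proof -
    have "(dif l y l * cnj (f l) - y l * cnj (dif l f l)) * slope_value \<mu> (cnj h)
       + (cnj (dif l f l) - cnj h * cnj (f l)) * boundary_value l \<mu> y = (dif l y l - cnj h * y l) * cnj (boundary_value l \<mu> f)"
      by (simp add: boundary_value_def slope_value_def algebra_simps)
    then show ?thesis unfolding T'_def using nz(2) by (simp add: field_simps)
  qed
  finally have e: "cnj (state_space_op l q \<mu> h f y) = L2_inner l (diff_expr l q y) f - T' * cnj (boundary_value l \<mu> f)" .
  show ?thesis
    unfolding op_re_def op_adjoint_def e T_def[symmetric] T'_def[symmetric] state_space_op_eq[of l q \<mu> h y f]
    by (simp add: field_simps)
qed

text \<open>The identity \<open>Im A = K K\<^sup>*\<close>, tested on the diagonal.\<close>

lemma state_space_op_diagonal: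
  assumes h: "Im h > 0" and d: "d \<in> D_star l q"
  shows "state_space_op l q \<mu> h d d = op_re (state_space_op l q \<mu> h) d d + \<i> * of_real ((channel_scale \<mu> h)\<^sup>2 * (cmod (boundary_value l \<mu> d))\<^sup>2)"
proof -
  have h': "Im h \<noteq> 0" using h by simp
  have nz: "slope_value \<mu> h \<noteq> 0" "slope_value \<mu> (cnj h) \<noteq> 0" using h slope_value_nonzero[of h \<mu>] slope_value_nonzero[of "cnj h" \<mu>] by auto
  define T where "T = (dif l d l - h * d l) / slope_value \<mu> h"
  define T' where "T' = (dif l d l - cnj h * d l) / slope_value \<mu> (cnj h)"
  have hc: "2 * \<i> * complex_of_real (Im h) = h - cnj h" by (simp add: complex_eq_iff)
  have "T' - T = 2 * \<i> * of_real (Im h) * boundary_value l \<mu> d / (slope_value \<mu> h * slope_value \<mu> (cnj h))"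
  proof -
    have "(dif l d l - cnj h * d l) * slope_value \<mu> h - (dif l d l - h * d l) * slope_value \<mu> (cnj h) = 2 * \<i> * of_real (Im h) * boundary_value l \<mu> d"
      unfolding hc by (simp add: boundary_value_def slope_value_def algebra_simps)
    then show ?thesis unfolding T_def T'_def using nz by (simp add: divide_simps mult.commute)
  qed
  also have "\<dots> = 2 * (\<i> * of_real (channel_scale \<mu> h) * of_real (channel_scale \<mu> h) * boundary_value l \<mu> d)"
    using channel_scale_square[OF h, of \<mu>] by (simp add: mult.assoc)
  finally have TT: "(T' - T) / 2 = \<i> * of_real (channel_scale \<mu> h) * of_real (channel_scale \<mu> h) * boundary_value l \<mu> d" by simp
  have "state_space_op l q \<mu> h d d - op_re (state_space_op l q \<mu> h) d d = (T' - T) / 2 * cnj (boundary_value l \<mu> d)"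
    unfolding op_re_eq[OF h' d d] state_space_op_eq T_def[symmetric] T'_def[symmetric] by (simp add: field_simps)
  also have "\<dots> = \<i> * of_real ((channel_scale \<mu> h)\<^sup>2) * (boundary_value l \<mu> d * cnj (boundary_value l \<mu> d))"
    unfolding TT by (simp add: power2_eq_square)
  also have "boundary_value l \<mu> d * cnj (boundary_value l \<mu> d) = of_real ((cmod (boundary_value l \<mu> d))\<^sup>2)" by (simp only: complex_norm_square)
  finally show ?thesis by (simp add: algebra_simps)
qed

lemma Im_op_re_diagonal: "Im (op_re A d d) = 0"
  by (simp add: op_re_def op_adjoint_def)

text \<open>Test the difference of two preimages against itself: the form of the real part is real there, while
\<open>z\<close> times the square of the norm is not, unless the norm is zero.\<close>

lemma op_re_minus_unique:
  assumes h: "Im h \<noteq> 0" and z: "Im z \<noteq> 0" and w: "w \<in> D_star l q" and y: "y \<in> D_star l q"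
    and eq: "\<And>f. f \<in> D_star l q \<Longrightarrow> op_re (state_space_op l q \<mu> h) w f - z * L2_inner l w f =
        op_re (state_space_op l q \<mu> h) y f - z * L2_inner l y f"
  shows "w = y"
proof -
  define d where "d = (\<lambda>x. 1 * w x + (-1) * y x)"
  note D = D_star_diff[OF w y d_def]
  have "op_re (state_space_op l q \<mu> h) d d = z * L2_inner l d d"
    using eq[OF D(1)] unfolding op_re_eq[OF h w D(1)] op_re_eq[OF h y D(1)] op_re_eq[OF h D(1) D(1)] D(2-3) D(4)[OF D(1)] D(5)[OF D(1)]
    by (simp add: diff_divide_distrib add_divide_distrib algebra_simps)
  then have "Im (z * of_real (sq_norm {l..} d)) = 0"
    using Im_op_re_diagonal[of "state_space_op l q \<mu> h" d] by (simp only: L2_inner_self)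
  then have "sq_norm {l..} d = 0" using z by simp
  then have "d x = 0" for x using D_star_zeroI[OF D(1)] by (simp add: fun_eq_iff)
  then show ?thesis by (simp add: d_def fun_eq_iff)
qed

text \<open>The same test; now the form has non-negative imaginary part, so that uniqueness holds in the lower half-plane.\<close>

lemma state_space_op_minus_unique:
  assumes h: "Im h > 0" and z: "Im z < 0" and w: "w \<in> D_star l q" and y: "y \<in> D_star l q"
    and eq: "\<And>f. f \<in> D_star l q \<Longrightarrow> state_space_op l q \<mu> h w f - z * L2_inner l w f =
        state_space_op l q \<mu> h y f - z * L2_inner l y f"
  shows "w = y"
proof -
  define d where "d = (\<lambda>x. 1 * w x + (-1) * y x)"
  note D = D_star_diff[OF w y d_def]
  have "state_space_op l q \<mu> h d d = z * L2_inner l d d"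
    using eq[OF D(1)] unfolding state_space_op_eq D(2-3) D(4)[OF D(1)] D(5)[OF D(1)]
    by (simp add: diff_divide_distrib add_divide_distrib algebra_simps)
  then have "Im (z * of_real (sq_norm {l..} d)) =
      Im (op_re (state_space_op l q \<mu> h) d d + \<i> * of_real ((channel_scale \<mu> h)\<^sup>2 * (cmod (boundary_value l \<mu> d))\<^sup>2))"
    using state_space_op_diagonal[OF h D(1), of \<mu>] by (simp only: L2_inner_self)
  also have "\<dots> = (channel_scale \<mu> h)\<^sup>2 * (cmod (boundary_value l \<mu> d))\<^sup>2"
    unfolding plus_complex.sel Im_op_re_diagonal by (simp only: Im_i_times Re_complex_of_real add_0)
  finally have "Im z * sq_norm {l..} d = (channel_scale \<mu> h)\<^sup>2 * (cmod (boundary_value l \<mu> d))\<^sup>2" by simp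
  then have "Im z * sq_norm {l..} d \<ge> 0" by simp
  then have "sq_norm {l..} d = 0" using z sq_norm_nonneg[of "{l..}" d] by (simp add: zero_le_mult_iff)
  then have "d x = 0" for x using D_star_zeroI[OF D(1)] by (simp add: fun_eq_iff)
  then show ?thesis by (simp add: d_def fun_eq_iff)
qed

definition weyl_multiple :: "complex \<Rightarrow> complex \<Rightarrow> real \<Rightarrow> complex" where
  "weyl_multiple c z x = c * weyl_solution z x"

lemma weyl_multiple:
  assumes z: "Im z \<noteq> 0"
  shows "weyl_multiple c z \<in> D_star l q" "weyl_multiple c z l = - c" "dif l (weyl_multiple c z) l = c * minf z"
    "\<And>f. f \<in> L2_half_line l \<Longrightarrow> L2_inner l (diff_expr l q (weyl_multiple c z)) f = z * L2_inner l (weyl_multiple c z) f"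
    "ode_solution l q z (weyl_multiple c z)"
    "boundary_value l \<mu> (weyl_multiple c z) = - c * (of_real (value_weight \<mu>) + of_real (slope_weight \<mu>) * minf z)"
proof -
  have e: "weyl_multiple c z = (\<lambda>x. c * weyl_solution z x + 0 * weyl_solution z x)" by (simp add: weyl_multiple_def[abs_def])
  show o: "ode_solution l q z (weyl_multiple c z)" unfolding e by (intro ode_solution_lincomb weyl_solution z)
  show D: "weyl_multiple c z \<in> D_star l q" unfolding e by (intro D_star_lincomb weyl_solution z)
  show v: "weyl_multiple c z l = - c" by (simp add: weyl_multiple_def weyl_solution(3)[OF z])
  show dv: "dif l (weyl_multiple c z) l = c * minf z"
    unfolding e using regular_lincomb(2)[OF weyl_solution(6)[OF z] weyl_solution(6)[OF z], of l c 0] weyl_solution(4)[OF z] by simp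
  show "L2_inner l (diff_expr l q (weyl_multiple c z)) f = z * L2_inner l (weyl_multiple c z) f" if "f \<in> L2_half_line l" for f
    using L2_inner_solution[OF o _ that] D by (auto simp: D_star_def)
  show "boundary_value l \<mu> (weyl_multiple c z) = - c * (of_real (value_weight \<mu>) + of_real (slope_weight \<mu>) * minf z)"
    by (simp add: boundary_value_def v dv algebra_simps)
qed

definition impedance_denominator :: "ext_real_param \<Rightarrow> complex \<Rightarrow> complex \<Rightarrow> complex" where
  "impedance_denominator \<mu> h m = of_real (value_weight \<mu> - slope_weight \<mu> * Re h) * m + of_real (value_weight \<mu> * Re h - slope_weight \<mu> * (cmod h)\<^sup>2)"

text \<open>The coefficients are real, so at a zero with non-real \<open>m\<close> both of them vanish. The first one then
gives \<open>\<mu> = Re h\<close>, which makes the second one \<open>- (Im h)\<^sup>2\<close>.\<close>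

lemma impedance_denominator_nonzero:
  assumes "Im h \<noteq> 0" "Im m \<noteq> 0"
  shows "impedance_denominator \<mu> h m \<noteq> 0"
proof
  assume D: "impedance_denominator \<mu> h m = 0"
  then have "(value_weight \<mu> - slope_weight \<mu> * Re h) * Im m = 0" by (simp add: impedance_denominator_def complex_eq_iff)
  then have a: "value_weight \<mu> = slope_weight \<mu> * Re h" using assms by simp
  then have b: "slope_weight \<mu> = 1" using weights_normalised[of \<mu>] by auto
  have "value_weight \<mu> * Re h - slope_weight \<mu> * (cmod h)\<^sup>2 = 0" using D a by (simp add: impedance_denominator_def complex_eq_iff)
  moreover have "(cmod h)\<^sup>2 = Re h * Re h + Im h * Im h"
    using cmod_power2[of h] by (simp add: power2_eq_square)
  ultimately have "Im h * Im h = 0" unfolding a b by simp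
  then show False using assms by simp
qed

lemma impedance_denominator_eq:
  "(m + h) * slope_value \<mu> (cnj h) + (m + cnj h) * slope_value \<mu> h = 2 * impedance_denominator \<mu> h m"
proof -
  have hh: "h + cnj h = 2 * of_real (Re h)" by (simp add: complex_eq_iff)
  have hn: "h * cnj h = of_real ((cmod h)\<^sup>2)" by (simp only: complex_norm_square)
  have "(m + h) * slope_value \<mu> (cnj h) + (m + cnj h) * slope_value \<mu> h =
      of_real (value_weight \<mu>) * (2 * m) - of_real (slope_weight \<mu>) * m * (h + cnj h) + of_real (value_weight \<mu>) * (h + cnj h) - 2 * of_real (slope_weight \<mu>) * (h * cnj h)"
    by (simp add: slope_value_def algebra_simps)
  also have "\<dots> = 2 * impedance_denominator \<mu> h m" unfolding hh hn by (simp add: impedance_denominator_def algebra_simps)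
  finally show ?thesis .
qed

text \<open>For a multiple \<open>y\<close> of the Weyl solution \<open>diff_expr l q y = z y\<close>, so that the resolvent equation
reduces to its boundary terms. Comparing the coefficients of the boundary functional gives the
factor.\<close>

lemma impedance_formula:
  assumes h: "Im h > 0" and z: "Im z \<noteq> 0"
  shows "impedance_function (schroedinger_system l q \<mu> h) z =
    of_real (Im h) * (of_real (value_weight \<mu>) + of_real (slope_weight \<mu>) * minf z) / impedance_denominator \<mu> h (minf z)"
proof -
  have h': "Im h \<noteq> 0" using h by simp
  have nz: "slope_value \<mu> h \<noteq> 0" "slope_value \<mu> (cnj h) \<noteq> 0" "impedance_denominator \<mu> h (minf z) \<noteq> 0"
    using h impedance_denominator_nonzero[OF h' Im_minf_nonzero[OF z]] slope_value_nonzero[of h \<mu>] slope_value_nonzero[of "cnj h" \<mu>] by auto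
  define c where "c = - of_real (channel_scale \<mu> h) * (slope_value \<mu> h * slope_value \<mu> (cnj h)) / impedance_denominator \<mu> h (minf z)"
  note C = weyl_multiple[OF z, where c=c]
  have sol: "op_re (state_space_op l q \<mu> h) (weyl_multiple c z) f - z * L2_inner l (weyl_multiple c z) f = 1 * channel_vector l \<mu> h f"
    if f: "f \<in> D_star l q" for f
  proof -
    have "((dif l (weyl_multiple c z) l - h * weyl_multiple c z l) / slope_value \<mu> h + (dif l (weyl_multiple c z) l - cnj h * weyl_multiple c z l) / slope_value \<mu> (cnj h)) / 2
        = c * ((minf z + h) * slope_value \<mu> (cnj h) + (minf z + cnj h) * slope_value \<mu> h) / (2 * (slope_value \<mu> h * slope_value \<mu> (cnj h)))"
      unfolding C(2,3) using nz by (simp add: field_simps)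
    also have "\<dots> = - of_real (channel_scale \<mu> h)" unfolding impedance_denominator_eq c_def using nz by (simp add: field_simps)
    finally have S: "((dif l (weyl_multiple c z) l - h * weyl_multiple c z l) / slope_value \<mu> h + (dif l (weyl_multiple c z) l - cnj h * weyl_multiple c z l) / slope_value \<mu> (cnj h)) / 2
        = - of_real (channel_scale \<mu> h)" .
    show ?thesis
      unfolding op_re_eq[OF h' C(1) f] S channel_vector_eq using C(4)[of f] f by (simp add: D_star_def)
  qed
  have "resolvent (schroedinger_system l q \<mu> h) (op_re (state_space_op l q \<mu> h)) z (\<lambda>f. 1 * channel_vector l \<mu> h f) = weyl_multiple c z"
  proof (rule resolvent_eqI[OF C(1)])
    fix w assume w: "w \<in> D_star l q" and eq: "\<And>f. f \<in> D_star l q \<Longrightarrow>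
      op_re (state_space_op l q \<mu> h) w f - z * L2_inner l w f = 1 * channel_vector l \<mu> h f"
    show "w = weyl_multiple c z"
      by (rule op_re_minus_unique[OF h' z w C(1), of \<mu>]) (simp only: eq sol)
  qed (rule sol)
  then have "impedance_function (schroedinger_system l q \<mu> h) z = cnj (channel_vector l \<mu> h (weyl_multiple c z))"
    by (simp add: impedance_function_def channel_adjoint_def schroedinger_system_def)
  also have "\<dots> = (of_real (channel_scale \<mu> h) * of_real (channel_scale \<mu> h)) * (slope_value \<mu> h * slope_value \<mu> (cnj h)) * (of_real (value_weight \<mu>) + of_real (slope_weight \<mu>) * minf z) / impedance_denominator \<mu> h (minf z)"
    unfolding channel_vector_eq C(6) unfolding c_def by (simp add: field_simps)
  also have "\<dots> = of_real (Im h) * (of_real (value_weight \<mu>) + of_real (slope_weight \<mu>) * minf z) / impedance_denominator \<mu> h (minf z)"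
    unfolding channel_scale_square[OF h] using nz by simp
  finally show ?thesis .
qed

text \<open>As for the impedance function, with the boundary condition of the state-space operator itself. Only
the lower half-plane is covered, which contains the point \<open>-\<i>\<close> that the entropy refers to.\<close>

lemma transfer_formula:
  assumes h: "Im h > 0" and z: "Im z < 0"
  shows "transfer_function (schroedinger_system l q \<mu> h) z = slope_value \<mu> h / slope_value \<mu> (cnj h) * ((minf z + cnj h) / (minf z + h))"
proof -
  have h': "Im h \<noteq> 0" and z': "Im z \<noteq> 0" using h z by auto
  have "Im (minf z) > 0"
    using Im_minf[OF z'] z by (metis mult_neg_pos neg_0_less_iff_less neg_less_0_iff_less minus_minus)
  then have "Im (minf z + h) > 0" using h by simp
  then have mh: "minf z + h \<noteq> 0" by (metis order_less_irrefl zero_complex.sel(2))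
  have nz: "slope_value \<mu> h \<noteq> 0" "slope_value \<mu> (cnj h) \<noteq> 0" using h slope_value_nonzero[of h \<mu>] slope_value_nonzero[of "cnj h" \<mu>] by auto
  define c where "c = - of_real (channel_scale \<mu> h) * slope_value \<mu> h / (minf z + h)"
  note C = weyl_multiple[OF z', where c=c]
  have sol: "state_space_op l q \<mu> h (weyl_multiple c z) f - z * L2_inner l (weyl_multiple c z) f = 1 * channel_vector l \<mu> h f"
    if f: "f \<in> D_star l q" for f
  proof -
    have "(dif l (weyl_multiple c z) l - h * weyl_multiple c z l) / slope_value \<mu> h = c * (minf z + h) / slope_value \<mu> h"
      unfolding C(2,3) by (simp add: algebra_simps)
    also have "\<dots> = - of_real (channel_scale \<mu> h)" unfolding c_def using nz mh by simp
    finally have S: "(dif l (weyl_multiple c z) l - h * weyl_multiple c z l) / slope_value \<mu> h = - of_real (channel_scale \<mu> h)" .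
    show ?thesis
      unfolding state_space_op_eq S channel_vector_eq using C(4)[of f] f by (simp add: D_star_def)
  qed
  have "resolvent (schroedinger_system l q \<mu> h) (state_space_op l q \<mu> h) z (\<lambda>f. 1 * channel_vector l \<mu> h f) = weyl_multiple c z"
  proof (rule resolvent_eqI[OF C(1)])
    fix w assume w: "w \<in> D_star l q" and eq: "\<And>f. f \<in> D_star l q \<Longrightarrow>
      state_space_op l q \<mu> h w f - z * L2_inner l w f = 1 * channel_vector l \<mu> h f"
    show "w = weyl_multiple c z"
      by (rule state_space_op_minus_unique[OF h z w C(1), of \<mu>]) (simp only: eq sol)
  qed (rule sol)
  then have "transfer_function (schroedinger_system l q \<mu> h) z = 1 - 2 * \<i> * cnj (channel_vector l \<mu> h (weyl_multiple c z))"
    by (simp add: transfer_function_def channel_adjoint_def schroedinger_system_def)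
  also have "cnj (channel_vector l \<mu> h (weyl_multiple c z)) = (of_real (channel_scale \<mu> h) * of_real (channel_scale \<mu> h)) * slope_value \<mu> h * (of_real (value_weight \<mu>) + of_real (slope_weight \<mu>) * minf z) / (minf z + h)"
    unfolding channel_vector_eq C(6) unfolding c_def by (simp add: field_simps)
  also have "\<dots> = of_real (Im h) * (of_real (value_weight \<mu>) + of_real (slope_weight \<mu>) * minf z) / (slope_value \<mu> (cnj h) * (minf z + h))"
    unfolding channel_scale_square[OF h] using nz by simp
  finally have "transfer_function (schroedinger_system l q \<mu> h) z =
      1 - 2 * \<i> * of_real (Im h) * (of_real (value_weight \<mu>) + of_real (slope_weight \<mu>) * minf z) / (slope_value \<mu> (cnj h) * (minf z + h))"
    by (simp add: mult.assoc)
  also have "2 * \<i> * complex_of_real (Im h) = h - cnj h" by (simp add: complex_eq_iff)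
  also have "1 - (h - cnj h) * (of_real (value_weight \<mu>) + of_real (slope_weight \<mu>) * minf z) / (slope_value \<mu> (cnj h) * (minf z + h))
     = (slope_value \<mu> (cnj h) * (minf z + h) - (h - cnj h) * (of_real (value_weight \<mu>) + of_real (slope_weight \<mu>) * minf z)) / (slope_value \<mu> (cnj h) * (minf z + h))"
    using nz mh by (simp add: diff_divide_distrib)
  also have "slope_value \<mu> (cnj h) * (minf z + h) - (h - cnj h) * (of_real (value_weight \<mu>) + of_real (slope_weight \<mu>) * minf z) = slope_value \<mu> h * (minf z + cnj h)"
    by (simp add: slope_value_def algebra_simps)
  finally show ?thesis by simp
qed

text \<open>The factor that contains \<open>\<mu>\<close> is a quotient of conjugates and has modulus one, so that the entropy depends on \<open>h\<close>
alone.\<close>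

lemma c_entropy_formula:
  assumes h: "Im h > 0" and ne: "minf \<i> + h \<noteq> 0"
  shows "c_entropy (schroedinger_system l q \<mu> h) = ereal (- ln (cmod (minf \<i> + h) / cmod (minf \<i> + cnj h)))"
proof -
  have nz: "slope_value \<mu> h \<noteq> 0" "slope_value \<mu> (cnj h) \<noteq> 0" using h slope_value_nonzero[of h \<mu>] slope_value_nonzero[of "cnj h" \<mu>] by auto
  have "minf (cnj \<i>) = cnj (minf \<i>)" by (rule minf_cnj) simp
  then have m: "minf (- \<i>) = cnj (minf \<i>)" by simp
  have c: "cmod (cnj (minf \<i>) + cnj h) = cmod (minf \<i> + h)" "cmod (cnj (minf \<i>) + h) = cmod (minf \<i> + cnj h)"
    using complex_mod_cnj[of "minf \<i> + h"] complex_mod_cnj[of "minf \<i> + cnj h"] by simp_all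
  have pp: "cmod (slope_value \<mu> h) = cmod (slope_value \<mu> (cnj h))" using complex_mod_cnj[of "slope_value \<mu> h"] by (simp only: cnj_slope_value)
  have eq: "cmod (transfer_function (schroedinger_system l q \<mu> h) (- \<i>)) = cmod (minf \<i> + h) / cmod (minf \<i> + cnj h)"
    using transfer_formula[OF h, of "- \<i>" \<mu>] nz by (simp add: norm_mult norm_divide m c pp)
  have "Im (minf \<i> + cnj h) < 0" using h Im_minf_i by simp
  then have "minf \<i> + cnj h \<noteq> 0" by (metis order_less_irrefl zero_complex.sel(2))
  then have "cmod (transfer_function (schroedinger_system l q \<mu> h) (- \<i>)) \<noteq> 0" unfolding eq using ne by simp
  then have "transfer_function (schroedinger_system l q \<mu> h) (- \<i>) \<noteq> 0" by auto
  then show ?thesis by (simp add: c_entropy_def eq)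
qed

end

section \<open>Herglotz representations\<close>

text \<open>The unit circle is parametrised by \<open>[0, 1]\<close>, so that measures on the circle become distributions on
the real line, for which Helly's selection theorem is stated.\<close>

definition circle_point :: "real \<Rightarrow> complex" where "circle_point t = exp (2 * of_real pi * \<i> * of_real t)"

lemma circle_point_norm: "cmod (circle_point t) = 1"
  by (simp add: circle_point_def)

lemma circle_point_cnj: "cnj (circle_point t) = inverse (circle_point t)"
  using circle_point_norm[of t] by (metis complex_norm_square mult_1 of_real_1 one_power2 inverse_unique)

lemma circle_point_continuous: "continuous_on A circle_point"
  unfolding circle_point_def by (intro continuous_intros)

lemma circle_point_borel[measurable]: "circle_point \<in> borel_measurable borel"
  by (intro borel_measurable_continuous_onI circle_point_continuous)

lemma circle_point_ne: "cmod w < 1 \<Longrightarrow> circle_point t - w \<noteq> 0" "cmod w < 1 \<Longrightarrow> circle_point t \<noteq> w" "circle_point t \<noteq> 0"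
  using circle_point_norm[of t] by auto

text \<open>Cauchy's integral formula on the unit circle, written as a mean value.\<close>

lemma Cauchy_mean:
  assumes f: "continuous_on (cball 0 1) f" "f holomorphic_on ball 0 1" and w: "cmod w < 1"
  shows "((\<lambda>t. f (circle_point t) * (circle_point t / (circle_point t - w))) has_integral f w) {0..1}"
proof -
  have "((\<lambda>u. f u / (u - w)) has_contour_integral (2 * of_real pi * \<i> * f w)) (circlepath 0 1)"
    using w by (intro Cauchy_integral_circlepath f) auto
  then have "((\<lambda>x. f (circlepath 0 1 x) / (circlepath 0 1 x - w) * vector_derivative (circlepath 0 1) (at x within {0..1}))
     has_integral 2 * of_real pi * \<i> * f w) {0..1}"
    by (simp add: has_contour_integral_def)
  then have "((\<lambda>t. (2 * of_real pi * \<i>) * (f (circle_point t) * (circle_point t / (circle_point t - w)))) has_integral 2 * of_real pi * \<i> * f w) {0..1}"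
  proof (rule has_integral_eq[rotated])
    fix x :: real assume x: "x \<in> {0..1}"
    have vd: "vector_derivative (circlepath 0 1) (at x within {0..1}) = 2 * of_real pi * \<i> * circle_point x"
      using x vector_derivative_circlepath01[of x 0 1] by (simp add: circle_point_def)
    have cp: "circlepath 0 1 x = circle_point x" by (simp add: circlepath circle_point_def)
    show "f (circlepath 0 1 x) / (circlepath 0 1 x - w) * vector_derivative (circlepath 0 1) (at x within {0..1}) =
      (2 * of_real pi * \<i>) * (f (circle_point x) * (circle_point x / (circle_point x - w)))"
      unfolding vd cp by simp
  qed
  from has_integral_mult_right[OF this, of "1 / (2 * of_real pi * \<i>)"] show ?thesis by simp
qed

text \<open>The Schwarz integral formula recovers a holomorphic function from its real part on the circle.
Apply Cauchy's formula to \<open>f\<close>, and to \<open>f u / (1 - cnj w u)\<close> at the point \<open>0\<close>; the conjugate of the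
latter has the same kernel as the former, since \<open>cnj u = 1 / u\<close> on the circle.\<close>

lemma Schwarz_formula:
  assumes f: "continuous_on (cball 0 1) f" "f holomorphic_on ball 0 1" and w: "cmod w < 1" and f0: "Im (f 0) = 0"
  shows "((\<lambda>t. ((circle_point t + w) / (circle_point t - w)) * of_real (Re (f (circle_point t)))) has_integral f w) {0..1}"
proof -
  have nz: "cnj w * u \<noteq> 1" if "cmod u \<le> 1" for u
  proof
    assume "cnj w * u = 1"
    then have "cmod (cnj w * u) = 1" by simp
    moreover have "cmod (cnj w * u) \<le> cmod w * 1" unfolding norm_mult complex_mod_cnj using that by (intro mult_left_mono) auto
    ultimately show False using w by simp
  qed
  have A: "((\<lambda>t. f (circle_point t) * (circle_point t / (circle_point t - w))) has_integral f w) {0..1}" by (rule Cauchy_mean[OF f w])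
  have "((\<lambda>t. f (circle_point t) / (1 - cnj w * circle_point t) * (circle_point t / (circle_point t - 0))) has_integral f 0 / (1 - cnj w * 0)) {0..1}"
  proof (rule Cauchy_mean[where f="\<lambda>u. f u / (1 - cnj w * u)"])
    show "continuous_on (cball 0 1) (\<lambda>u. f u / (1 - cnj w * u))"
      by (intro continuous_on_divide continuous_intros f) (simp add: nz)
    show "(\<lambda>u. f u / (1 - cnj w * u)) holomorphic_on ball 0 1"
      by (intro holomorphic_on_divide holomorphic_intros f) (simp add: nz)
  qed simp
  then have "((\<lambda>t. f (circle_point t) / (1 - cnj w * circle_point t)) has_integral f 0) {0..1}" using circle_point_ne(3) by simp
  from has_integral_linear[OF this bounded_linear_cnj]
  have "((\<lambda>t. cnj (f (circle_point t) / (1 - cnj w * circle_point t))) has_integral cnj (f 0)) {0..1}"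
    by (simp only: o_def)
  moreover have "cnj (f (circle_point t) / (1 - cnj w * circle_point t)) = cnj (f (circle_point t)) * (circle_point t / (circle_point t - w))" for t
    using circle_point_ne(1,2)[of w t] circle_point_ne(3)[of t] w by (simp add: circle_point_cnj field_simps)
  ultimately have B: "((\<lambda>t. cnj (f (circle_point t)) * (circle_point t / (circle_point t - w))) has_integral cnj (f 0)) {0..1}" by simp
  have "((\<lambda>t. f (circle_point t) * (circle_point t / (circle_point t - 0))) has_integral f 0) {0..1}" by (rule Cauchy_mean[OF f]) simp
  then have C: "((\<lambda>t. f (circle_point t)) has_integral f 0) {0..1}" using circle_point_ne(3) by simp
  from has_integral_linear[OF this bounded_linear_cnj]
  have C': "((\<lambda>t. cnj (f (circle_point t))) has_integral cnj (f 0)) {0..1}" by (simp only: o_def)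
  have "((\<lambda>t. (f (circle_point t) * (circle_point t / (circle_point t - w)) + cnj (f (circle_point t)) * (circle_point t / (circle_point t - w))) - (1/2) * (f (circle_point t) + cnj (f (circle_point t))))
     has_integral ((f w + cnj (f 0)) - (1/2) * (f 0 + cnj (f 0)))) {0..1}"
    by (intro has_integral_diff has_integral_add has_integral_mult_right A B C C')
  moreover have "(f (circle_point t) * (circle_point t / (circle_point t - w)) + cnj (f (circle_point t)) * (circle_point t / (circle_point t - w))) - (1/2) * (f (circle_point t) + cnj (f (circle_point t)))
     = ((circle_point t + w) / (circle_point t - w)) * of_real (Re (f (circle_point t)))" for t
  proof -
    have "f (circle_point t) + cnj (f (circle_point t)) = 2 * of_real (Re (f (circle_point t)))" by (simp add: complex_eq_iff)
    moreover have "(f (circle_point t) * (circle_point t / (circle_point t - w)) + cnj (f (circle_point t)) * (circle_point t / (circle_point t - w))) - (1/2) * (f (circle_point t) + cnj (f (circle_point t)))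
      = (f (circle_point t) + cnj (f (circle_point t))) * (circle_point t / (circle_point t - w) - 1/2)" by (simp add: algebra_simps)
    moreover define K where "K = (circle_point t + w) / (circle_point t - w)"
    have "circle_point t / (circle_point t - w) - 1/2 = K / 2"
      unfolding K_def using circle_point_ne(1,2)[of w t] w by (simp add: field_simps)
    ultimately have "(f (circle_point t) * (circle_point t / (circle_point t - w)) + cnj (f (circle_point t)) * (circle_point t / (circle_point t - w))) - (1/2) * (f (circle_point t) + cnj (f (circle_point t)))
      = (2 * of_real (Re (f (circle_point t)))) * (K / 2)" by (simp only:)
    also have "\<dots> = K * of_real (Re (f (circle_point t)))" by simp
    finally show ?thesis unfolding K_def .
  qed
  moreover have "cnj (f 0) = f 0" using f0 by (simp add: complex_eq_iff)
  ultimately show ?thesis by simp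
qed

text \<open>Herglotz's theorem on the disc. Since \<open>G\<close> need not extend to the boundary, the Schwarz formula is
used on circles of radius \<open>r n < 1\<close>, where the real part is the density of a probability measure up to the factor \<open>c\<close>.
The measures live on \<open>[0, 1]\<close>, hence are tight, and a weak limit represents \<open>G\<close>.\<close>

lemma Herglotz_disc:
  assumes G: "G holomorphic_on ball 0 1" and pos: "\<And>w. cmod w < 1 \<Longrightarrow> Re (G w) \<ge> 0"
    and G0: "G 0 = of_real c" and c: "c > 0"
  obtains M where "real_distribution M"
    "\<And>w. cmod w < 1 \<Longrightarrow> G w = of_real c * (LINT t|M. (circle_point t + w) / (circle_point t - w))"
proof -
  define r where "r n = 1 - 1 / (real n + 2)" for n :: nat
  have r: "0 < r n" "r n < 1" for n by (auto simp: r_def field_simps)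
  define f where "f n u = G (of_real (r n) * u)" for n u
  have rb: "of_real (r n) * u \<in> ball 0 1" if "cmod u \<le> 1" for n u
  proof -
    have "cmod (of_real (r n) * u) \<le> r n * 1" unfolding norm_mult using r[of n] that by (intro mult_mono) auto
    then show ?thesis using r[of n] by simp
  qed
  have fc: "continuous_on (cball 0 1) (f n)" for n
    unfolding f_def by (rule continuous_on_compose2[OF holomorphic_on_imp_continuous_on[OF G]]) (auto intro!: continuous_intros rb)
  have fh: "f n holomorphic_on ball 0 1" for n
  proof -
    have "(G \<circ> (\<lambda>u. of_real (r n) * u)) holomorphic_on ball 0 1"
      by (rule holomorphic_on_compose_gen[OF _ G]) (auto intro!: holomorphic_intros rb)
    then show ?thesis by (simp add: f_def[abs_def] o_def)
  qed
  have f0: "f n 0 = of_real c" for n by (simp add: f_def G0)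
  have fpos: "Re (f n (circle_point t)) \<ge> 0" for n t unfolding f_def using rb[of "circle_point t" n] circle_point_norm[of t] by (intro pos) auto
  have fct: "continuous_on A (\<lambda>t. Re (f n (circle_point t)))" for n A
    by (intro continuous_intros continuous_on_compose2[OF fc circle_point_continuous]) (auto simp: circle_point_norm)
  define d where "d n t = indicator {0..1} t * (Re (f n (circle_point t)) / c)" for n t
  have dm[measurable]: "d n \<in> borel_measurable borel" for n
    unfolding d_def using borel_measurable_continuous_onI[OF fct[of UNIV n]] by measurable
  have dpos: "d n t \<ge> 0" for n t using fpos c by (simp add: d_def)
  define \<mu> where "\<mu> n = density lborel (\<lambda>t. ennreal (d n t))" for n
  have int: "(LINT t|\<mu> n. h t) = (1 / of_real c) * integral {0..1} (\<lambda>t. h t * of_real (Re (f n (circle_point t))))"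
    and inti: "integrable lborel (\<lambda>t. d n t *\<^sub>R h t)"
    if h: "continuous_on UNIV h" for h :: "real \<Rightarrow> complex" and n
  proof -
    have hm: "h \<in> borel_measurable borel" using h by (rule borel_measurable_continuous_onI)
    have e: "(\<lambda>t. d n t *\<^sub>R h t) = (\<lambda>t. indicator {0..1} t *\<^sub>R ((1 / of_real c) * (h t * of_real (Re (f n (circle_point t))))))"
      by (auto simp: d_def indicator_def scaleR_conv_of_real)
    have cont: "continuous_on {0..1} (\<lambda>t. (1 / complex_of_real c) * (h t * of_real (Re (f n (circle_point t)))))"
      using c by (intro continuous_intros fct continuous_on_subset[OF h]) auto
    have si: "set_integrable lborel {0..1} (\<lambda>t. (1 / complex_of_real c) * (h t * of_real (Re (f n (circle_point t)))))"
      using cont by (rule borel_integrable_atLeastAtMost')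
    then show "integrable lborel (\<lambda>t. d n t *\<^sub>R h t)" unfolding e by (simp add: set_integrable_def)
    have "(LINT t|\<mu> n. h t) = (LINT t|lborel. d n t *\<^sub>R h t)"
      unfolding \<mu>_def by (rule integral_density) (use hm dpos in auto)
    also have "\<dots> = integral {0..1} (\<lambda>t. (1 / complex_of_real c) * (h t * of_real (Re (f n (circle_point t)))))"
      unfolding e using set_borel_integral_eq_integral(2)[OF si] unfolding set_lebesgue_integral_def .
    also have "\<dots> = (1 / of_real c) * integral {0..1} (\<lambda>t. h t * of_real (Re (f n (circle_point t))))" by (rule integral_mult_right)
    finally show "(LINT t|\<mu> n. h t) = (1 / of_real c) * integral {0..1} (\<lambda>t. h t * of_real (Re (f n (circle_point t))))" .
  qed
  have sets: "sets (\<mu> n) = sets borel" "space (\<mu> n) = UNIV" for n by (auto simp: \<mu>_def)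
  have em: "emeasure (\<mu> n) {0..1} = 1" "emeasure (\<mu> n) UNIV = 1" for n
  proof -
    have "integrable lborel (\<lambda>t. d n t *\<^sub>R (1::complex))" by (rule inti) simp
    then have di: "integrable lborel (d n)"
      using integrable_Re[of lborel "\<lambda>t. d n t *\<^sub>R (1::complex)"] by simp
    have "((\<lambda>t. ((circle_point t + 0) / (circle_point t - 0)) * of_real (Re (f n (circle_point t)))) has_integral f n 0) {0..1}"
      by (rule Schwarz_formula[OF fc fh]) (auto simp: f0)
    then have I: "integral {0..1} (\<lambda>t. of_real (Re (f n (circle_point t)))) = complex_of_real c"
      using circle_point_ne(3) by (simp add: f0 has_integral_iff)
    have "(LINT t|lborel. d n t *\<^sub>R (1::complex)) = (LINT t|\<mu> n. (1::complex))"
      unfolding \<mu>_def by (rule integral_density[symmetric]) (use dpos in auto)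
    also have "\<dots> = 1" using int[of "\<lambda>_. 1" n] I c by simp
    finally have "complex_of_real (LINT t|lborel. d n t) = 1"
      by (simp add: scaleR_conv_of_real)
    then have "(LINT t|lborel. d n t) = 1" by (simp only: of_real_eq_1_iff)
    then have nn: "(\<integral>\<^sup>+t. ennreal (d n t) \<partial>lborel) = 1"
      using nn_integral_eq_integral[OF di] dpos by simp
    then show "emeasure (\<mu> n) UNIV = 1" unfolding \<mu>_def by (subst emeasure_density) auto
    have "(\<integral>\<^sup>+t. ennreal (d n t) * indicator {0..1} t \<partial>lborel) = (\<integral>\<^sup>+t. ennreal (d n t) \<partial>lborel)"
      by (intro nn_integral_cong) (auto simp: d_def indicator_def)
    then show "emeasure (\<mu> n) {0..1} = 1" unfolding \<mu>_def using nn by (subst emeasure_density) auto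
  qed
  have rd: "real_distribution (\<mu> n)" for n
  proof -
    interpret prob_space "\<mu> n" by (rule prob_spaceI) (simp add: sets em)
    show ?thesis by unfold_locales (simp_all add: sets)
  qed
  have "tight \<mu>"
    unfolding tight_def
  proof (intro conjI allI impI)
    fix e :: real assume e: "e > 0"
    have "1 - e < measure (\<mu> n) {-1<..1}" for n
    proof -
      interpret real_distribution "\<mu> n" by (rule rd)
      have "measure (\<mu> n) {0..1} = 1" using em(1)[of n] by (simp add: measure_def)
      moreover have "measure (\<mu> n) {0..1} \<le> measure (\<mu> n) {-1<..1}"
        by (rule finite_measure_mono) (auto simp: sets)
      ultimately show ?thesis using e by linarith
    qed
    then show "\<exists>a b. a < b \<and> (\<forall>n. 1 - e < measure (\<mu> n) {a<..b})"
      by (intro exI[of _ "-1"] exI[of _ "1"]) simp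
  qed (rule rd)
  from tight_imp_convergent_subsubsequence[OF this, of id]
  obtain s M where M: "strict_mono s" "real_distribution M" "weak_conv_m (\<mu> \<circ> s) M"
    by (auto simp: strict_mono_def)
  have "G w = of_real c * (LINT t|M. (circle_point t + w) / (circle_point t - w))" if w: "cmod w < 1" for w
  proof -
    define h where "h t = (circle_point t + w) / (circle_point t - w)" for t
    have hc: "continuous_on UNIV h" unfolding h_def using w by (intro continuous_intros circle_point_continuous) (auto simp: circle_point_ne)
    have hb: "cmod (h t) \<le> 2 / (1 - cmod w)" for t
    proof -
      have "cmod (circle_point t + w) \<le> 2" using norm_triangle_ineq[of "circle_point t" w] circle_point_norm[of t] w by linarith
      moreover have "1 - cmod w \<le> cmod (circle_point t - w)" using norm_triangle_ineq2[of "circle_point t" w] circle_point_norm[of t] by simp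
      ultimately show ?thesis unfolding h_def norm_divide using w by (intro frac_le) auto
    qed
    have l1: "(\<lambda>n. LINT t|(\<mu> \<circ> s) n. h t) \<longlonglongrightarrow> (LINT t|M. h t)"
      by (rule weak_conv_imp_integral_bdd_continuous_conv[OF _ M(2,3)])
         (use rd hc hb continuous_on_eq_continuous_at in \<open>auto simp: continuous_on_eq_continuous_at\<close>)
    have l2: "(LINT t|(\<mu> \<circ> s) n. h t) = (1 / of_real c) * G (of_real (r (s n)) * w)" for n
      using int[OF hc, of "s n"] Schwarz_formula[OF fc fh w, of "s n"] f0[of "s n"]
      by (simp add: has_integral_iff h_def f_def)
    have l3: "(\<lambda>n. (1 / of_real c) * G (of_real (r (s n)) * w)) \<longlonglongrightarrow> (1 / of_real c) * G (of_real 1 * w)"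
    proof -
      have "(\<lambda>n. 1 / (real n + 2)) \<longlonglongrightarrow> 0" by real_asymp
      then have "r \<longlonglongrightarrow> 1 - 0" unfolding r_def by (intro tendsto_intros)
      then have "(\<lambda>n. r (s n)) \<longlonglongrightarrow> 1" using LIMSEQ_subseq_LIMSEQ[OF _ M(1)] by (fastforce simp: o_def)
      then have lim: "(\<lambda>n. of_real (r (s n)) * w) \<longlonglongrightarrow> of_real 1 * w" by (intro tendsto_intros)
      have "isCont G w" using holomorphic_on_imp_continuous_on[OF G] w
        by (simp add: continuous_on_eq_continuous_at)
      then have "(\<lambda>n. G (of_real (r (s n)) * w)) \<longlonglongrightarrow> G (of_real 1 * w)"
        using isCont_tendsto_compose[OF _ lim] by simp
      then show ?thesis by (intro tendsto_intros)
    qed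
    have "(LINT t|M. h t) = (1 / of_real c) * G (of_real 1 * w)"
      by (rule LIMSEQ_unique[OF l1[unfolded l2] l3])
    then show ?thesis using c by (simp add: h_def)
  qed
  then show ?thesis using that M by blast
qed

text \<open>The Cayley transform from the circle to the real line. The point \<open>1\<close> of the circle corresponds to
infinity and has to be treated separately.\<close>

definition line_point :: "real \<Rightarrow> real" where "line_point t = Re (\<i> * (1 + circle_point t) / (1 - circle_point t))"

lemma line_point_borel[measurable]: "line_point \<in> borel_measurable borel"
  unfolding line_point_def by measurable

lemma line_point: "circle_point t \<noteq> 1 \<Longrightarrow> of_real (line_point t) = \<i> * (1 + circle_point t) / (1 - circle_point t)"
proof -
  assume ne: "circle_point t \<noteq> 1"
  have "cnj (\<i> * (1 + circle_point t) / (1 - circle_point t)) = \<i> * (1 + circle_point t) / (1 - circle_point t)"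
    using ne circle_point_ne(3)[of t] by (simp add: circle_point_cnj field_simps)
  then have "Im (\<i> * (1 + circle_point t) / (1 - circle_point t)) = 0"
    by (metis complex_cnj_cancel_iff Im_complex_of_real Reals_cnj_iff complex_is_Real_iff)
  then show "of_real (line_point t) = \<i> * (1 + circle_point t) / (1 - circle_point t)"
    unfolding line_point_def by (simp only: complex_eq_iff Re_complex_of_real Im_complex_of_real)
qed

lemma kernel_transform:
  assumes z: "Im z > 0" and ne: "circle_point t \<noteq> 1"
  defines "w \<equiv> (z - \<i>) / (z + \<i>)"
  shows "\<i> * ((circle_point t + w) / (circle_point t - w)) = (1 + of_real (line_point t) * z) / (of_real (line_point t) - z)"
proof -
  define u where "u = circle_point t"
  have zi: "z + \<i> \<noteq> 0" using z by (auto simp: complex_eq_iff)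
  have u1: "1 - u \<noteq> 0" using ne by (simp add: u_def)
  have tz: "of_real (line_point t) - z \<noteq> 0" using z by (auto simp: complex_eq_iff)
  have e1: "of_real (line_point t) * (1 - u) = \<i> * (1 + u)" using line_point[OF ne] u1 by (simp add: u_def)
  define T where "T = complex_of_real (line_point t)"
  have uT: "u * (T + \<i>) = T - \<i>" using e1 unfolding T_def[symmetric] by (simp add: algebra_simps) 
  have Ti: "T + \<i> \<noteq> 0" by (auto simp: T_def complex_eq_iff)
  have u: "u = (T - \<i>) / (T + \<i>)" using uT Ti by (simp add: field_simps)
  have a: "u + w = 2 * (1 + T * z) / ((T + \<i>) * (z + \<i>))"
    unfolding u w_def using Ti zi by (simp add: add_frac_eq algebra_simps)
  have b: "u - w = 2 * \<i> * (T - z) / ((T + \<i>) * (z + \<i>))"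
    unfolding u w_def using Ti zi by (simp add: diff_frac_eq algebra_simps)
  have "\<i> * ((u + w) / (u - w)) = (1 + T * z) / (T - z)"
    unfolding a b using Ti zi tz by (simp add: T_def[symmetric] divide_simps) (simp add: algebra_simps)
  then show ?thesis by (simp add: u_def T_def)
qed

lemma Im_kernel:
  "Im z \<noteq> 0 \<Longrightarrow> Im ((1 + of_real x * z) / (of_real x - z)) = Im z * (1 + x\<^sup>2) / (cmod (of_real x - z))\<^sup>2"
proof -
  assume z: "Im z \<noteq> 0"
  have "Im ((1 + of_real x * z) / (of_real x - z)) = Im ((1 + of_real x * z) * cnj (of_real x - z)) / (cmod (of_real x - z))\<^sup>2"
    by (simp add: complex_div_cnj[of "1 + of_real x * z"] flip: of_real_power)
  also have "Im ((1 + of_real x * z) * cnj (of_real x - z)) = Im z * (1 + x\<^sup>2)"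
    by (simp add: algebra_simps power2_eq_square)
  finally show ?thesis .
qed

text \<open>The Cayley transform carries the upper half-plane to the disc. The mass at the point \<open>1\<close> of the
circle becomes the coefficient of the linear term.\<close>

theorem Herglotz_half_plane:
  assumes hol: "F holomorphic_on {z. Im z > 0}"
    and pos: "\<And>z. Im z > 0 \<Longrightarrow> Im (F z) \<ge> 0"
    and Fi: "F \<i> = \<i> * of_real c" and c: "c > 0"
  obtains M where "real_distribution M"
    "\<And>z. Im z > 0 \<Longrightarrow> F z = of_real c * (of_real (measure M {t. circle_point t = 1}) * z
       + (LINT t:{t. circle_point t \<noteq> 1}|M. (1 + of_real (line_point t) * z) / (of_real (line_point t) - z)))"
    "\<And>z. Im z > 0 \<Longrightarrow> set_integrable M {t. circle_point t \<noteq> 1} (\<lambda>t. (1 + of_real (line_point t) * z) / (of_real (line_point t) - z))"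
proof -
  define G where "G w = - \<i> * F (\<i> * (1 + w) / (1 - w))" for w
  have up: "Im (\<i> * (1 + w) / (1 - w)) > 0" if w: "cmod w < 1" for w
  proof -
    have n: "1 - w \<noteq> 0" using w by auto
    have "Im (\<i> * (1 + w) / (1 - w)) = Im (\<i> * (1 + w) * cnj (1 - w)) / (cmod (1 - w))\<^sup>2"
      by (simp add: complex_div_cnj[of "\<i> * (1 + w)"] flip: of_real_power)
    also have "Im (\<i> * (1 + w) * cnj (1 - w)) = 1 - (cmod w)\<^sup>2"
      by (simp add: cmod_power2 algebra_simps) (simp add: power2_eq_square)
    finally show ?thesis using n w by (simp add: power_less_one_iff)
  qed
  have Gh: "G holomorphic_on ball 0 1"
  proof -
    have "(F \<circ> (\<lambda>w. \<i> * (1 + w) / (1 - w))) holomorphic_on ball 0 1"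
      by (rule holomorphic_on_compose_gen[OF _ hol]) (auto intro!: holomorphic_intros up)
    then show ?thesis unfolding G_def[abs_def] o_def by (intro holomorphic_intros)
  qed
  have Gpos: "Re (G w) \<ge> 0" if "cmod w < 1" for w using pos[OF up[OF that]] by (simp add: G_def)
  have G0: "G 0 = of_real c" by (simp add: G_def Fi)
  obtain M where M: "real_distribution M"
    "\<And>w. cmod w < 1 \<Longrightarrow> G w = of_real c * (LINT t|M. (circle_point t + w) / (circle_point t - w))"
    using Herglotz_disc[OF Gh Gpos G0 c] by blast
  interpret real_distribution M by fact
  have main: "F z = of_real c * (of_real (measure M {t. circle_point t = 1}) * z
       + (LINT t:{t. circle_point t \<noteq> 1}|M. (1 + of_real (line_point t) * z) / (of_real (line_point t) - z))) \<and>
     set_integrable M {t. circle_point t \<noteq> 1} (\<lambda>t. (1 + of_real (line_point t) * z) / (of_real (line_point t) - z))"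
    if z: "Im z > 0" for z
  proof -
    define w where "w = (z - \<i>) / (z + \<i>)"
    have zi: "z + \<i> \<noteq> 0" using z by (auto simp: complex_eq_iff)
    have "(cmod (z - \<i>))\<^sup>2 < (cmod (z + \<i>))\<^sup>2" unfolding cmod_power2 using z by (simp add: power2_eq_square algebra_simps)
    then have "cmod (z - \<i>) < cmod (z + \<i>)" by (rule power_less_imp_less_base) simp
    then have w: "cmod w < 1" unfolding w_def norm_divide using zi by simp
    have zw: "\<i> * (1 + w) / (1 - w) = z"
    proof -
      have "1 + w = 2 * z / (z + \<i>)" "1 - w = 2 * \<i> / (z + \<i>)" unfolding w_def using zi by (simp_all add: field_simps)
      then show ?thesis using zi by simp
    qed
    let ?h = "\<lambda>t. \<i> * ((circle_point t + w) / (circle_point t - w))"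
    have hb: "cmod (?h t) \<le> 2 / (1 - cmod w)" for t
    proof -
      have "cmod (circle_point t + w) \<le> 2" using norm_triangle_ineq[of "circle_point t" w] circle_point_norm[of t] w by linarith
      moreover have "1 - cmod w \<le> cmod (circle_point t - w)" using norm_triangle_ineq2[of "circle_point t" w] circle_point_norm[of t] by simp
      ultimately show ?thesis unfolding norm_mult norm_divide using w by (simp add: frac_le)
    qed
    have hi: "integrable M ?h" by (rule integrable_const_bound[of _ "2 / (1 - cmod w)"]) (use hb in auto)
    have E: "{t. circle_point t = 1} \<in> sets M" "{t. circle_point t \<noteq> 1} \<in> sets M" by auto
    have s: "set_integrable M {t. circle_point t = 1} ?h" "set_integrable M {t. circle_point t \<noteq> 1} ?h"
      using integrable_mult_indicator[OF E(1) hi] integrable_mult_indicator[OF E(2) hi] by (auto simp: set_integrable_def)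
    have k: "?h t = (1 + of_real (line_point t) * z) / (of_real (line_point t) - z)" if "circle_point t \<noteq> 1" for t
      using kernel_transform[OF z that] by (simp add: w_def)
    have un: "{t. circle_point t = 1} \<union> {t. circle_point t \<noteq> 1} = UNIV" by auto
    have "F z = \<i> * G w" unfolding G_def zw by simp
    also have "\<dots> = of_real c * (\<i> * (LINT t|M. (circle_point t + w) / (circle_point t - w)))" unfolding M(2)[OF w] by simp
    also have "\<i> * (LINT t|M. (circle_point t + w) / (circle_point t - w)) = (LINT t|M. ?h t)"
      by (rule integral_mult_right_zero[symmetric])
    also have "(LINT t|M. ?h t) = (LINT t:({t. circle_point t = 1} \<union> {t. circle_point t \<noteq> 1})|M. ?h t)"
      unfolding un by (simp add: set_lebesgue_integral_def)
    also have "\<dots> = (LINT t:{t. circle_point t = 1}|M. ?h t) + (LINT t:{t. circle_point t \<noteq> 1}|M. ?h t)"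
      by (rule set_integral_Un) (use s in auto)
    also have "(LINT t:{t. circle_point t = 1}|M. ?h t) = (LINT t:{t. circle_point t = 1}|M. z)"
      using zw by (intro set_lebesgue_integral_cong) (use E in auto)
    also have "\<dots> = of_real (measure M {t. circle_point t = 1}) * z"
      using E by (simp add: set_lebesgue_integral_def scaleR_conv_of_real)
    also have "(LINT t:{t. circle_point t \<noteq> 1}|M. ?h t) = (LINT t:{t. circle_point t \<noteq> 1}|M. (1 + of_real (line_point t) * z) / (of_real (line_point t) - z))"
      using k by (intro set_lebesgue_integral_cong) (use E in auto)
    finally have 1: "F z = of_real c * (of_real (measure M {t. circle_point t = 1}) * z
       + (LINT t:{t. circle_point t \<noteq> 1}|M. (1 + of_real (line_point t) * z) / (of_real (line_point t) - z)))" .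
    have "set_integrable M {t. circle_point t \<noteq> 1} (\<lambda>t. (1 + of_real (line_point t) * z) / (of_real (line_point t) - z))"
      using s(2) k by (subst set_integrable_cong[OF refl refl, of _ _ ?h]) auto
    then show ?thesis using 1 by blast
  qed
  show ?thesis using that[OF M(1)] main by blast
qed

text \<open>Two asymptotic conditions on the imaginary axis separate the functions of a Donoghue class from
general Herglotz-Nevanlinna functions. Growth slower than linear excludes the linear term, and if
\<open>s Im (F (\<i> s))\<close> is unbounded then the representing measure is infinite, since for a finite measure
this quantity is bounded by the total mass. The condition \<open>F \<i> = \<i> (1 - \<kappa>) / (1 + \<kappa>)\<close> fixes the
normalisation and removes a real additive constant.\<close>

theorem donoghue_classI:
  assumes hol: "F holomorphic_on {z. Im z > 0}"
    and pos: "\<And>z. Im z > 0 \<Longrightarrow> Im (F z) \<ge> 0"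
    and reflection: "\<And>z. Im z > 0 \<Longrightarrow> F (cnj z) = cnj (F z)"
    and Fi: "F \<i> = \<i> * of_real ((1 - \<kappa>) / (1 + \<kappa>))" and \<kappa>: "(1 - \<kappa>) / (1 + \<kappa>) > 0"
    and lin: "((\<lambda>s. F (\<i> * of_real s) / of_real s) \<longlongrightarrow> 0) at_top"
    and unbdd: "\<And>C. \<exists>s\<ge>1. s * Im (F (\<i> * of_real s)) > C"
  shows "F \<in> donoghue_class \<kappa>"
proof -
  define c where "c = (1 - \<kappa>) / (1 + \<kappa>)"
  have c: "c > 0" using \<kappa> by (simp add: c_def)
  define E where "E = {t. circle_point t \<noteq> 1}"
  define k where "k z t = (1 + of_real (line_point t) * z) / (of_real (line_point t) - z)" for z :: complex and t
  obtain M where M: "real_distribution M" and rep0: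
    "\<And>z. Im z > 0 \<Longrightarrow> F z = of_real c * (of_real (measure M {t. circle_point t = 1}) * z
       + (LINT t:{t. circle_point t \<noteq> 1}|M. (1 + of_real (line_point t) * z) / (of_real (line_point t) - z)))"
    and ki0: "\<And>z. Im z > 0 \<Longrightarrow> set_integrable M {t. circle_point t \<noteq> 1} (\<lambda>t. (1 + of_real (line_point t) * z) / (of_real (line_point t) - z))"
    using Herglotz_half_plane[OF hol pos Fi[folded c_def] c] by blast
  have rep: "F z = of_real c * (of_real (measure M {t. circle_point t = 1}) * z + (LINT t:E|M. k z t))"
    and ki: "set_integrable M E (k z)" if "Im z > 0" for z
    using rep0[OF that] ki0[OF that] by (simp_all add: E_def k_def[abs_def])
  interpret real_distribution M by fact
  have Eb: "E \<in> sets borel" "E \<in> sets M" by (auto simp: E_def)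
  define p where "p = measure M {t. circle_point t = 1}"
  have ImF: "Im (F (\<i> * of_real s)) = c * (p * s + (LINT t:E|M. s * (1 + (line_point t)\<^sup>2) / ((line_point t)\<^sup>2 + s\<^sup>2)))"
    and ImI: "set_integrable M E (\<lambda>t. s * (1 + (line_point t)\<^sup>2) / ((line_point t)\<^sup>2 + s\<^sup>2))" if s: "s > 0" for s
  proof -
    let ?z = "\<i> * complex_of_real s"
    have z: "Im ?z > 0" using s by simp
    have Ik: "Im (k ?z t) = s * (1 + (line_point t)\<^sup>2) / ((line_point t)\<^sup>2 + s\<^sup>2)" for t
      using Im_kernel[of ?z "line_point t"] s by (simp add: k_def cmod_power2)
    have i: "integrable M (\<lambda>t. indicator E t *\<^sub>R k ?z t)" using ki[OF z] by (simp add: set_integrable_def)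
    have e: "Im (indicator E t *\<^sub>R k ?z t) = indicator E t *\<^sub>R (s * (1 + (line_point t)\<^sup>2) / ((line_point t)\<^sup>2 + s\<^sup>2))" for t
      by (simp add: Ik)
    show "set_integrable M E (\<lambda>t. s * (1 + (line_point t)\<^sup>2) / ((line_point t)\<^sup>2 + s\<^sup>2))"
      using integrable_Im[OF i] unfolding e by (simp add: set_integrable_def)
    have "Im (LINT t:E|M. k ?z t) = (LINT t:E|M. s * (1 + (line_point t)\<^sup>2) / ((line_point t)\<^sup>2 + s\<^sup>2))"
      unfolding set_lebesgue_integral_def integral_Im[OF i, symmetric] e ..
    then show "Im (F (\<i> * of_real s)) = c * (p * s + (LINT t:E|M. s * (1 + (line_point t)\<^sup>2) / ((line_point t)\<^sup>2 + s\<^sup>2)))"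
      using rep[OF z] by (simp add: p_def)
  qed
  \<comment> \<open>The mass at infinity is bounded by the growth along the imaginary axis.\<close>
  have p0: "p = 0"
  proof -
    have "c * p \<le> Im (F (\<i> * of_real s) / of_real s)" if s: "s > 0" for s
    proof -
      have "0 \<le> (LINT t:E|M. s * (1 + (line_point t)\<^sup>2) / ((line_point t)\<^sup>2 + s\<^sup>2))"
        unfolding set_lebesgue_integral_def using s by (intro Bochner_Integration.integral_nonneg) auto
      then have "c * (p * s) \<le> Im (F (\<i> * of_real s))" unfolding ImF[OF s] using c by simp
      then show ?thesis using s by (simp add: field_simps)
    qed
    then have "\<forall>\<^sub>F s in at_top. c * p \<le> Im (F (\<i> * of_real s) / of_real s)"
      by (intro eventually_mono[OF eventually_gt_at_top[of "0::real"]])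
    moreover have "((\<lambda>s. Im (F (\<i> * of_real s) / of_real s)) \<longlongrightarrow> Im 0) at_top" by (intro tendsto_intros lin)
    ultimately have "c * p \<le> Im 0" by (intro tendsto_lowerbound) auto
    then have "p \<le> 0" using c by (simp add: mult_le_0_iff)
    moreover have "p \<ge> 0" by (simp add: p_def)
    ultimately show ?thesis by simp
  qed
  have mE: "measure M E = 1"
  proof -
    have "measure M E = 1 - p" unfolding p_def E_def using prob_compl[of "{t. circle_point t = 1}"] by (simp add: Collect_neg_eq Compl_eq_Diff_UNIV)
    then show ?thesis using p0 by simp
  qed
  define wt where "wt t = indicator E t * (c * (1 + (line_point t)\<^sup>2))" for t
  have wt[measurable]: "wt \<in> borel_measurable borel" unfolding wt_def using Eb by measurable
  have wt0: "wt t \<ge> 0" for t using c by (simp add: wt_def)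
  \<comment> \<open>In terms of the points of the line, the Herglotz kernel is 1 + x^2 times the kernel of the
    Donoghue class; this factor is absorbed by the measure.\<close>
  define \<sigma> where "\<sigma> = distr (density M (\<lambda>t. ennreal (wt t))) borel line_point"
  have dI: "(LINT t|\<sigma>. g t) = (LINT t|M. wt t *\<^sub>R g (line_point t))"
    if [measurable]: "g \<in> borel_measurable borel" for g :: "real \<Rightarrow> 'b :: {banach, second_countable_topology}"
  proof -
    have "(LINT t|\<sigma>. g t) = (LINT t|density M (\<lambda>t. ennreal (wt t)). g (line_point t))"
      unfolding \<sigma>_def by (rule integral_distr) measurable
    also have "\<dots> = (LINT t|M. wt t *\<^sub>R g (line_point t))" by (rule integral_density) (auto simp: wt0)
    finally show ?thesis .
  qed
  have di: "integrable \<sigma> g \<longleftrightarrow> integrable M (\<lambda>t. wt t *\<^sub>R g (line_point t))"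
    if [measurable]: "g \<in> borel_measurable borel" for g :: "real \<Rightarrow> real"
  proof -
    have "integrable \<sigma> g \<longleftrightarrow> integrable (density M (\<lambda>t. ennreal (wt t))) (\<lambda>t. g (line_point t))"
      unfolding \<sigma>_def by (rule integrable_distr_eq) measurable
    also have "\<dots> \<longleftrightarrow> integrable M (\<lambda>t. wt t *\<^sub>R g (line_point t))" by (rule integrable_density) (auto simp: wt0)
    finally show ?thesis .
  qed
  have one: "wt t *\<^sub>R (1 / (1 + (line_point t)\<^sup>2)) = indicator E t *\<^sub>R c" for t
  proof -
    have "1 + (line_point t)\<^sup>2 \<noteq> 0" by (metis add_pos_nonneg less_irrefl zero_le_power2 zero_less_one)
    then show ?thesis by (simp add: wt_def)
  qed
  have s1: "integrable \<sigma> (\<lambda>t. 1 / (1 + t\<^sup>2))"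
  proof -
    have "integrable M (\<lambda>t. wt t *\<^sub>R (1 / (1 + (line_point t)\<^sup>2)))"
      unfolding one by (intro integrable_mult_indicator Eb) simp
    moreover have "(\<lambda>t::real. 1 / (1 + t\<^sup>2)) \<in> borel_measurable borel" by measurable
    ultimately show ?thesis using di by blast
  qed
  have s2: "(LINT t|\<sigma>. 1 / (1 + t\<^sup>2)) = c"
  proof -
    have "(LINT t|\<sigma>. 1 / (1 + t\<^sup>2)) = (LINT t|M. wt t *\<^sub>R (1 / (1 + (line_point t)\<^sup>2)))" by (rule dI) measurable
    also have "\<dots> = c" unfolding one using mE Eb by simp
    finally show ?thesis .
  qed
  have up: "F z = (LINT t|\<sigma>. 1 / (of_real t - z) - of_real t / (1 + (of_real t)\<^sup>2))" if z: "Im z > 0" for z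
  proof -
    have "(LINT t|\<sigma>. 1 / (of_real t - z) - of_real t / (1 + (of_real t)\<^sup>2)) =
       (LINT t|M. wt t *\<^sub>R (1 / (of_real (line_point t) - z) - of_real (line_point t) / (1 + (of_real (line_point t))\<^sup>2)))"
      by (rule dI) measurable
    also have "\<dots> = (LINT t|M. of_real c * (indicator E t *\<^sub>R k z t))"
    proof (rule Bochner_Integration.integral_cong[OF refl])
      fix t
      have a: "of_real (line_point t) - z \<noteq> 0" using z by (auto simp: complex_eq_iff)
      have "1 + (line_point t)\<^sup>2 \<noteq> 0" by (metis add_pos_nonneg less_irrefl zero_le_power2 zero_less_one)
      then have b: "1 + (complex_of_real (line_point t))\<^sup>2 \<noteq> 0"
        by (metis of_real_1 of_real_add of_real_eq_0_iff of_real_power)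
      have "1 / (of_real (line_point t) - z) - of_real (line_point t) / (1 + (of_real (line_point t))\<^sup>2) =
        (1 + of_real (line_point t) * z) / ((of_real (line_point t) - z) * (1 + (of_real (line_point t))\<^sup>2))"
        using a b by (simp add: diff_frac_eq power2_eq_square algebra_simps)
      then have "(1 + (complex_of_real (line_point t))\<^sup>2) * (1 / (of_real (line_point t) - z) - of_real (line_point t) / (1 + (of_real (line_point t))\<^sup>2)) = k z t"
        using a b by (simp add: k_def)
      moreover have "wt t *\<^sub>R x = of_real c * (indicator E t *\<^sub>R ((1 + (complex_of_real (line_point t))\<^sup>2) * x))" for x
        by (simp add: wt_def scaleR_conv_of_real indicator_def)
      ultimately show "wt t *\<^sub>R (1 / (of_real (line_point t) - z) - of_real (line_point t) / (1 + (of_real (line_point t))\<^sup>2)) = of_real c * (indicator E t *\<^sub>R k z t)"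
        by metis
    qed
    also have "\<dots> = of_real c * (LINT t:E|M. k z t)"
      unfolding set_lebesgue_integral_def by (rule integral_mult_right_zero)
    also have "\<dots> = F z" using rep[OF z] p0 by (simp add: p_def)
    finally show ?thesis ..
  qed
  have all: "F z = (LINT t|\<sigma>. 1 / (of_real t - z) - of_real t / (1 + (of_real t)\<^sup>2))" if z: "Im z \<noteq> 0" for z
  proof (cases "Im z > 0")
    case False
    then have z': "Im (cnj z) > 0" using z by simp
    have "F z = cnj (F (cnj z))" using reflection[OF z'] by simp
    also have "\<dots> = (LINT t|\<sigma>. cnj (1 / (of_real t - cnj z) - of_real t / (1 + (of_real t)\<^sup>2)))"
      unfolding up[OF z'] Bochner_Integration.integral_cnj ..
    finally show ?thesis by simp
  qed (rule up)
  have inf: "emeasure \<sigma> UNIV = \<infinity>"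
  proof (rule ccontr)
    assume "emeasure \<sigma> UNIV \<noteq> \<infinity>"
    then have "emeasure (density M (\<lambda>t. ennreal (wt t))) UNIV \<noteq> \<infinity>"
      unfolding \<sigma>_def by (subst (asm) emeasure_distr) auto
    then have "(\<integral>\<^sup>+t. ennreal (wt t) \<partial>M) \<noteq> \<infinity>"
      by (subst (asm) emeasure_density) auto
    then have wi: "integrable M wt"
      by (intro integrableI_nonneg) (auto simp: wt0 less_top[symmetric])
    obtain s where s: "s \<ge> 1" "s * Im (F (\<i> * of_real s)) > (LINT t|M. wt t)" using unbdd by blast
    have "s * Im (F (\<i> * of_real s)) = s * c * (LINT t:E|M. s * (1 + (line_point t)\<^sup>2) / ((line_point t)\<^sup>2 + s\<^sup>2))"
      using ImF[of s] s p0 by simp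
    also have "\<dots> = (LINT t|M. s * c * (indicator E t *\<^sub>R (s * (1 + (line_point t)\<^sup>2) / ((line_point t)\<^sup>2 + s\<^sup>2))))"
      unfolding set_lebesgue_integral_def by (rule integral_mult_right_zero[symmetric])
    also have "\<dots> \<le> (LINT t|M. wt t)"
    proof (rule integral_mono[OF _ wi])
      show "integrable M (\<lambda>t. s * c * (indicator E t *\<^sub>R (s * (1 + (line_point t)\<^sup>2) / ((line_point t)\<^sup>2 + s\<^sup>2))))"
        using ImI[of s] s by (intro integrable_mult_right) (auto simp: set_integrable_def)
      fix t
      have d: "(line_point t)\<^sup>2 + s\<^sup>2 > 0" using s by (intro add_nonneg_pos) auto
      have "s * (s * (1 + (line_point t)\<^sup>2) / ((line_point t)\<^sup>2 + s\<^sup>2)) = (1 + (line_point t)\<^sup>2) * (s\<^sup>2 / ((line_point t)\<^sup>2 + s\<^sup>2))"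
        by (simp add: power2_eq_square)
      also have "\<dots> \<le> (1 + (line_point t)\<^sup>2) * 1"
        using d by (intro mult_left_mono) (auto simp: divide_le_eq_1)
      finally have "s * (s * (1 + (line_point t)\<^sup>2) / ((line_point t)\<^sup>2 + s\<^sup>2)) \<le> 1 + (line_point t)\<^sup>2" by simp
      then have "c * (s * (s * (1 + (line_point t)\<^sup>2) / ((line_point t)\<^sup>2 + s\<^sup>2))) \<le> c * (1 + (line_point t)\<^sup>2)"
        by (rule mult_left_mono[OF _ less_imp_le[OF c]])
      then show "s * c * (indicator E t *\<^sub>R (s * (1 + (line_point t)\<^sup>2) / ((line_point t)\<^sup>2 + s\<^sup>2))) \<le> wt t"
        by (cases "t \<in> E") (auto simp: wt_def mult_ac)
    qed
    finally show False using s by simp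
  qed
  have "sets \<sigma> = sets borel" by (simp add: \<sigma>_def)
  then show ?thesis
    unfolding donoghue_class_def using inf s1 s2 all by (auto simp: c_def)
qed

section \<open>Functions with prescribed boundary values and small norm\<close>

lemma max0_power_derivative:
  "((\<lambda>t::real. (max 0 t) ^ Suc (Suc n)) has_real_derivative real (Suc (Suc n)) * (max 0 t) ^ Suc n) (at t)"
proof -
  consider "t > 0" | "t < 0" | "t = 0" by linarith
  then show ?thesis
  proof cases
    case 1
    have "((\<lambda>t::real. t ^ Suc (Suc n)) has_real_derivative real (Suc (Suc n)) * t ^ Suc n) (at t)"
      using DERIV_pow[of "Suc (Suc n)" t UNIV] by simp
    then have "((\<lambda>t::real. (max 0 t) ^ Suc (Suc n)) has_real_derivative real (Suc (Suc n)) * t ^ Suc n) (at t)"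
      by (rule has_field_derivative_transform_within_open[of _ _ _ "{0<..}"]) (use 1 in auto)
    then show ?thesis using 1 by simp
  next
    case 2
    have "((\<lambda>t::real. 0) has_real_derivative 0) (at t)" by simp
    then have "((\<lambda>t::real. (max 0 t) ^ Suc (Suc n)) has_real_derivative 0) (at t)"
      by (rule has_field_derivative_transform_within_open[of _ _ _ "{..<0}"]) (use 2 in auto)
    then show ?thesis using 2 by simp
  next
    case 3
    have "((\<lambda>h::real. (max 0 h) ^ Suc n) \<longlongrightarrow> (max 0 0) ^ Suc n) (at 0)"
      by (intro tendsto_power tendsto_max tendsto_const tendsto_ident_at)
    then have "((\<lambda>h::real. ((max 0 h) ^ Suc (Suc n) - (max 0 0) ^ Suc (Suc n)) / (h - 0)) \<longlongrightarrow> (max 0 0) ^ Suc n) (at 0)"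
    proof (rule Lim_transform_eventually)
      show "\<forall>\<^sub>F h::real in at 0. (max 0 h) ^ Suc n = ((max 0 h) ^ Suc (Suc n) - (max 0 0) ^ Suc (Suc n)) / (h - 0)"
        unfolding eventually_at_filter by (rule always_eventually) (auto simp: max_def)
    qed
    then show ?thesis using 3 by (simp add: has_field_derivative_iff)
  qed
qed

lemma L2_of_compact_support:
  assumes c: "continuous_on {l..} w" and supp: "\<And>x. x \<ge> l + r \<Longrightarrow> w x = 0"
  shows "w \<in> L2_half_line l"
    and "0 \<le> r \<Longrightarrow> (\<And>x. l \<le> x \<Longrightarrow> x \<le> l + r \<Longrightarrow> cmod (w x) \<le> C) \<Longrightarrow> sq_norm {l..} w \<le> r * C\<^sup>2"
proof -
  have sc: "sq_integrable {l..b} w" for b by (intro sq_integrable_continuous continuous_on_subset[OF c]) auto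
  have le: "sq_norm {l..b} w \<le> sq_norm {l..l + r} w" for b
    unfolding sq_norm_def set_lebesgue_integral_def
  proof (rule integral_mono)
    fix x show "indicat_real {l..b} x *\<^sub>R (cmod (w x))\<^sup>2 \<le> indicat_real {l..l + r} x *\<^sub>R (cmod (w x))\<^sup>2"
      using supp[of x] by (cases "x \<ge> l + r") (auto simp: indicator_def)
  qed (use sc in \<open>simp_all add: sq_integrable_def set_integrable_def\<close>)
  show L: "w \<in> L2_half_line l" by (rule L2_of_bounded[OF c le])
  assume r: "0 \<le> r" and C: "\<And>x. l \<le> x \<Longrightarrow> x \<le> l + r \<Longrightarrow> cmod (w x) \<le> C"
  have "sq_norm {l..} w \<le> (LINT x:{l..l+r}|lebesgue. C\<^sup>2)"
    unfolding sq_norm_def set_lebesgue_integral_def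
  proof (rule integral_mono)
    show "integrable lebesgue (\<lambda>x. indicat_real {l..} x *\<^sub>R (cmod (w x))\<^sup>2)"
      using L by (simp add: L2_iff sq_integrable_def set_integrable_def)
    have "(\<lambda>x. C\<^sup>2) absolutely_integrable_on {l..l + r}" by (rule absolutely_integrable_on_const) simp
    then show "integrable lebesgue (\<lambda>x. indicat_real {l..l + r} x *\<^sub>R C\<^sup>2)" unfolding set_integrable_def .
    fix x show "indicat_real {l..} x *\<^sub>R (cmod (w x))\<^sup>2 \<le> indicat_real {l..l + r} x *\<^sub>R C\<^sup>2"
      using supp[of x] C[of x] by (cases "x \<ge> l + r") (auto simp: indicator_def intro!: power_mono)
  qed
  also have "\<dots> = r * C\<^sup>2" using r by (simp add: set_lebesgue_integral_def)
  finally show "sq_norm {l..} w \<le> r * C\<^sup>2" .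
qed

context half_line
begin

text \<open>Boundary values at \<open>l\<close> can be prescribed arbitrarily at an arbitrarily small cost in norm. A smooth
function will not do: \<open>q\<close> is only locally summable, so \<open>q f\<close> need not be square integrable. Instead
take the solution \<open>u\<close> of \<open>diff_expr l q u = 0\<close> with the given initial values and multiply it by a
smooth enough cutoff \<open>v\<close> with \<open>v l = 1\<close>, \<open>v' l = 0\<close>. Then
\<open>diff_expr l q (u v) = - 2 u' v' - u v''\<close> no longer contains \<open>q\<close> and is continuous with compact
support.\<close>

lemma cutoff:
  fixes p0 p1 :: complex and \<epsilon> :: real
  assumes \<epsilon>: "\<epsilon> > 0"
  obtains f where "f \<in> D_star l q" "f l = p0" "dif l f l = p1" "sq_norm {l..} f \<le> \<epsilon>"
proof -
  obtain u where u: "ode_solution l q 0 u" "u l = p0" "dif l u l = p1" using ode_solution_exists by blast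
  have ru: "regular l u" using u by (simp add: ode_solution_def)
  have uc: "continuous_on {l..} u" "continuous_on {l..} (dif l u)" using regular_continuous[OF ru] by auto
  have "continuous_on {l..l+1} u" by (rule continuous_on_subset[OF uc(1)]) auto
  then have "bounded (u ` {l..l+1})" by (auto intro!: compact_imp_bounded compact_continuous_image)
  then obtain C where C: "C > 0" "\<And>x. x \<in> {l..l+1} \<Longrightarrow> cmod (u x) \<le> C" unfolding bounded_pos by blast
  define r where "r = min 1 (\<epsilon> / C\<^sup>2)"
  have r: "0 < r" "r \<le> 1" "r * C\<^sup>2 \<le> \<epsilon>"
    using \<epsilon> C by (auto simp: r_def min_def field_simps)
  define k where "k = 1 / r\<^sup>2"
  have k: "k \<ge> 0" "k * r\<^sup>2 = 1" using r by (simp_all add: k_def)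
  define s where "s x = 1 - k * (x - l)\<^sup>2" for x
  define s' where "s' x = - 2 * k * (x - l)" for x
  \<comment> \<open>The third power of the positive part is twice continuously differentiable.\<close>
  define v where "v x = (max 0 (s x)) ^ 3" for x
  define v' where "v' x = 3 * (max 0 (s x))\<^sup>2 * s' x" for x
  define v'' where "v'' x = 6 * max 0 (s x) * (s' x)\<^sup>2 + 3 * (max 0 (s x))\<^sup>2 * (- 2 * k)" for x
  have ds: "(s has_real_derivative s' x) (at x)" for x
    unfolding s_def s'_def by (rule derivative_eq_intros refl)+ (simp add: algebra_simps)
  have ds': "(s' has_real_derivative (- 2 * k)) (at x)" for x
    unfolding s'_def by (rule derivative_eq_intros refl)+ simp
  have dv: "(v has_real_derivative v' x) (at x)" for x
    using DERIV_chain2[OF max0_power_derivative[of 1 "s x"] ds]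
    by (simp add: v_def[abs_def] v'_def numeral_3_eq_3 power2_eq_square)
  have d2: "((\<lambda>x. (max 0 (s x))\<^sup>2) has_real_derivative 2 * max 0 (s x) * s' x) (at x)" for x
    using DERIV_chain2[OF max0_power_derivative[of 0 "s x"] ds] by (simp add: numeral_2_eq_2)
  have dv': "(v' has_real_derivative v'' x) (at x)" for x
    unfolding v'_def v''_def
    by (rule derivative_eq_intros d2 ds' refl)+ (simp add: power2_eq_square algebra_simps)
  have vl: "v l = 1" "v' l = 0" by (simp_all add: v_def v'_def s_def s'_def)
  have s0: "s x \<le> 0" if "x \<ge> l + r" for x
  proof -
    have "k * r\<^sup>2 \<le> k * (x - l)\<^sup>2" using that r k by (intro mult_left_mono power_mono) auto
    then show ?thesis using k by (simp add: s_def)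
  qed
  have supp: "v x = 0" "v' x = 0" "v'' x = 0" if "x \<ge> l + r" for x
    using s0[OF that] by (simp_all add: v_def v'_def v''_def max_def)
  have v01: "0 \<le> v x" "v x \<le> 1" for x
  proof -
    have "0 \<le> max 0 (s x)" "max 0 (s x) \<le> 1" using k by (auto simp: s_def)
    then show "0 \<le> v x" "v x \<le> 1" unfolding v_def by (auto intro: power_le_one)
  qed
  have vc: "continuous_on A v" "continuous_on A v'" for A
  proof -
    show "continuous_on A v" by (intro continuous_at_imp_continuous_on ballI DERIV_isCont[OF dv])
    show "continuous_on A v'" by (intro continuous_at_imp_continuous_on ballI DERIV_isCont[OF dv'])
  qed
  have v''c: "continuous_on A v''" for A
    unfolding v''_def s_def s'_def by (intro continuous_intros)
  have acv: "absolutely_continuous_on l b (\<lambda>x. complex_of_real (v x))" for b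
    by (rule ac_of_C1[of _ _ _ "\<lambda>x. of_real (v' x)"])
       (auto intro!: continuous_intros vc has_vector_derivative_of_real has_field_derivative_at_within[OF dv])
  have acv': "absolutely_continuous_on l b (\<lambda>x. complex_of_real (v' x))" for b
    by (rule ac_of_C1[of _ _ _ "\<lambda>x. of_real (v'' x)"])
       (auto intro!: continuous_intros v''c has_vector_derivative_of_real has_field_derivative_at_within[OF dv'])
  have vd: "((\<lambda>x. complex_of_real (v x)) has_vector_derivative of_real (v' x)) (at x within A)"
    "((\<lambda>x. complex_of_real (v' x)) has_vector_derivative of_real (v'' x)) (at x within A)" for x A
    by (rule has_vector_derivative_of_real[OF has_field_derivative_at_within], rule dv dv')+
  define f where "f x = u x * of_real (v x)" for x
  define f' where "f' x = u x * of_real (v' x) + dif l u x * of_real (v x)" for x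
  have zero: "f x = 0" if "x < l" for x using ru that by (simp add: f_def regular_def)
  have der: "(f has_vector_derivative f' x) (at x within {l..})" if "x \<ge> l" for x
    unfolding f_def f'_def by (rule has_vector_derivative_mult[OF regular_has_derivative[OF ru that] vd(1)])
  have acf': "locally_absolutely_continuous l f'"
    using ru unfolding regular_def locally_absolutely_continuous_def f'_def
    by (auto intro!: ac_add ac_mult acv acv')
  have rf: "regular l f" and df: "\<And>x. x \<ge> l \<Longrightarrow> dif l f x = f' x"
    using regularI[OF zero der acf'] by auto
  define w where "w x = - 2 * dif l u x * of_real (v' x) - u x * of_real (v'' x)" for x
  have wc: "continuous_on {l..} w" unfolding w_def by (intro continuous_intros uc vc v''c)
  have wL: "w \<in> L2_half_line l" by (rule L2_of_compact_support(1)[OF wc, of r]) (simp add: w_def supp)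
  obtain N where N: "negligible N"
    "\<And>x. x > l \<Longrightarrow> x \<notin> N \<Longrightarrow> (dif l u has_vector_derivative dif l (dif l u) x) (at x)"
    using regular_second_derivative[OF ru] by blast
  have "dif l (dif l f) x = u x * of_real (v'' x) + 2 * dif l u x * of_real (v' x) + dif l (dif l u) x * of_real (v x)"
    if x: "x > l" "x \<notin> N" for x
  proof (rule dif_eqI_interior[OF _ x(1)])
    have du: "(u has_vector_derivative dif l u x) (at x)"
      using regular_has_derivative[OF ru, of x] x at_within_half_line[OF x(1)] by simp
    have "(f' has_vector_derivative (u x * of_real (v'' x) + dif l u x * of_real (v' x)) +
        (dif l u x * of_real (v' x) + dif l (dif l u) x * of_real (v x))) (at x)"
      unfolding f'_def by (intro has_vector_derivative_add has_vector_derivative_mult du N(2) x vd)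
    then have "(dif l f has_vector_derivative (u x * of_real (v'' x) + dif l u x * of_real (v' x)) +
        (dif l u x * of_real (v' x) + dif l (dif l u) x * of_real (v x))) (at x)"
      by (rule has_vector_derivative_transform_within_open[of _ _ _ "{l<..}"]) (use x df in auto)
    then show "(dif l f has_vector_derivative u x * of_real (v'' x) + 2 * dif l u x * of_real (v' x) + dif l (dif l u) x * of_real (v x)) (at x)"
      by (simp add: algebra_simps)
  qed
  then have "AE x in lebesgue. x > l \<longrightarrow> dif l (dif l f) x =
      u x * of_real (v'' x) + 2 * dif l u x * of_real (v' x) + dif l (dif l u) x * of_real (v x)"
    using N(1) unfolding eventually_ae_filter_negligible by blast
  moreover have "AE x in lebesgue. x > l \<longrightarrow> dif l (dif l u) x = (of_real (q x) - 0) * u x"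
    using u(1) by (simp add: ode_solution_iff)
  ultimately have "AE x in lebesgue. x > l \<longrightarrow> w x = diff_expr l q f x"
    by eventually_elim (auto simp: w_def diff_expr_def f_def algebra_simps)
  then have Lf: "diff_expr l q f \<in> L2_half_line l" using wL by (rule L2_cong_AE)
  have fc: "continuous_on {l..} f" using regular_continuous(1)[OF rf] .
  have fs: "f x = 0" if "x \<ge> l + r" for x using supp(1)[OF that] by (simp add: f_def)
  have fb: "cmod (f x) \<le> C" if "l \<le> x" "x \<le> l + r" for x
  proof -
    have "cmod (f x) \<le> C * 1"
      unfolding f_def norm_mult using C(2)[of x] v01[of x] that r C(1) by (intro mult_mono) auto
    then show ?thesis by simp
  qed
  have "f \<in> L2_half_line l" by (rule L2_of_compact_support(1)[OF fc fs])
  then have "f \<in> D_star l q" using rf Lf by (simp add: D_star_def)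
  moreover have "sq_norm {l..} f \<le> \<epsilon>"
    using L2_of_compact_support(2)[OF fc fs less_imp_le[OF r(1)] fb] r(3) by simp
  moreover have "f l = p0" by (simp add: f_def vl u)
  moreover have "dif l f l = p1" using df[of l] by (simp add: f'_def vl u)
  ultimately show ?thesis using that by blast
qed

end

section \<open>Impedance functions as Herglotz integrals\<close>

text \<open>Impedance functions of the extremal systems have the form
\<open>F z - cnj (F w) = (z - cnj w) (y z, y w)\<close>, where \<open>y z\<close> is the square integrable solution with the
inhomogeneous boundary condition \<open>a y + b y' = s0\<close>, for real coefficients. This situation is enough
for the analytic properties that define a Donoghue class.\<close>

locale boundary_family = limit_point +
  fixes a b s0 :: real and y :: "complex \<Rightarrow> real \<Rightarrow> complex" and F :: "complex \<Rightarrow> complex"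
  assumes ab: "a \<noteq> 0 \<or> b \<noteq> 0" and s0: "s0 \<noteq> 0"
    and yD: "\<And>z. Im z \<noteq> 0 \<Longrightarrow> y z \<in> D_star l q"
    and yL: "\<And>z f. Im z \<noteq> 0 \<Longrightarrow> f \<in> L2_half_line l \<Longrightarrow> L2_inner l (diff_expr l q (y z)) f = z * L2_inner l (y z) f"
    and bc: "\<And>z. Im z \<noteq> 0 \<Longrightarrow> of_real a * y z l + of_real b * dif l (y z) l = of_real s0"
    and kernel: "\<And>z w. Im z \<noteq> 0 \<Longrightarrow> Im w \<noteq> 0 \<Longrightarrow> F z - cnj (F w) = (z - cnj w) * L2_inner l (y z) (y w)"
begin

lemma yL2: "Im z \<noteq> 0 \<Longrightarrow> y z \<in> L2_half_line l" "Im z \<noteq> 0 \<Longrightarrow> diff_expr l q (y z) \<in> L2_half_line l"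
  using yD[of z] by (auto simp: D_star_def)

definition y_norm :: "complex \<Rightarrow> real" where "y_norm z = sqrt (sq_norm {l..} (y z))"

lemma y_norm_nonneg: "y_norm z \<ge> 0" by (simp add: y_norm_def sq_norm_nonneg)

lemma F_reflection: "Im z \<noteq> 0 \<Longrightarrow> F (cnj z) = cnj (F z)"
  using kernel[of "cnj z" z] by simp

lemma Im_F: assumes "Im z \<noteq> 0" shows "Im (F z) = Im z * (y_norm z)\<^sup>2"
proof -
  have "F z - cnj (F z) = (z - cnj z) * of_real (sq_norm {l..} (y z))"
    using kernel[OF assms assms] by (simp add: L2_inner_self)
  then have "2 * Im (F z) = 2 * Im z * sq_norm {l..} (y z)" by (simp add: complex_eq_iff)
  then show ?thesis by (simp add: y_norm_def sq_norm_nonneg)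
qed

text \<open>A homogeneous boundary condition with real coefficients puts the value and the slope at \<open>l\<close> in a real
ratio, which makes the boundary term in Lagrange's identity vanish.\<close>

lemma boundary_condition_symmetric:
  assumes f: "f \<in> D_star l q" and 0: "of_real a * f l + of_real b * dif l f l = 0"
  shows "Im (L2_inner l (diff_expr l q f) f) = 0"
proof -
  have "dif l f l * cnj (f l) - f l * cnj (dif l f l) = 0"
  proof (cases "b = 0")
    case True
    then have "f l = 0" using 0 ab by simp
    then show ?thesis by simp
  next
    case False
    then have "dif l f l = of_real (- a / b) * f l" using 0 by (simp add: field_simps add_eq_0_iff)
    then show ?thesis by simp
  qed
  then have "L2_inner l (diff_expr l q f) f = L2_inner l f (diff_expr l q f)" using Lagrange_half_line[OF f f] by simp
  then have "L2_inner l (diff_expr l q f) f = cnj (L2_inner l (diff_expr l q f) f)" using L2_inner_commute by metis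
  then show ?thesis by (simp add: complex_eq_iff)
qed

text \<open>The difference of \<open>y z\<close> and \<open>y w\<close> satisfies the homogeneous boundary condition, so it is
\<open>(z - w)\<close> times the resolvent of a self-adjoint operator applied to \<open>y w\<close>, whose norm is at most
\<open>1 / \<bar>Im z\<bar>\<close>. The proof tests the equation of the difference against the difference.\<close>

lemma y_diff:
  assumes z: "Im z \<noteq> 0" and w: "Im w \<noteq> 0"
  shows "\<And>g. g \<in> L2_half_line l \<Longrightarrow> cmod (L2_inner l (y z) g - L2_inner l (y w) g) \<le> cmod (z - w) / \<bar>Im z\<bar> * y_norm w * sqrt (sq_norm {l..} g)"
    and "y_norm z \<le> y_norm w + cmod (z - w) / \<bar>Im z\<bar> * y_norm w"
proof -
  define d where "d = (\<lambda>x. 1 * y z x + (-1) * y w x)"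
  note D = D_star_diff[OF yD[OF z] yD[OF w] d_def]
  have dL: "d \<in> L2_half_line l" using D(1) by (simp add: D_star_def)
  have "of_real a * d l + of_real b * dif l d l = 0"
    unfolding D(2,3) using bc[OF z] bc[OF w] by (simp add: algebra_simps)
  then have im: "Im (L2_inner l (diff_expr l q d) d) = 0" by (rule boundary_condition_symmetric[OF D(1)])
  have "L2_inner l (diff_expr l q d) d = z * L2_inner l (y z) d - w * L2_inner l (y w) d"
    unfolding D(5)[OF D(1)] yL[OF z dL] yL[OF w dL] ..
  also have "\<dots> = z * L2_inner l d d + (z - w) * L2_inner l (y w) d"
    unfolding D(4)[OF D(1)] by (simp add: algebra_simps)
  finally have "Im (z * of_real (sq_norm {l..} d) + (z - w) * L2_inner l (y w) d) = 0"
    using im unfolding L2_inner_self by simp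
  then have "Im z * sq_norm {l..} d = - Im ((z - w) * L2_inner l (y w) d)"
    by (simp add: algebra_simps)
  then have "\<bar>Im z\<bar> * sq_norm {l..} d = \<bar>Im ((z - w) * L2_inner l (y w) d)\<bar>"
    by (metis abs_minus_cancel abs_mult abs_of_nonneg sq_norm_nonneg)
  also have "\<dots> \<le> cmod (z - w) * cmod (L2_inner l (y w) d)"
    using abs_Im_le_cmod[of "(z - w) * L2_inner l (y w) d"] by (simp add: norm_mult)
  also have "\<dots> \<le> cmod (z - w) * (y_norm w * sqrt (sq_norm {l..} d))"
    unfolding y_norm_def by (intro mult_left_mono L2_Cauchy_Schwarz yL2 w dL) auto
  finally have le: "\<bar>Im z\<bar> * (sqrt (sq_norm {l..} d) * sqrt (sq_norm {l..} d)) \<le> cmod (z - w) * y_norm w * sqrt (sq_norm {l..} d)"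
    using sq_norm_nonneg[of "{l..}" d] by (simp add: mult.assoc)
  have sd: "sqrt (sq_norm {l..} d) \<le> cmod (z - w) / \<bar>Im z\<bar> * y_norm w"
  proof (cases "sqrt (sq_norm {l..} d) = 0")
    case False
    then have "sqrt (sq_norm {l..} d) > 0" using sq_norm_nonneg[of "{l..}" d] by (simp add: less_le)
    moreover have "(\<bar>Im z\<bar> * sqrt (sq_norm {l..} d)) * sqrt (sq_norm {l..} d) \<le> (cmod (z - w) * y_norm w) * sqrt (sq_norm {l..} d)"
      using le by (simp only: mult.assoc)
    ultimately have "\<bar>Im z\<bar> * sqrt (sq_norm {l..} d) \<le> cmod (z - w) * y_norm w"
      by (rule mult_right_le_imp_le[rotated])
    then show ?thesis using z by (simp add: field_simps)
  qed (use y_norm_nonneg z in simp)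
  show any: "cmod (L2_inner l (y z) g - L2_inner l (y w) g) \<le> cmod (z - w) / \<bar>Im z\<bar> * y_norm w * sqrt (sq_norm {l..} g)"
    if g: "g \<in> L2_half_line l" for g
  proof -
    have "L2_inner l (y z) g - L2_inner l (y w) g = L2_inner l d g"
      using L2_inner_lincomb[OF yL2(1)[OF z] yL2(1)[OF w] g, of 1 "-1"] by (simp add: d_def)
    then have "cmod (L2_inner l (y z) g - L2_inner l (y w) g) \<le> sqrt (sq_norm {l..} d) * sqrt (sq_norm {l..} g)"
      using L2_Cauchy_Schwarz[OF dL g] by simp
    also have "\<dots> \<le> cmod (z - w) / \<bar>Im z\<bar> * y_norm w * sqrt (sq_norm {l..} g)"
      by (rule mult_right_mono[OF sd]) (simp add: sq_norm_nonneg)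
    finally show ?thesis .
  qed
  have "y_norm z * y_norm z = cmod (L2_inner l (y z) (y z))" by (simp add: L2_inner_self y_norm_def sq_norm_nonneg)
  also have "\<dots> \<le> cmod (L2_inner l (y w) (y z)) + cmod (L2_inner l (y z) (y z) - L2_inner l (y w) (y z))"
    by (metis norm_triangle_sub)
  also have "\<dots> \<le> y_norm w * y_norm z + cmod (z - w) / \<bar>Im z\<bar> * y_norm w * y_norm z"
    using any[OF yL2(1)[OF z]] L2_Cauchy_Schwarz[OF yL2(1)[OF w] yL2(1)[OF z]] unfolding y_norm_def by linarith
  finally have "y_norm z * y_norm z \<le> (y_norm w + cmod (z - w) / \<bar>Im z\<bar> * y_norm w) * y_norm z" by (simp add: algebra_simps)
  then show "y_norm z \<le> y_norm w + cmod (z - w) / \<bar>Im z\<bar> * y_norm w"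
    using y_norm_nonneg[of z] y_norm_nonneg[of w] by (cases "y_norm z = 0") (auto simp: mult_le_cancel_right)
qed

text \<open>By the kernel identity the difference quotient at \<open>w\<close> is the inner product of \<open>y z\<close> with
\<open>y (cnj w)\<close>, which is continuous in \<open>z\<close>.\<close>

lemma F_holomorphic: "F holomorphic_on {z. Im z > 0}"
proof (rule holomorphic_onI)
  fix w assume "w \<in> {z. Im z > 0}"
  then have w: "Im w > 0" "Im w \<noteq> 0" "Im (cnj w) \<noteq> 0" by auto
  have "((\<lambda>z. L2_inner l (y z) (y (cnj w)) - L2_inner l (y w) (y (cnj w))) \<longlongrightarrow> 0) (at w)"
  proof (rule Lim_null_comparison)
    have "((\<lambda>z. cmod (z - w) / \<bar>Im z\<bar> * y_norm w * y_norm (cnj w)) \<longlongrightarrow> cmod (w - w) / \<bar>Im w\<bar> * y_norm w * y_norm (cnj w)) (at w)"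
      using w by (intro tendsto_intros) auto
    then show "((\<lambda>z. cmod (z - w) / \<bar>Im z\<bar> * y_norm w * y_norm (cnj w)) \<longlongrightarrow> 0) (at w)" by simp
    have "\<forall>\<^sub>F z in at w. z \<in> {z. Im z > 0}"
      using w by (intro eventually_at_in_open') (auto simp: open_halfspace_Im_gt)
    then show "\<forall>\<^sub>F z in at w. norm (L2_inner l (y z) (y (cnj w)) - L2_inner l (y w) (y (cnj w))) \<le> cmod (z - w) / \<bar>Im z\<bar> * y_norm w * y_norm (cnj w)"
    proof eventually_elim
      case (elim z)
      then show ?case using y_diff(1)[OF _ w(2) yL2(1)[OF w(3)], of z] by (simp add: y_norm_def)
    qed
  qed
  then have lim: "((\<lambda>z. L2_inner l (y z) (y (cnj w))) \<longlongrightarrow> L2_inner l (y w) (y (cnj w))) (at w)"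
    by (simp add: LIM_zero_iff)
  have "((\<lambda>z. (F z - F w) / (z - w)) \<longlongrightarrow> L2_inner l (y w) (y (cnj w))) (at w)"
  proof (rule Lim_transform_eventually[OF lim])
    have "\<forall>\<^sub>F z in at w. z \<in> {z. Im z > 0} - {w}"
      using w by (intro eventually_at_in_open) (auto simp: open_halfspace_Im_gt)
    then show "\<forall>\<^sub>F z in at w. L2_inner l (y z) (y (cnj w)) = (F z - F w) / (z - w)"
    proof eventually_elim
      case (elim z)
      then show ?case using kernel[of z "cnj w"] F_reflection[OF w(2)] w by (simp add: field_simps)
    qed
  qed
  then have "(F has_field_derivative L2_inner l (y w) (y (cnj w))) (at w)" by (simp add: has_field_derivative_iff)
  then show "F field_differentiable at w within {z. Im z > 0}"
    using field_differentiable_at_within field_differentiable_def by blast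
qed

lemma y_norm_bound: "s \<ge> 1 \<Longrightarrow> y_norm (\<i> * of_real s) \<le> 2 * y_norm \<i>"
proof -
  assume s: "s \<ge> 1"
  have "\<i> * complex_of_real s - \<i> = \<i> * of_real (s - 1)" by (simp add: algebra_simps)
  then have e: "cmod (\<i> * complex_of_real s - \<i>) = s - 1" using s by (simp only: norm_mult norm_ii norm_of_real) simp
  have "cmod (\<i> * complex_of_real s - \<i>) / \<bar>Im (\<i> * complex_of_real s)\<bar> * y_norm \<i> \<le> 1 * y_norm \<i>"
    unfolding e using s y_norm_nonneg by (intro mult_right_mono) auto
  then show ?thesis using y_diff(2)[of "\<i> * of_real s" \<i>] s by simp
qed

text \<open>Subtract from \<open>y \<i>\<close> a function \<open>p\<close> of small norm with the same boundary values. The remainder \<open>f\<close>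
has zero boundary values, so \<open>z (y z, f) = (y z, diff_expr l q f)\<close> is bounded along the imaginary axis and \<open>(y z, f)\<close>
tends to zero.\<close>

lemma inner_tendsto_0: "((\<lambda>s. L2_inner l (y (\<i> * of_real s)) (y \<i>)) \<longlongrightarrow> 0) at_top"
  unfolding tendsto_iff
proof (intro allI impI)
  fix e :: real assume e: "e > 0"
  define \<eta> where "\<eta> = e / (4 * (y_norm \<i> + 1))"
  have \<eta>: "\<eta> > 0" using e y_norm_nonneg[of \<i>] by (simp add: \<eta>_def)
  obtain p where p: "p \<in> D_star l q" "p l = y \<i> l" "dif l p l = dif l (y \<i>) l" "sq_norm {l..} p \<le> \<eta>\<^sup>2"
    using cutoff[of "\<eta>\<^sup>2" "y \<i> l" "dif l (y \<i>) l"] \<eta> by (metis zero_less_power)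
  have yi: "y \<i> \<in> D_star l q" by (rule yD) simp
  define f where "f = (\<lambda>x. 1 * y \<i> x + (-1) * p x)"
  note D = D_star_diff[OF yi p(1) f_def]
  have L: "f \<in> L2_half_line l" "diff_expr l q f \<in> L2_half_line l" "p \<in> L2_half_line l" "y \<i> \<in> L2_half_line l"
    using D(1) p yi by (auto simp: D_star_def)
  define K where "K = 2 * y_norm \<i> * sqrt (sq_norm {l..} (diff_expr l q f))"
  have bound: "cmod (L2_inner l (y (\<i> * of_real s)) (y \<i>)) \<le> K / s + e / 2" if s: "s \<ge> 1" for s
  proof -
    let ?z = "\<i> * complex_of_real s"
    have z: "Im ?z \<noteq> 0" using s by simp
    have nz: "sqrt (sq_norm {l..} (y ?z)) \<le> 2 * y_norm \<i>" using y_norm_bound[OF s] by (simp add: y_norm_def)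
    have "?z * L2_inner l (y ?z) f = L2_inner l (y ?z) (diff_expr l q f)"
      using Lagrange_half_line[OF yD[OF z] D(1)] yL[OF z L(1)] D(2,3) p by simp
    then have "cmod (?z * L2_inner l (y ?z) f) \<le> sqrt (sq_norm {l..} (y ?z)) * sqrt (sq_norm {l..} (diff_expr l q f))"
      using L2_Cauchy_Schwarz[OF yL2(1)[OF z] L(2)] by simp
    also have "\<dots> \<le> K" unfolding K_def by (intro mult_right_mono nz) (simp add: sq_norm_nonneg)
    finally have 1: "cmod (L2_inner l (y ?z) f) \<le> K / s" using s by (simp add: norm_mult field_simps)
    have "cmod (L2_inner l (y ?z) p) \<le> sqrt (sq_norm {l..} (y ?z)) * sqrt (sq_norm {l..} p)"
      by (rule L2_Cauchy_Schwarz[OF yL2(1)[OF z] L(3)])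
    also have "\<dots> \<le> (2 * y_norm \<i>) * \<eta>"
    proof (rule mult_mono[OF nz])
      show "sqrt (sq_norm {l..} p) \<le> \<eta>" using p(4) \<eta> by (intro real_le_lsqrt) (auto simp: sq_norm_nonneg)
    qed (use y_norm_nonneg[of \<i>] in \<open>auto simp: sq_norm_nonneg\<close>)
    also have "\<dots> \<le> e / 2" unfolding \<eta>_def using y_norm_nonneg[of \<i>] e by (simp add: field_simps)
    finally have 2: "cmod (L2_inner l (y ?z) p) \<le> e / 2" .
    have "L2_inner l (y ?z) (y \<i>) = L2_inner l (y ?z) f + L2_inner l (y ?z) p"
    proof -
      have "L2_inner l f (y ?z) = L2_inner l (y \<i>) (y ?z) - L2_inner l p (y ?z)" by (rule D(4)[OF yD[OF z]])
      then have "cnj (L2_inner l f (y ?z)) = cnj (L2_inner l (y \<i>) (y ?z)) - cnj (L2_inner l p (y ?z))" by simp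
      then show ?thesis unfolding L2_inner_commute[of l "y ?z", symmetric] by simp
    qed
    then have "cmod (L2_inner l (y ?z) (y \<i>)) \<le> cmod (L2_inner l (y ?z) f) + cmod (L2_inner l (y ?z) p)"
      by (simp add: norm_triangle_ineq)
    then show ?thesis using 1 2 by linarith
  qed
  have "\<forall>\<^sub>F s in at_top. s > 2 * K / e" "\<forall>\<^sub>F s in at_top. s \<ge> (1::real)"
    by (rule eventually_gt_at_top, rule eventually_ge_at_top)
  then show "\<forall>\<^sub>F s in at_top. dist (L2_inner l (y (\<i> * of_real s)) (y \<i>)) 0 < e"
  proof eventually_elim
    case (elim s)
    then have "K / s < e / 2" using e by (simp add: field_simps)
    then have "cmod (L2_inner l (y (\<i> * of_real s)) (y \<i>)) < e" using bound[OF elim(2)] by linarith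
    then show ?case by simp
  qed
qed

lemma F_sublinear: "((\<lambda>s. F (\<i> * of_real s) / of_real s) \<longlongrightarrow> 0) at_top"
proof -
  have "((\<lambda>s. cnj (F \<i>) / complex_of_real s) \<longlongrightarrow> 0) at_top"
    by (rule const_over_at_top_tendsto_0[OF filterlim_ident])
  moreover have "((\<lambda>s. \<i> / complex_of_real s) \<longlongrightarrow> 0) at_top"
    by (rule const_over_at_top_tendsto_0[OF filterlim_ident])
  ultimately have "((\<lambda>s. cnj (F \<i>) / complex_of_real s + (\<i> + \<i> / of_real s) * L2_inner l (y (\<i> * of_real s)) (y \<i>)) \<longlongrightarrow> 0 + (\<i> + 0) * 0) at_top"
    by (intro tendsto_intros inner_tendsto_0)
  then have "((\<lambda>s. F (\<i> * of_real s) / of_real s) \<longlongrightarrow> 0 + (\<i> + 0) * 0) at_top"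
  proof (rule Lim_transform_eventually)
    show "\<forall>\<^sub>F s in at_top. cnj (F \<i>) / complex_of_real s + (\<i> + \<i> / of_real s) * L2_inner l (y (\<i> * of_real s)) (y \<i>) = F (\<i> * of_real s) / of_real s"
      using eventually_gt_at_top[of 0]
    proof eventually_elim
      case (elim s)
      have "F (\<i> * of_real s) = cnj (F \<i>) + (\<i> * of_real s + \<i>) * L2_inner l (y (\<i> * of_real s)) (y \<i>)"
        using kernel[of "\<i> * of_real s" \<i>] elim by (simp add: algebra_simps)
      then show ?case using elim by (simp add: add_divide_distrib distrib_right)
    qed
  qed
  then show ?thesis by simp
qed

text \<open>If \<open>t Im (F (\<i> t))\<close> were bounded, the norm of \<open>y (\<i> t)\<close> would be of order \<open>1 / t\<close>. Pair \<open>y (\<i> t)\<close>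
with a function \<open>f\<close> of small norm whose boundary values make the boundary term in Lagrange's
identity equal to \<open>- (a y + b y') = - s0\<close>: the other terms would be too small to produce it.\<close>

lemma F_unbounded: "\<exists>t\<ge>1. t * Im (F (\<i> * of_real t)) > C"
proof (rule ccontr)
  assume no: "\<not> ?thesis"
  define C' where "C' = max C 1"
  have C': "C' > 0" by (simp add: C'_def)
  have nb: "y_norm (\<i> * of_real t) \<le> sqrt C' / t" if t: "t \<ge> 1" for t
  proof -
    have "t * Im (F (\<i> * of_real t)) \<le> C'" using no t by (force simp: C'_def not_less)
    then have "t * (t * (y_norm (\<i> * of_real t))\<^sup>2) \<le> C'" using Im_F[of "\<i> * of_real t"] t by simp
    then have "(t * y_norm (\<i> * of_real t))\<^sup>2 \<le> C'" by (simp add: power_mult_distrib power2_eq_square mult_ac)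
    then have "t * y_norm (\<i> * of_real t) \<le> sqrt C'" by (rule real_le_rsqrt)
    then show ?thesis using t by (simp add: field_simps)
  qed
  define \<eta> where "\<eta> = \<bar>s0\<bar> / (4 * sqrt C')"
  have \<eta>: "\<eta> > 0" using s0 C' by (simp add: \<eta>_def)
  obtain f where f: "f \<in> D_star l q" "f l = - of_real b" "dif l f l = of_real a" "sq_norm {l..} f \<le> \<eta>\<^sup>2"
    using cutoff[of "\<eta>\<^sup>2" "- of_real b" "of_real a"] \<eta> by (metis zero_less_power)
  have L: "f \<in> L2_half_line l" "diff_expr l q f \<in> L2_half_line l" using f by (auto simp: D_star_def)
  define K where "K = sqrt (sq_norm {l..} (diff_expr l q f))"
  \<comment> \<open>With these choices both remaining terms are at most a quarter of the boundary term.\<close>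
  define t where "t = max 1 (4 * sqrt C' * K / \<bar>s0\<bar>)"
  have t: "t \<ge> 1" by (simp add: t_def)
  let ?z = "\<i> * complex_of_real t"
  have z: "Im ?z \<noteq> 0" using t by simp
  have "L2_inner l (diff_expr l q (y ?z)) f - L2_inner l (y ?z) (diff_expr l q f) = - (of_real a * y ?z l + of_real b * dif l (y ?z) l)"
    using Lagrange_half_line[OF yD[OF z] f(1)] f(2,3) by (simp add: algebra_simps)
  then have "of_real s0 = L2_inner l (y ?z) (diff_expr l q f) - ?z * L2_inner l (y ?z) f"
    unfolding bc[OF z] yL[OF z L(1)] by (simp add: algebra_simps)
  then have "\<bar>s0\<bar> \<le> cmod (L2_inner l (y ?z) (diff_expr l q f)) + t * cmod (L2_inner l (y ?z) f)"
    using norm_triangle_ineq4[of "L2_inner l (y ?z) (diff_expr l q f)" "?z * L2_inner l (y ?z) f"] t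
    by (metis norm_mult norm_of_real norm_ii mult_1 abs_of_nonneg order_trans zero_le_one)
  also have "cmod (L2_inner l (y ?z) (diff_expr l q f)) \<le> y_norm ?z * K"
    unfolding y_norm_def K_def by (rule L2_Cauchy_Schwarz[OF yL2(1)[OF z] L(2)])
  also have "y_norm ?z * K \<le> sqrt C' / t * K"
    by (intro mult_right_mono nb t) (simp add: K_def sq_norm_nonneg)
  also have "sqrt C' / t * K \<le> \<bar>s0\<bar> / 4"
  proof -
    have "4 * sqrt C' * K / \<bar>s0\<bar> \<le> t" by (simp add: t_def)
    then show ?thesis using t s0 by (simp add: field_simps)
  qed
  also have "t * cmod (L2_inner l (y ?z) f) \<le> t * (y_norm ?z * sqrt (sq_norm {l..} f))"
    unfolding y_norm_def using t by (intro mult_left_mono L2_Cauchy_Schwarz[OF yL2(1)[OF z] L(1)]) auto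
  also have "\<dots> \<le> t * (sqrt C' / t * \<eta>)"
  proof -
    have "sqrt (sq_norm {l..} f) \<le> \<eta>" using f(4) \<eta> by (intro real_le_lsqrt) (auto simp: sq_norm_nonneg)
    then have "y_norm ?z * sqrt (sq_norm {l..} f) \<le> sqrt C' / t * \<eta>"
      using t C' by (intro mult_mono nb) (auto simp: sq_norm_nonneg)
    then show ?thesis using t by (intro mult_left_mono) auto
  qed
  also have "\<dots> = \<bar>s0\<bar> / 4" using t C' by (simp add: \<eta>_def)
  finally show False using s0 by simp
qed

lemma F_in_donoghue_class:
  assumes "F \<i> = \<i> * of_real ((1 - \<kappa>) / (1 + \<kappa>))" "(1 - \<kappa>) / (1 + \<kappa>) > 0"
  shows "F \<in> donoghue_class \<kappa>"
  by (rule donoghue_classI[OF F_holomorphic _ _ assms F_sublinear F_unbounded])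
     (auto simp: Im_F F_reflection)

end

section \<open>Maximal entropy\<close>

text \<open>Adding the same non-negative number to numerator and denominator of a proper fraction brings it
closer to one.\<close>

lemma ratio_less_shift:
  fixes p r x :: real
  assumes "0 < p" "p < r" "0 \<le> x"
  shows "p / r \<le> (x + p) / (x + r) \<and> (x > 0 \<longrightarrow> p / r < (x + p) / (x + r))"
proof -
  have "(x + p) / (x + r) - p / r = x * (r - p) / (r * (x + r))"
    using assms by (simp add: field_simps)
  moreover have "0 \<le> x * (r - p) / (r * (x + r))" "x > 0 \<longrightarrow> 0 < x * (r - p) / (r * (x + r))"
    using assms by auto
  ultimately show ?thesis by auto
qed

text \<open>At \<open>\<i>\<close> the kernel reduces to \<open>\<i> / (1 + t\<^sup>2)\<close>.\<close>

lemma donoghue_class_at_i: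
  assumes "M \<in> donoghue_class \<kappa>"
  shows "M \<i> = \<i> * of_real ((1 - \<kappa>) / (1 + \<kappa>))"
proof -
  obtain \<sigma> :: "real measure" where \<sigma>: "(LINT t|\<sigma>. 1 / (1 + t\<^sup>2)) = (1 - \<kappa>) / (1 + \<kappa>)"
    "M \<i> = (LINT t|\<sigma>. 1 / (of_real t - \<i>) - of_real t / (1 + (of_real t)\<^sup>2))"
    using assms unfolding donoghue_class_def by auto
  have "1 / (complex_of_real t - \<i>) - of_real t / (1 + (of_real t)\<^sup>2) = \<i> * of_real (1 / (1 + t\<^sup>2))" for t
  proof -
    have a: "complex_of_real t - \<i> \<noteq> 0" "complex_of_real t + \<i> \<noteq> 0" by (auto simp: complex_eq_iff)
    have b: "1 + (complex_of_real t)\<^sup>2 = (complex_of_real t - \<i>) * (complex_of_real t + \<i>)"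
      by (simp add: power2_eq_square algebra_simps)
    have "\<i> * of_real (1 / (1 + t\<^sup>2)) = \<i> / (1 + (complex_of_real t)\<^sup>2)" by simp
    moreover have "1 / (complex_of_real t - \<i>) = (complex_of_real t + \<i>) / (1 + (of_real t)\<^sup>2)"
      unfolding b using a by simp
    ultimately show ?thesis by (simp add: add_divide_distrib)
  qed
  then have "M \<i> = (LINT t|\<sigma>. \<i> * of_real (1 / (1 + t\<^sup>2)))" using \<sigma>(2) by simp
  also have "\<dots> = \<i> * (LINT t|\<sigma>. of_real (1 / (1 + t\<^sup>2)))" by (rule integral_mult_right_zero)
  also have "(LINT t|\<sigma>. complex_of_real (1 / (1 + t\<^sup>2))) = of_real ((1 - \<kappa>) / (1 + \<kappa>))"
    unfolding integral_complex_of_real \<sigma>(1) ..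
  finally show ?thesis .
qed

context limit_point
begin

definition opt_h :: "real \<Rightarrow> complex" where "opt_h \<D> = Complex (- Re (minf \<i>)) \<D>"
definition opt_mu :: "real \<Rightarrow> ext_real_param" where
  "opt_mu \<D> = (if \<D> > - Im (minf \<i>) then Fin (- Re (minf \<i>)) else Infty)"

lemma weyl_multiple_inner:
  assumes "Im z \<noteq> 0" "Im w \<noteq> 0"
  shows "(z - cnj w) * L2_inner l (weyl_multiple c z) (weyl_multiple d w) = c * cnj d * (cnj (minf w) - minf z)"
proof -
  have dL: "weyl_multiple d w \<in> L2_half_line l" using weyl_multiple(1)[OF assms(2)] by (simp add: D_star_def)
  have e: "weyl_multiple c z = (\<lambda>x. c * weyl_solution z x)" "weyl_multiple d w = (\<lambda>x. d * weyl_solution w x)" by (simp_all add: weyl_multiple_def[abs_def])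
  have "L2_inner l (weyl_multiple c z) (weyl_multiple d w) = c * L2_inner l (weyl_solution z) (weyl_multiple d w)"
    unfolding e(1) by (rule L2_inner_scale[OF weyl_solution(2)[OF assms(1)] dL])
  also have "L2_inner l (weyl_solution z) (weyl_multiple d w) = cnj (d * L2_inner l (weyl_solution w) (weyl_solution z))"
    unfolding L2_inner_commute[of l "weyl_solution z" "weyl_multiple d w"] unfolding e(2)
    by (simp only: L2_inner_scale[OF weyl_solution(2)[OF assms(2)] weyl_solution(2)[OF assms(1)]])
  also have "\<dots> = cnj d * L2_inner l (weyl_solution z) (weyl_solution w)" using L2_inner_commute[of l "weyl_solution z" "weyl_solution w"] by simp
  finally show ?thesis using weyl_solution_inner[OF assms] by (simp add: mult_ac)
qed

text \<open>With \<open>Re h = - Re m\<close>, where \<open>m = m_infinity l q \<i>\<close>, the impedance function becomes \<open>(Re m - m_infinity l q z) / \<D>\<close> for a large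
and \<open>\<D> / (m_infinity l q z - Re m)\<close> for a small coefficient of dissipation. Both belong to a
boundary family of multiples of Weyl solutions, with a Dirichlet condition in the first case and the
condition \<open>Re m * y + y' = sqrt \<D>\<close> in the second. The value at \<open>\<i>\<close> is \<open>\<i>\<close> times the quotient of
\<open>\<D>\<close> and \<open>- Im m\<close>, taken in the order that makes it smaller than one.\<close>

lemma optimum_in_class:
  assumes D: "\<D> > 0" and ne: "\<D> \<noteq> - Im (minf \<i>)"
  shows "in_entropy_class l q \<D> (opt_mu \<D>) (opt_h \<D>)"
proof -
  define a where "a = Re (minf \<i>)"
  define b where "b = - Im (minf \<i>)"
  have b: "b > 0" using Im_minf_i by (simp add: b_def)
  have mi: "minf \<i> = of_real a - \<i> * of_real b" by (simp add: a_def b_def complex_eq_iff)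
  have ma: "minf z - of_real a \<noteq> 0" if "Im z \<noteq> 0" for z using Im_minf_nonzero[OF that] by (auto simp: complex_eq_iff)
  have h: "Im (opt_h \<D>) = \<D>" "Re (opt_h \<D>) = - a" "(cmod (opt_h \<D>))\<^sup>2 = a\<^sup>2 + \<D>\<^sup>2"
    by (simp_all add: opt_h_def a_def cmod_power2)
  have hp: "Im (opt_h \<D>) > 0" using D h by simp
  let ?V = "impedance_function (schroedinger_system l q (opt_mu \<D>) (opt_h \<D>))"
  have "\<exists>\<kappa>. 0 < \<kappa> \<and> \<kappa> < 1 \<and> ?V \<in> donoghue_class \<kappa>"
  proof (cases "\<D> > b")
    case True
    then have mu: "opt_mu \<D> = Fin (- a)" by (simp add: opt_mu_def a_def b_def)
    have V: "?V z = (of_real a - minf z) / of_real \<D>" if z: "Im z \<noteq> 0" for z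
    proof -
      have "impedance_denominator (Fin (- a)) (opt_h \<D>) (minf z) = - (of_real \<D> * of_real \<D>)"
        unfolding impedance_denominator_def h by (simp add: power2_eq_square)
      then have "?V z = of_real \<D> * (of_real (- a) + minf z) / (- (of_real \<D> * of_real \<D>))"
        using impedance_formula[OF hp z, of "opt_mu \<D>"] unfolding mu h by simp
      also have "\<dots> = (of_real a - minf z) / of_real \<D>" using D by (simp add: field_simps)
      finally show ?thesis .
    qed
    define c where "c = complex_of_real (1 / sqrt \<D>)"
    have cc: "c * cnj c = 1 / of_real \<D>"
      using D unfolding c_def by (simp flip: of_real_mult)
    interpret boundary_family l q "-1" 0 "1 / sqrt \<D>" "weyl_multiple c" ?V
    proof
      show "?V z - cnj (?V w) = (z - cnj w) * L2_inner l (weyl_multiple c z) (weyl_multiple c w)" if "Im z \<noteq> 0" "Im w \<noteq> 0" for z w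
        unfolding weyl_multiple_inner[OF that] cc V[OF that(1)] V[OF that(2)] by (simp add: diff_divide_distrib)
    qed (use D in \<open>auto simp: weyl_multiple c_def\<close>)
    define \<kappa> where "\<kappa> = (\<D> - b) / (\<D> + b)"
    have k: "(1 - \<kappa>) / (1 + \<kappa>) = b / \<D>"
    proof -
      have "1 - \<kappa> = 2 * b / (\<D> + b)" "1 + \<kappa> = 2 * \<D> / (\<D> + b)" using D b by (simp_all add: \<kappa>_def field_simps)
      then show ?thesis using D b by simp
    qed
    have Vi: "?V \<i> = \<i> * of_real (b / \<D>)" using V[of \<i>] D by (simp add: mi)
    have "?V \<in> donoghue_class \<kappa>"
      by (rule F_in_donoghue_class) (use Vi b D in \<open>simp_all add: k\<close>)
    moreover have "0 < \<kappa>" "\<kappa> < 1" using True D b by (auto simp: \<kappa>_def)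
    ultimately show ?thesis by blast
  next
    case False
    then have lt: "\<D> < b" using ne by (simp add: b_def)
    then have mu: "opt_mu \<D> = Infty" by (simp add: opt_mu_def b_def)
    have V: "?V z = of_real \<D> / (minf z - of_real a)" if z: "Im z \<noteq> 0" for z
      using impedance_formula[OF hp z, of "opt_mu \<D>"] unfolding mu h by (simp add: impedance_denominator_def h)
    define c where "c z = complex_of_real (sqrt \<D>) / (minf z - of_real a)" for z
    have ss: "complex_of_real (sqrt \<D>) * of_real (sqrt \<D>) = of_real \<D>" using D by (simp flip: of_real_mult)
    interpret boundary_family l q a 1 "sqrt \<D>" "\<lambda>z. weyl_multiple (c z) z" ?V
    proof
      fix z w assume zw: "Im z \<noteq> 0" "Im w \<noteq> 0"
      have m: "minf z - of_real a \<noteq> 0" "cnj (minf w) - of_real a \<noteq> 0"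
        using ma[OF zw(1)] ma[OF zw(2)] complex_cnj_cancel_iff[of "minf w" "of_real a"] by auto
      have "c z * cnj (c w) = of_real \<D> / ((minf z - of_real a) * (cnj (minf w) - of_real a))"
        by (simp add: c_def ss[symmetric])
      then show "?V z - cnj (?V w) = (z - cnj w) * L2_inner l (weyl_multiple (c z) z) (weyl_multiple (c w) w)"
        unfolding weyl_multiple_inner[OF zw] V[OF zw(1)] V[OF zw(2)] using m by (simp add: field_simps)
    next
      fix z assume z: "Im z \<noteq> 0"
      show "of_real a * weyl_multiple (c z) z l + of_real 1 * dif l (weyl_multiple (c z) z) l = of_real (sqrt \<D>)"
      proof -
        have "of_real a * weyl_multiple (c z) z l + of_real 1 * dif l (weyl_multiple (c z) z) l = c z * (minf z - of_real a)"
          unfolding weyl_multiple(2,3)[OF z] by (simp add: algebra_simps)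
        then show ?thesis using ma[OF z] by (simp add: c_def)
      qed
    qed (use D in \<open>auto simp: weyl_multiple\<close>)
    define \<kappa> where "\<kappa> = (b - \<D>) / (b + \<D>)"
    have k: "(1 - \<kappa>) / (1 + \<kappa>) = \<D> / b"
    proof -
      have "1 - \<kappa> = 2 * \<D> / (b + \<D>)" "1 + \<kappa> = 2 * b / (b + \<D>)" using D b by (simp_all add: \<kappa>_def field_simps)
      then show ?thesis using D b by simp
    qed
    have "\<i> * of_real (\<D> / b) * (- (\<i> * of_real b)) = complex_of_real \<D>" using b by (simp add: complex_eq_iff)
    then have "of_real \<D> / (- (\<i> * of_real b)) = \<i> * of_real (\<D> / b)"
      using b by (subst nonzero_divide_eq_eq) auto
    then have Vi: "?V \<i> = \<i> * of_real (\<D> / b)" using V[of \<i>] by (simp add: mi)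
    have "?V \<in> donoghue_class \<kappa>"
      by (rule F_in_donoghue_class) (use Vi b D in \<open>simp_all add: k\<close>)
    moreover have "0 < \<kappa>" "\<kappa> < 1" using lt D b by (auto simp: \<kappa>_def)
    ultimately show ?thesis by blast
  qed
  then show ?thesis using h by (simp add: in_entropy_class_def)
qed

text \<open>Write \<open>m = m_infinity l q \<i>\<close>. The value of the impedance function at \<open>\<i>\<close> must be \<open>\<i> t\<close> with \<open>0 < t < 1\<close>. For an infinite parameter
this forces \<open>\<D> = - t Im m\<close>. For a finite one, the imaginary part forces \<open>- Im m = t \<D>\<close>, and then the
real part forces \<open>\<mu> = - Re m\<close>, since \<open>t\<^sup>2 \<noteq> 1\<close>.\<close>

lemma class_mu_unique:
  assumes D: "\<D> > 0" and ne: "\<D> \<noteq> - Im (minf \<i>)"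
    and cl: "in_entropy_class l q \<D> \<mu> h" and h: "Re h = - Re (minf \<i>)"
  shows "\<mu> = opt_mu \<D>"
proof -
  define a where "a = Re (minf \<i>)"
  define b where "b = - Im (minf \<i>)"
  have b: "b > 0" using Im_minf_i by (simp add: b_def)
  have mi: "minf \<i> = of_real a - \<i> * of_real b" by (simp add: a_def b_def complex_eq_iff)
  have h': "Im h = \<D>" "Re h = - a" "(cmod h)\<^sup>2 = a\<^sup>2 + \<D>\<^sup>2"
    using cl h by (simp_all add: in_entropy_class_def a_def cmod_power2)
  obtain \<kappa> where k: "0 < \<kappa>" "\<kappa> < 1" "impedance_function (schroedinger_system l q \<mu> h) \<in> donoghue_class \<kappa>"
    using cl by (auto simp: in_entropy_class_def)
  define t where "t = (1 - \<kappa>) / (1 + \<kappa>)"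
  have t: "0 < t" "t < 1" using k by (auto simp: t_def)
  have hp: "Im h > 0" using h' D by simp
  have V: "of_real \<D> * (of_real (value_weight \<mu>) + of_real (slope_weight \<mu>) * minf \<i>) / impedance_denominator \<mu> h (minf \<i>) = \<i> * of_real t"
    using impedance_formula[OF hp, of \<i> \<mu>] donoghue_class_at_i[OF k(3)] h' by (simp add: t_def)
  have "impedance_denominator \<mu> h (minf \<i>) \<noteq> 0" using impedance_denominator_nonzero[of h "minf \<i>"] hp Im_minf_nonzero[of \<i>] by simp
  then have V': "of_real \<D> * (of_real (value_weight \<mu>) + of_real (slope_weight \<mu>) * minf \<i>) = \<i> * of_real t * impedance_denominator \<mu> h (minf \<i>)"
    using V by (simp add: field_simps)
  show ?thesis
  proof (cases \<mu>)
    case Infty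
    then have "\<D> = t * b" using V' unfolding impedance_denominator_def h' mi by (simp add: complex_eq_iff)
    then have "\<D> < b" using t b by simp
    then show ?thesis using Infty by (simp add: opt_mu_def b_def)
  next
    case (Fin m)
    define s where "s = m + a"
    have dn: "impedance_denominator \<mu> h (minf \<i>) = - (\<i> * of_real (s * b)) - of_real (\<D> * \<D>)"
      unfolding impedance_denominator_def h' mi Fin s_def by (simp add: power2_eq_square algebra_simps)
    have nm: "of_real (value_weight \<mu>) + of_real (slope_weight \<mu>) * minf \<i> = of_real s - \<i> * of_real b"
      unfolding mi Fin s_def by simp
    have "\<D> * s = t * (s * b)" "\<D> * b = t * (\<D> * \<D>)"
      using V' unfolding dn nm by (simp_all add: complex_eq_iff)
    then have "s * (\<D> - t * b) = 0" "b = t * \<D>"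
      using D by (auto simp: algebra_simps)
    moreover have "\<D> - t * (t * \<D>) \<noteq> 0"
    proof -
      have "t * t < 1" using t by (metis mult_strict_mono' mult_1 less_imp_le)
      then have "(t * t) * \<D> < 1 * \<D>" using D by (intro mult_strict_right_mono)
      then have "t * (t * \<D>) < \<D>" by (simp only: mult.assoc mult_1)
      then show ?thesis by linarith
    qed
    ultimately have "s = 0" "b < \<D>" using t D by auto
    then show ?thesis using Fin by (simp add: opt_mu_def b_def s_def a_def add_eq_0_iff2)
  qed
qed

text \<open>The modulus of von Neumann's parameter of the main operator.\<close>

definition von_neumann_ratio :: "complex \<Rightarrow> real" where
  "von_neumann_ratio h = cmod (minf \<i> + h) / cmod (minf \<i> + cnj h)"

text \<open>With \<open>m = m_infinity l q \<i>\<close> and \<open>X = (Re m + Re h)\<^sup>2\<close> the square of the ratio is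
\<open>(X + (\<D> + Im m)\<^sup>2) / (X + (\<D> - Im m)\<^sup>2)\<close>. The second summand is smaller in the numerator than in
the denominator because \<open>Im m < 0\<close>, so the ratio is smallest for \<open>X = 0\<close> only.\<close>

lemma von_neumann_ratio_minimal:
  assumes D: "\<D> > 0" and ne: "\<D> \<noteq> - Im (minf \<i>)" and h: "Im h = \<D>"
  shows "0 < von_neumann_ratio (opt_h \<D>)" "von_neumann_ratio (opt_h \<D>) \<le> von_neumann_ratio h" "von_neumann_ratio (opt_h \<D>) = von_neumann_ratio h \<Longrightarrow> h = opt_h \<D>"
    "von_neumann_ratio (opt_h \<D>) = \<bar>\<D> + Im (minf \<i>)\<bar> / \<bar>\<D> - Im (minf \<i>)\<bar>"
proof -
  define m where "m = Im (minf \<i>)"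
  have m: "m < 0" "\<D> + m \<noteq> 0" using Im_minf_i ne by (auto simp: m_def)
  define X where "X = (Re (minf \<i>) + Re h)\<^sup>2"
  have X0: "X \<ge> 0" by (simp add: X_def)
  have pq: "0 < (\<D> + m)\<^sup>2" "(\<D> + m)\<^sup>2 < (\<D> - m)\<^sup>2"
    using m mult_pos_neg[OF D m(1)] by (simp, simp add: power2_eq_square algebra_simps)
  have r2: "(von_neumann_ratio h)\<^sup>2 = (X + (\<D> + m)\<^sup>2) / (X + (\<D> - m)\<^sup>2)"
    unfolding von_neumann_ratio_def power_divide cmod_power2 by (simp add: X_def h m_def power2_eq_square algebra_simps)
  have "Im (minf \<i> + opt_h \<D>) = \<D> + m" "Re (minf \<i> + opt_h \<D>) = 0" "Im (minf \<i> + cnj (opt_h \<D>)) = - (\<D> - m)" "Re (minf \<i> + cnj (opt_h \<D>)) = 0"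
    by (simp_all add: opt_h_def m_def)
  then have "cmod (minf \<i> + opt_h \<D>) = \<bar>\<D> + m\<bar>" "cmod (minf \<i> + cnj (opt_h \<D>)) = \<bar>\<D> - m\<bar>"
    by (simp_all only: cmod_def) simp_all
  then have o: "von_neumann_ratio (opt_h \<D>) = \<bar>\<D> + m\<bar> / \<bar>\<D> - m\<bar>" by (simp add: von_neumann_ratio_def)
  then show "von_neumann_ratio (opt_h \<D>) = \<bar>\<D> + Im (minf \<i>)\<bar> / \<bar>\<D> - Im (minf \<i>)\<bar>" by (simp add: m_def)
  show "0 < von_neumann_ratio (opt_h \<D>)" unfolding o using m D by auto
  have o2: "(von_neumann_ratio (opt_h \<D>))\<^sup>2 = (\<D> + m)\<^sup>2 / (\<D> - m)\<^sup>2" unfolding o by (simp add: power_divide)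
  have le: "(\<D> + m)\<^sup>2 / (\<D> - m)\<^sup>2 \<le> (X + (\<D> + m)\<^sup>2) / (X + (\<D> - m)\<^sup>2)"
    and strict: "X > 0 \<Longrightarrow> (\<D> + m)\<^sup>2 / (\<D> - m)\<^sup>2 < (X + (\<D> + m)\<^sup>2) / (X + (\<D> - m)\<^sup>2)"
    using ratio_less_shift[OF pq X0] by auto
  have rp: "0 \<le> von_neumann_ratio h" by (simp add: von_neumann_ratio_def)
  show "von_neumann_ratio (opt_h \<D>) \<le> von_neumann_ratio h" using le rp unfolding o2[symmetric] r2[symmetric] by (rule power2_le_imp_le)
  assume "von_neumann_ratio (opt_h \<D>) = von_neumann_ratio h"
  then have "\<not> X > 0" using strict unfolding o2[symmetric] r2[symmetric] by auto
  then have "X = 0" using X0 by simp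
  then have "Re h = - Re (minf \<i>)" by (simp add: X_def)
  then show "h = opt_h \<D>" using h by (simp add: opt_h_def complex_eq_iff)
qed

lemma entropy_class_entropy:
  assumes D: "\<D> > 0" and ne: "\<D> \<noteq> - Im (minf \<i>)" and h: "Im h = \<D>"
  shows "c_entropy (schroedinger_system l q \<mu> h) = ereal (- ln (von_neumann_ratio h))" "0 < von_neumann_ratio h"
proof -
  show "0 < von_neumann_ratio h" using von_neumann_ratio_minimal(1,2)[OF D ne h] by linarith
  then have "minf \<i> + h \<noteq> 0" by (auto simp: von_neumann_ratio_def)
  then show "c_entropy (schroedinger_system l q \<mu> h) = ereal (- ln (von_neumann_ratio h))"
    using c_entropy_formula[of h \<mu>] h D by (simp add: von_neumann_ratio_def)
qed

lemma max_entropy_iff: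
  assumes D: "\<D> > 0" and ne: "\<D> \<noteq> - Im (minf \<i>)"
  shows "has_max_finite_entropy l q \<D> \<mu> h \<longleftrightarrow> h = opt_h \<D> \<and> \<mu> = opt_mu \<D>"
proof
  assume "h = opt_h \<D> \<and> \<mu> = opt_mu \<D>"
  then have e: "h = opt_h \<D>" "\<mu> = opt_mu \<D>" by auto
  have Im: "Im (opt_h \<D>) = \<D>" by (simp add: opt_h_def)
  show "has_max_finite_entropy l q \<D> \<mu> h"
    unfolding has_max_finite_entropy_def e
  proof (intro conjI allI impI)
    show "in_entropy_class l q \<D> (opt_mu \<D>) (opt_h \<D>)" by (rule optimum_in_class[OF D ne])
    show "\<bar>c_entropy (schroedinger_system l q (opt_mu \<D>) (opt_h \<D>))\<bar> \<noteq> \<infinity>"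
      by (simp add: entropy_class_entropy[OF D ne Im])
    fix \<mu>' h' assume "in_entropy_class l q \<D> \<mu>' h'"
    then have h': "Im h' = \<D>" by (simp add: in_entropy_class_def)
    show "c_entropy (schroedinger_system l q \<mu>' h') \<le> c_entropy (schroedinger_system l q (opt_mu \<D>) (opt_h \<D>))"
      unfolding entropy_class_entropy(1)[OF D ne h'] entropy_class_entropy(1)[OF D ne Im]
      using von_neumann_ratio_minimal(1,2)[OF D ne h'] by simp
  qed
next
  assume mx: "has_max_finite_entropy l q \<D> \<mu> h"
  then have cl: "in_entropy_class l q \<D> \<mu> h" by (simp add: has_max_finite_entropy_def)
  then have h: "Im h = \<D>" by (simp add: in_entropy_class_def)
  have Im: "Im (opt_h \<D>) = \<D>" by (simp add: opt_h_def)
  have "c_entropy (schroedinger_system l q (opt_mu \<D>) (opt_h \<D>)) \<le> c_entropy (schroedinger_system l q \<mu> h)"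
    using mx optimum_in_class[OF D ne] by (simp add: has_max_finite_entropy_def)
  then have "von_neumann_ratio h \<le> von_neumann_ratio (opt_h \<D>)"
    unfolding entropy_class_entropy(1)[OF D ne h] entropy_class_entropy(1)[OF D ne Im]
    using entropy_class_entropy(2)[OF D ne h] entropy_class_entropy(2)[OF D ne Im] by simp
  then have "von_neumann_ratio (opt_h \<D>) = von_neumann_ratio h" using von_neumann_ratio_minimal(2)[OF D ne h] by simp
  then have ho: "h = opt_h \<D>" by (rule von_neumann_ratio_minimal(3)[OF D ne h])
  then have "Re h = - Re (minf \<i>)" by (simp add: opt_h_def)
  then show "h = opt_h \<D> \<and> \<mu> = opt_mu \<D>" using class_mu_unique[OF D ne cl] ho by blast
qed

end

theorem theorem21:
  fixes l \<D> :: real and q :: "real \<Rightarrow> real"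
  assumes "locally_summable l q"
    and "deficiency_indices l q = (1, 1)"
    and "\<D> > 0"
    and "\<D> \<noteq> - Im (m_infinity l q \<i>)"
  shows "(\<forall>\<mu> h. has_max_finite_entropy l q \<D> \<mu> h \<longleftrightarrow>
             h = Complex (- Re (m_infinity l q \<i>)) \<D> \<and>
             \<mu> = (if \<D> > - Im (m_infinity l q \<i>) then Fin (- Re (m_infinity l q \<i>)) else Infty)) \<and>
         (\<forall>\<mu> h. has_max_finite_entropy l q \<D> \<mu> h \<longrightarrow>
             c_entropy (schroedinger_system l q \<mu> h) =
               ereal (ln \<bar>\<D> - Im (m_infinity l q \<i>)\<bar> - ln \<bar>\<D> + Im (m_infinity l q \<i>)\<bar>))"
proof -
  interpret limit_point l q by unfold_locales fact+
  note D = assms(3,4)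
  have val: "c_entropy (schroedinger_system l q \<mu> h) =
      ereal (ln \<bar>\<D> - Im (minf \<i>)\<bar> - ln \<bar>\<D> + Im (minf \<i>)\<bar>)"
    if "has_max_finite_entropy l q \<D> \<mu> h" for \<mu> h
  proof -
    have ho: "h = opt_h \<D>" using that max_entropy_iff[OF D] by blast
    then have h: "Im h = \<D>" by (simp add: opt_h_def)
    have "\<D> + Im (minf \<i>) \<noteq> 0" "\<D> - Im (minf \<i>) \<noteq> 0" using D Im_minf_i by auto
    then show ?thesis
      unfolding entropy_class_entropy(1)[OF D h] unfolding ho von_neumann_ratio_minimal(4)[OF D h]
      by (simp add: ln_div)
  qed
  show ?thesis
    using max_entropy_iff[OF D] val unfolding opt_h_def opt_mu_def by blast
qed

end
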